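(* There is a randomized algorithm (ApproxGTRS) with the following guarantee. Given $q_0,q_1$ satisfying Assumption (A), a pair $(\xi,\zeta)$ such that $(q_0,q_1)$ is $(\xi,\zeta)$-regular, a number $\hat\gamma\geq 0$ with $\lambda_{\min}(A(\hat\gamma))\geq\xi$, an error parameter $0<\epsilon_r\leq\kappa^3\xi$ (where $\kappa=\zeta/\xi$), and a failure probability $p_r>0$, it outputs $\bar x\in\mathbb{R}^n$ such that, with probability at least $1-p_r$, $$q_0(\bar x)\leq\mathrm{Opt}+\epsilon_r,\qquad q_1(\bar x)=0.$$ The algorithm runs in time $$\tilde O\left(\frac{N\kappa^2\sqrt{\zeta}}{\sqrt{\epsilon_r}}\log\left(\frac{n}{p_r}\right)\log\left(\frac{\kappa}{\epsilon_r}\right)\right).$$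
   Context: For symmetric $A_0,A_1\in\mathbb{R}^{n\times n}$, $b_0,b_1\in\mathbb{R}^n$, $c_0,c_1\in\mathbb{R}$, let $q_i(x)=x^\top A_ix+2b_i^\top x+c_i$ ($i=0,1$). For $\gamma\in\mathbb{R}$ let $A(\gamma)=A_0+\gamma A_1$. $\mathrm{Opt}:=\min\{q_0(x): q_1(x)\leq 0\}$. Assumption (A): $A_0$ and $A_1$ each have a negative eigenvalue, there exists $\gamma^*\geq 0$ with $A(\gamma^* )\succ 0$, and $\|A_0\|,\|A_1\|,\|b_0\|,\|b_1\|,|c_1|\leq 1$ (spectral norm for matrices, Euclidean norm for vectors). Under (A), $\Gamma:=\{\gamma\geq0: A(\gamma)\succeq 0\}$ is a nonempty compact interval $[\gamma_-,\gamma_+]$. Regularity: $\xi^*:=\min\{1,\max_{\gamma\geq 0}\lambda_{\min}(A(\gamma))\}$, $\zeta^*:=\max\{1,\gamma_+\}$; $(q_0,q_1)$ is $(\xi,\zeta)$-regular if $0<\xi\leq\xi^*$ and $\zeta\geq\zeta^*$. $\lambda_{\min}$ is the smallest eigenvalue. $N$ is the number of nonzero entries of $A_0$ and $A_1$; $\tilde O$ hides $\log\log$ factors.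
   Formalization: In the running time, log(n/p_r) and log(κ/ε_r) are read as max(1, log), since within the allowed range (e.g. ε_r > κ) the literal logarithm is zero or negative; Õ hides a fixed power of such truncated loglog factors of n/p_r, κ and κ/ε_r. *)

theory Defs
  imports
    "HOL-Probability.Probability"
    "Jordan_Normal_Form.Char_Poly"
begin

hide_type (open) Finite_Cartesian_Product.vec
hide_const (open) Finite_Cartesian_Product.vec Finite_Cartesian_Product.transpose
no_notation Finite_Cartesian_Product.vec_nth (infixl "$" 90)
no_notation inner (infix "\<bullet>" 70)


section \<open>The generalized trust region subproblem\<close>

definition euclid_norm :: "real vec \<Rightarrow> real" where
  "euclid_norm v = sqrt (v \<bullet> v)"

definition spectral_norm :: "real mat \<Rightarrow> real" where
  "spectral_norm A =
     (SUP x \<in> {x \<in> carrier_vec (dim_col A). euclid_norm x \<le> 1}. euclid_norm (A *\<^sub>v x))"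

definition sym_mat :: "real mat \<Rightarrow> bool" where
  "sym_mat A \<longleftrightarrow> transpose_mat A = A"

definition pos_def :: "real mat \<Rightarrow> bool" where
  "pos_def A \<longleftrightarrow> (\<forall>x \<in> carrier_vec (dim_row A). x \<noteq> 0\<^sub>v (dim_row A) \<longrightarrow> x \<bullet> (A *\<^sub>v x) > 0)"

definition pos_semidef :: "real mat \<Rightarrow> bool" where
  "pos_semidef A \<longleftrightarrow> (\<forall>x \<in> carrier_vec (dim_row A). x \<bullet> (A *\<^sub>v x) \<ge> 0)"

definition lambda_min :: "real mat \<Rightarrow> real" where
  "lambda_min A = Min {k. eigenvalue A k}"

definition quad :: "real mat \<Rightarrow> real vec \<Rightarrow> real \<Rightarrow> real vec \<Rightarrow> real" where
  "quad A b c x = x \<bullet> (A *\<^sub>v x) + 2 * (b \<bullet> x) + c"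

definition pencil :: "real mat \<Rightarrow> real mat \<Rightarrow> real \<Rightarrow> real mat" where
  "pencil A0 A1 \<gamma> = A0 + \<gamma> \<cdot>\<^sub>m A1"

definition Opt ::
  "nat \<Rightarrow> real mat \<Rightarrow> real mat \<Rightarrow> real vec \<Rightarrow> real vec \<Rightarrow> real \<Rightarrow> real \<Rightarrow> real" where
  "Opt n A0 A1 b0 b1 c0 c1 =
     (LEAST v. \<exists>x \<in> carrier_vec n. quad A1 b1 c1 x \<le> 0 \<and> v = quad A0 b0 c0 x)"

definition assumption_A ::
  "nat \<Rightarrow> real mat \<Rightarrow> real mat \<Rightarrow> real vec \<Rightarrow> real vec \<Rightarrow> real \<Rightarrow> bool" where
  "assumption_A n A0 A1 b0 b1 c1 \<longleftrightarrow>
     A0 \<in> carrier_mat n n \<and> A1 \<in> carrier_mat n n \<and> sym_mat A0 \<and> sym_mat A1 \<and>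
     b0 \<in> carrier_vec n \<and> b1 \<in> carrier_vec n \<and>
     (\<exists>k < 0. eigenvalue A0 k) \<and> (\<exists>k < 0. eigenvalue A1 k) \<and>
     (\<exists>\<gamma> \<ge> 0. pos_def (pencil A0 A1 \<gamma>)) \<and>
     spectral_norm A0 \<le> 1 \<and> spectral_norm A1 \<le> 1 \<and>
     euclid_norm b0 \<le> 1 \<and> euclid_norm b1 \<le> 1 \<and> \<bar>c1\<bar> \<le> 1"

definition Gamma :: "real mat \<Rightarrow> real mat \<Rightarrow> real set" where
  "Gamma A0 A1 = {\<gamma>. \<gamma> \<ge> 0 \<and> pos_semidef (pencil A0 A1 \<gamma>)}"

definition gamma_plus :: "real mat \<Rightarrow> real mat \<Rightarrow> real" where
  "gamma_plus A0 A1 = (GREATEST \<gamma>. \<gamma> \<in> Gamma A0 A1)"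

definition xi_star :: "real mat \<Rightarrow> real mat \<Rightarrow> real" where
  "xi_star A0 A1 = min 1 (GREATEST v. \<exists>\<gamma> \<ge> 0. v = lambda_min (pencil A0 A1 \<gamma>))"

definition zeta_star :: "real mat \<Rightarrow> real mat \<Rightarrow> real" where
  "zeta_star A0 A1 = max 1 (gamma_plus A0 A1)"

definition regular :: "real mat \<Rightarrow> real mat \<Rightarrow> real \<Rightarrow> real \<Rightarrow> bool" where
  "regular A0 A1 \<xi> \<zeta> \<longleftrightarrow> 0 < \<xi> \<and> \<xi> \<le> xi_star A0 A1 \<and> \<zeta> \<ge> zeta_star A0 A1"

definition nnz :: "real mat \<Rightarrow> nat" where
  "nnz A = card {(i, j). i < dim_row A \<and> j < dim_col A \<and> A $$ (i, j) \<noteq> 0}"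


section \<open>Randomized real random access machines\<close>

text \<open>
  The model of computation is the unit-cost real RAM with exact real arithmetic, square roots,
  comparisons, and draws from the standard normal distribution. Index arithmetic lives in separate
  natural-number registers and memory; there is no rounding from reals to naturals. Programs
  contain only natural and rational constants, and a program addresses finitely many registers
  directly and the memories indirectly, so that one fixed program handles inputs of every size.
\<close>

datatype instr =
    NConst nat nat
  | NAdd nat nat nat
  | NSub nat nat nat
  | NLoad nat nat
  | NStore nat nat
  | RConst nat rat
  | ROfNat nat nat
  | RAdd nat nat nat
  | RSub nat nat nat
  | RMul nat nat nat
  | RDiv nat nat nat
  | RSqrt nat nat
  | RLoad nat nat
  | RStore nat nat
  | RNormal nat
  | Jump nat
  | JumpN nat nat
  | JumpR nat nat

type_synonym program = "instr list"

record state =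
  pc :: nat
  nreg :: "nat \<Rightarrow> nat"
  rreg :: "nat \<Rightarrow> real"
  nmem :: "nat \<Rightarrow> nat"
  rmem :: "nat \<Rightarrow> real"
  draws :: nat  \<comment> \<open>number of random samples consumed so far\<close>

definition set_n :: "nat \<Rightarrow> nat \<Rightarrow> state \<Rightarrow> state" where
  "set_n a v s = s\<lparr>pc := Suc (pc s), nreg := (nreg s)(a := v)\<rparr>"

definition set_r :: "nat \<Rightarrow> real \<Rightarrow> state \<Rightarrow> state" where
  "set_r a v s = s\<lparr>pc := Suc (pc s), rreg := (rreg s)(a := v)\<rparr>"

text \<open>The sequence \<open>\<omega>\<close> supplies the random samples.\<close>

fun exec :: "(nat \<Rightarrow> real) \<Rightarrow> instr \<Rightarrow> state \<Rightarrow> state" where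
  "exec \<omega> (NConst a k) s = set_n a k s"
| "exec \<omega> (NAdd a b c) s = set_n a (nreg s b + nreg s c) s"
| "exec \<omega> (NSub a b c) s = set_n a (nreg s b - nreg s c) s"
| "exec \<omega> (NLoad a b) s = set_n a (nmem s (nreg s b)) s"
| "exec \<omega> (NStore a b) s =
     s\<lparr>pc := Suc (pc s), nmem := (nmem s)(nreg s a := nreg s b)\<rparr>"
| "exec \<omega> (RConst a q) s = set_r a (of_rat q) s"
| "exec \<omega> (ROfNat a b) s = set_r a (real (nreg s b)) s"
| "exec \<omega> (RAdd a b c) s = set_r a (rreg s b + rreg s c) s"
| "exec \<omega> (RSub a b c) s = set_r a (rreg s b - rreg s c) s"
| "exec \<omega> (RMul a b c) s = set_r a (rreg s b * rreg s c) s"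
| "exec \<omega> (RDiv a b c) s = set_r a (rreg s b / rreg s c) s"
| "exec \<omega> (RSqrt a b) s = set_r a (sqrt (rreg s b)) s"
| "exec \<omega> (RLoad a b) s = set_r a (rmem s (nreg s b)) s"
| "exec \<omega> (RStore a b) s =
     s\<lparr>pc := Suc (pc s), rmem := (rmem s)(nreg s a := rreg s b)\<rparr>"
| "exec \<omega> (RNormal a) s = (set_r a (\<omega> (draws s)) s)\<lparr>draws := Suc (draws s)\<rparr>"
| "exec \<omega> (Jump l) s = s\<lparr>pc := l\<rparr>"
| "exec \<omega> (JumpN a l) s = s\<lparr>pc := (if nreg s a = 0 then l else Suc (pc s))\<rparr>"
| "exec \<omega> (JumpR a l) s = s\<lparr>pc := (if rreg s a \<le> 0 then l else Suc (pc s))\<rparr>"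

definition halted :: "program \<Rightarrow> state \<Rightarrow> bool" where
  "halted P s \<longleftrightarrow> length P \<le> pc s"

definition step :: "program \<Rightarrow> (nat \<Rightarrow> real) \<Rightarrow> state \<Rightarrow> state" where
  "step P \<omega> s = (if halted P s then s else exec \<omega> (P ! pc s) s)"

definition run :: "program \<Rightarrow> (nat \<Rightarrow> real) \<Rightarrow> state \<Rightarrow> nat \<Rightarrow> state" where
  "run P \<omega> s t = (step P \<omega> ^^ t) s"

definition halts_within :: "program \<Rightarrow> (nat \<Rightarrow> real) \<Rightarrow> state \<Rightarrow> real \<Rightarrow> bool" where
  "halts_within P \<omega> s T \<longleftrightarrow> (\<exists>t. real t \<le> T \<and> halted P (run P \<omega> s t))"

definition final_state :: "program \<Rightarrow> (nat \<Rightarrow> real) \<Rightarrow> state \<Rightarrow> state" where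
  "final_state P \<omega> s = run P \<omega> s (LEAST t. halted P (run P \<omega> s t))"

definition samples :: "(nat \<Rightarrow> real) measure" where
  "samples = (\<Pi>\<^sub>M i \<in> UNIV. density lborel (\<lambda>x. ennreal (std_normal_density x)))"


section \<open>Input and output conventions\<close>

definition load_list :: "'a::zero list \<Rightarrow> nat \<Rightarrow> 'a" where
  "load_list xs i = (if i < length xs then xs ! i else 0)"

definition nz_entries :: "real mat \<Rightarrow> (nat \<times> nat) list" where
  "nz_entries A = filter (\<lambda>ij. A $$ ij \<noteq> 0) (List.product [0..<dim_row A] [0..<dim_col A])"

text \<open>
  Matrices are passed as sparse coordinate lists: the positions of the nonzero entries go to the
  natural-number memory, their values to the real memory, in the same order.
\<close>

definition gtrs_input ::
  "nat \<Rightarrow> real mat \<Rightarrow> real mat \<Rightarrow> real vec \<Rightarrow> real vec \<Rightarrow> real \<Rightarrow> real \<Rightarrow>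
   real \<Rightarrow> real \<Rightarrow> real \<Rightarrow> real \<Rightarrow> real \<Rightarrow> state" where
  "gtrs_input n A0 A1 b0 b1 c0 c1 \<xi> \<zeta> \<gamma> \<epsilon> p =
     \<lparr> pc = 0, nreg = (\<lambda>_. 0), rreg = (\<lambda>_. 0),
       nmem = load_list ([n, nnz A0, nnz A1]
                @ concat (map (\<lambda>(i, j). [i, j]) (nz_entries A0 @ nz_entries A1))),
       rmem = load_list ([\<xi>, \<zeta>, \<gamma>, \<epsilon>, p, c0, c1]
                @ list_of_vec b0 @ list_of_vec b1
                @ map (\<lambda>ij. A0 $$ ij) (nz_entries A0) @ map (\<lambda>ij. A1 $$ ij) (nz_entries A1)),
       draws = 0 \<rparr>"

definition output_vec :: "nat \<Rightarrow> state \<Rightarrow> real vec" where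
  "output_vec n s = Matrix.vec n (rmem s)"


section \<open>Logarithmic factors\<close>

text \<open>
  Logarithms in running times are bounded below by 1. The admissible parameters include cases with
  \<open>\<kappa> / \<epsilon> < 1\<close>, where the plain logarithm is negative.
\<close>

definition log1 :: "real \<Rightarrow> real" where
  "log1 x = max 1 (ln x)"

definition loglog1 :: "real \<Rightarrow> real" where
  "loglog1 x = log1 (log1 x)"

end

theory Submission
  imports Defs
begin

text \<open>
  Write \<open>q(\<gamma>, x) = q\<^sub>0(x) + \<gamma> q\<^sub>1(x)\<close>. The optimum \<open>x*\<close> satisfies \<open>q\<^sub>1(x*) = 0\<close>, so
  \<open>q(\<gamma>, x*) = Opt\<close> for every real \<open>\<gamma>\<close>, and \<open>|x*| \<le> 6 \<kappa>\<close>. Hence neither duality nor exact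
  semidefiniteness is needed: with \<open>\<sigma> = \<epsilon> / (72 \<kappa>\<^sup>3)\<close> it suffices to find \<open>\<gamma>\<^sub>1 < \<gamma>h < \<gamma>\<^sub>2\<close> with
  \<open>A(\<gamma>\<^sub>i) \<ge> - \<sigma>\<close> together with vectors \<open>v\<^sub>i\<close> of negative curvature, \<open>v\<^sub>i\<^sup>T A(\<gamma>\<^sub>i) v\<^sub>i < 0\<close>.

  Both come from bisection starting at \<open>\<gamma>h\<close>. A test of \<open>A(\<gamma>)\<close> applies a Chebyshev polynomial of
  \<open>M = 1 - c A(\<gamma>)\<close> to a Gaussian vector \<open>g\<close>; the polynomial identity
  \<open>(1 - M) W\<^sup>2 + (1 + M) V\<^sup>2 = 2\<close> shows that \<open>W(M) g\<close> has negative curvature as soon as \<open>V(M) g\<close> is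
  large, which happens with high probability if \<open>A(\<gamma>)\<close> has an eigenvalue below \<open>- \<sigma> / 2\<close>. The tests
  are adaptive, but each one uses fresh samples, so the failure probabilities add up.

  Nesterov's method applied to \<open>max\<^sub>i q(\<gamma>\<^sub>i, x) + \<sigma> |x|\<^sup>2\<close> yields \<open>x\<close> with \<open>q(\<gamma>\<^sub>i, x) \<le> Opt + \<epsilon>\<close> for
  both \<open>i\<close>. Finally \<open>x + r v\<^sub>i\<close>, where \<open>i\<close> is chosen by the sign of \<open>q\<^sub>1(x)\<close> and \<open>r\<close> is the root of
  \<open>q\<^sub>1(x + r v\<^sub>i)\<close> along which \<open>q(\<gamma>\<^sub>i, \<cdot>)\<close> does not increase to first order, satisfies \<open>q\<^sub>1 = 0\<close> and
  has \<open>q\<^sub>0 = q(\<gamma>\<^sub>i, \<cdot>) \<le> Opt + \<epsilon>\<close>.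

  The regularization carries a factor \<open>\<kappa>\<^sup>3\<close> where \<open>\<kappa>\<^sup>4\<close> would be affordable; this slack of
  \<open>\<surd>\<kappa>\<close> iterations pays for the logarithm of \<open>\<kappa>\<close> in the number of bisection steps.
\<close>

section \<open>Structured programs on the machine\<close>

text \<open>Letting the left multiplier be negative makes the two sides alike. At \<gamma> = 0 the
  form A0 may be only barely indefinite, so no margin is available there, whereas at - \<zeta> and
  at 2 \<zeta> some unit vector has form at most - \<xi> / 3. Both bisections therefore end with a
  witness: the lower bound - \<sigma> \<ge> - \<xi> / 72 excludes that the outer end never moved. A
  test errs on one side only. A vector of negative form is a certificate, so only the answer that
  none was found depends on luck. The form at \<gamma>h is positive, so a witness at a multiplier
  above \<gamma>h has negative A1-curvature and one below \<gamma>h has positive A1-curvature. This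
  is why q1 has roots on both sides of x along the direction selected by the sign of q1(x). The time
  bound must hold for every sample sequence. Hence all loop lengths are functions of the input, and
  only correctness is conditional on luck.\<close>

datatype test = TN nat | TR nat

fun test_jump :: "test \<Rightarrow> nat \<Rightarrow> instr" where
  "test_jump (TN a) l = JumpN a l"
| "test_jump (TR a) l = JumpR a l"

text \<open>Truth means falling through into the body: \<open>JumpN\<close> leaves on zero and
  \<open>JumpR\<close> on a nonpositive value.\<close>

fun test_holds :: "test \<Rightarrow> state \<Rightarrow> bool" where
  "test_holds (TN a) s \<longleftrightarrow> nreg s a \<noteq> 0"
| "test_holds (TR a) s \<longleftrightarrow> 0 < rreg s a"

datatype com =
    Block "instr list"
  | Seq com com (infixr ";;" 60)
  | While test com
  | Cond test com com

fun jump_free :: "instr \<Rightarrow> bool" where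
  "jump_free (Jump _) = False"
| "jump_free (JumpN _ _) = False"
| "jump_free (JumpR _ _) = False"
| "jump_free _ = True"

fun clen :: "com \<Rightarrow> nat" where
  "clen (Block is) = length is"
| "clen (c ;; d) = clen c + clen d"
| "clen (While b c) = clen c + 2"
| "clen (Cond b c d) = clen c + clen d + 2"

text \<open>The argument l is the address of the first instruction; it is needed because jump
  targets are absolute.\<close>

fun compile :: "nat \<Rightarrow> com \<Rightarrow> instr list" where
  "compile l (Block is) = is"
| "compile l (c ;; d) = compile l c @ compile (l + clen c) d"
| "compile l (While b c) = test_jump b (l + clen c + 2) # compile (Suc l) c @ [Jump l]"
| "compile l (Cond b c d) = test_jump b (l + clen c + 2) # compile (Suc l) c
     @ Jump (l + clen c + clen d + 2) # compile (l + clen c + 2) d"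

lemma length_compile [simp]: "length (compile l c) = clen c"
  by (induction c arbitrary: l) auto

definition code_at :: "program \<Rightarrow> nat \<Rightarrow> com \<Rightarrow> bool" where
  "code_at P l c \<longleftrightarrow> (\<exists>pre post. P = pre @ compile l c @ post \<and> length pre = l)"

text \<open>Quantifying over all programs that contain the fragment, at any position, lets fragments
  be composed without relocation. The program counters of \<open>s\<close> and \<open>s'\<close> are
  overwritten and carry no information.\<close>

definition executes :: "(nat \<Rightarrow> real) \<Rightarrow> com \<Rightarrow> state \<Rightarrow> nat \<Rightarrow> state \<Rightarrow> bool" where
  "executes \<omega> c s t s' \<longleftrightarrow>
     (\<forall>P l. code_at P l c \<longrightarrow> run P \<omega> (s\<lparr>pc := l\<rparr>) t = s'\<lparr>pc := l + clen c\<rparr>)"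

lemma run_0 [simp]: "run P \<omega> s 0 = s"
  by (simp add: run_def)

lemma run_Suc: "run P \<omega> s (Suc t) = run P \<omega> (step P \<omega> s) t"
  unfolding run_def by (simp add: funpow_swap1)

lemma run_add: "run P \<omega> s (t + u) = run P \<omega> (run P \<omega> s t) u"
  by (induction t arbitrary: s) (simp_all add: run_Suc)

lemma run_1: "run P \<omega> s (Suc 0) = step P \<omega> s"
  by (simp add: run_Suc)

lemma exec_jump_free: "jump_free i \<Longrightarrow> exec \<omega> i (s\<lparr>pc := l\<rparr>) = (exec \<omega> i s)\<lparr>pc := Suc l\<rparr>"
  by (cases i) (simp_all add: set_n_def set_r_def)

lemma exec_test_jump:
  "exec \<omega> (test_jump b l) s = s\<lparr>pc := if test_holds b s then Suc (pc s) else l\<rparr>"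
  by (cases b) auto

lemma test_holds_pc [simp]: "test_holds b (s\<lparr>pc := l\<rparr>) = test_holds b s"
  by (cases b) auto

lemma executes_Block:
  assumes "list_all jump_free is"
  shows "executes \<omega> (Block is) s (length is) (fold (exec \<omega>) is s)"
proof -
  have "run P \<omega> (s\<lparr>pc := l\<rparr>) (length is) = (fold (exec \<omega>) is s)\<lparr>pc := l + length is\<rparr>"
    if "P = pre @ is @ post" "length pre = l" for P pre post l
    using that assms
  proof (induction "is" arbitrary: pre l s)
    case Nil
    then show ?case by simp
  next
    case (Cons i js)
    have "step P \<omega> (s\<lparr>pc := l\<rparr>) = (exec \<omega> i s)\<lparr>pc := Suc l\<rparr>"
      using Cons.prems by (simp add: step_def halted_def exec_jump_free nth_append)
    moreover have "run P \<omega> ((exec \<omega> i s)\<lparr>pc := Suc l\<rparr>) (length js)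
        = (fold (exec \<omega>) js (exec \<omega> i s))\<lparr>pc := Suc l + length js\<rparr>"
      by (rule Cons.IH[of "pre @ [i]"]) (use Cons.prems in auto)
    ultimately show ?case by (simp add: run_Suc)
  qed
  then show ?thesis unfolding executes_def code_at_def by auto
qed

lemma code_at_Seq:
  assumes "code_at P l (c ;; d)"
  shows "code_at P l c" "code_at P (l + clen c) d"
proof -
  obtain pre post where P: "P = pre @ (compile l c @ compile (l + clen c) d) @ post" "length pre = l"
    using assms by (auto simp: code_at_def)
  show "code_at P l c" unfolding code_at_def
    by (rule exI[of _ pre], rule exI[of _ "compile (l + clen c) d @ post"]) (use P in simp)
  show "code_at P (l + clen c) d" unfolding code_at_def
    by (rule exI[of _ "pre @ compile l c"], rule exI[of _ post]) (use P in simp)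
qed

lemma executes_Seq:
  assumes "executes \<omega> c s t s'" "executes \<omega> d s' t' s''"
  shows "executes \<omega> (c ;; d) s (t + t') s''"
  unfolding executes_def
proof (intro allI impI)
  fix P l assume "code_at P l (c ;; d)"
  note cd = code_at_Seq[OF this]
  show "run P \<omega> (s\<lparr>pc := l\<rparr>) (t + t') = s''\<lparr>pc := l + clen (c ;; d)\<rparr>"
    using assms cd unfolding executes_def by (simp add: run_add add.assoc)
qed

lemma code_at_While:
  assumes "code_at P l (While b c)"
  shows "l < length P" "P ! l = test_jump b (l + clen c + 2)" "code_at P (Suc l) c"
    "Suc (l + clen c) < length P" "P ! Suc (l + clen c) = Jump l"
proof -
  obtain pre post where P: "P = pre @ (test_jump b (l + clen c + 2) # compile (Suc l) c @ [Jump l]) @ post"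
      and l: "length pre = l"
    using assms by (auto simp: code_at_def)
  show "l < length P" "P ! l = test_jump b (l + clen c + 2)" "Suc (l + clen c) < length P"
    using l by (auto simp: P nth_append)
  show "code_at P (Suc l) c" unfolding code_at_def
    by (rule exI[of _ "pre @ [test_jump b (l + clen c + 2)]"], rule exI[of _ "Jump l # post"])
      (use P l in simp)
  have "P = (pre @ test_jump b (l + clen c + 2) # compile (Suc l) c) @ Jump l # post" by (simp add: P)
  moreover have "length (pre @ test_jump b (l + clen c + 2) # compile (Suc l) c) = Suc (l + clen c)"
    using l by simp
  ultimately show "P ! Suc (l + clen c) = Jump l" by (metis nth_append_length)
qed

lemma executes_While_False:
  assumes "\<not> test_holds b s"
  shows "executes \<omega> (While b c) s 1 s"
  unfolding executes_def
proof (intro allI impI)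
  fix P l assume "code_at P l (While b c)"
  note cd = code_at_While[OF this]
  show "run P \<omega> (s\<lparr>pc := l\<rparr>) 1 = s\<lparr>pc := l + clen (While b c)\<rparr>"
    using assms cd by (simp add: run_1 step_def halted_def exec_test_jump)
qed

lemma executes_While_True:
  assumes "test_holds b s" "executes \<omega> c s t s'" "executes \<omega> (While b c) s' t' s''"
  shows "executes \<omega> (While b c) s (t + 2 + t') s''"
  unfolding executes_def
proof (intro allI impI)
  fix P l assume cw: "code_at P l (While b c)"
  note cd = code_at_While[OF this]
  have 1: "run P \<omega> (s\<lparr>pc := l\<rparr>) (Suc t) = s'\<lparr>pc := Suc l + clen c\<rparr>"
    using assms(1,2) cd(3) unfolding executes_def
    by (simp add: run_Suc step_def halted_def exec_test_jump cd(2)) (use cd(1) in simp)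
  have 2: "step P \<omega> (s'\<lparr>pc := Suc l + clen c\<rparr>) = s'\<lparr>pc := l\<rparr>"
    using cd(4,5) by (simp add: step_def halted_def)
  have "run P \<omega> (s\<lparr>pc := l\<rparr>) (Suc t + (Suc 0 + t')) = s''\<lparr>pc := l + clen (While b c)\<rparr>"
    unfolding run_add[of _ _ _ "Suc t"] 1 run_add run_1 2
    using assms(3) cw unfolding executes_def by simp
  then show "run P \<omega> (s\<lparr>pc := l\<rparr>) (t + 2 + t') = s''\<lparr>pc := l + clen (While b c)\<rparr>" by simp
qed

lemma code_at_Cond:
  assumes "code_at P l (Cond b c d)"
  shows "l < length P" "P ! l = test_jump b (l + clen c + 2)" "code_at P (Suc l) c"
    "Suc (l + clen c) < length P" "P ! Suc (l + clen c) = Jump (l + clen c + clen d + 2)"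
    "code_at P (l + clen c + 2) d"
proof -
  let ?t = "test_jump b (l + clen c + 2)" and ?j = "Jump (l + clen c + clen d + 2)"
  obtain pre post where P: "P = pre @ (?t # compile (Suc l) c @ ?j # compile (l + clen c + 2) d) @ post"
      and l: "length pre = l"
    using assms by (auto simp: code_at_def)
  show "l < length P" "P ! l = ?t" "Suc (l + clen c) < length P"
    using l by (auto simp: P nth_append)
  show "code_at P (Suc l) c" unfolding code_at_def
    by (rule exI[of _ "pre @ [?t]"], rule exI[of _ "?j # compile (l + clen c + 2) d @ post"])
      (use P l in simp)
  have "P = (pre @ ?t # compile (Suc l) c) @ ?j # compile (l + clen c + 2) d @ post" by (simp add: P)
  moreover have "length (pre @ ?t # compile (Suc l) c) = Suc (l + clen c)"
    using l by simp
  ultimately show "P ! Suc (l + clen c) = ?j" by (metis nth_append_length)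
  show "code_at P (l + clen c + 2) d" unfolding code_at_def
    by (rule exI[of _ "pre @ ?t # compile (Suc l) c @ [?j]"], rule exI[of _ post]) (use P l in simp)
qed

lemma executes_Cond:
  assumes "test_holds b s \<Longrightarrow> executes \<omega> c s t s'" "\<not> test_holds b s \<Longrightarrow> executes \<omega> d s t s'"
  shows "executes \<omega> (Cond b c d) s (if test_holds b s then t + 2 else t + 1) s'"
  unfolding executes_def
proof (intro allI impI)
  fix P l assume "code_at P l (Cond b c d)"
  note cd = code_at_Cond[OF this]
  show "run P \<omega> (s\<lparr>pc := l\<rparr>) (if test_holds b s then t + 2 else t + 1) = s'\<lparr>pc := l + clen (Cond b c d)\<rparr>"
  proof (cases "test_holds b s")
    case True
    have 1: "run P \<omega> (s\<lparr>pc := l\<rparr>) (Suc t) = s'\<lparr>pc := Suc l + clen c\<rparr>"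
      using assms(1)[OF True] True cd(3) unfolding executes_def
      by (simp add: run_Suc step_def halted_def exec_test_jump cd(2)) (use cd(1) in simp)
    have 2: "step P \<omega> (s'\<lparr>pc := Suc l + clen c\<rparr>) = s'\<lparr>pc := l + clen (Cond b c d)\<rparr>"
      using cd(4,5) by (simp add: step_def halted_def)
    have "run P \<omega> (s\<lparr>pc := l\<rparr>) (Suc t + Suc 0) = s'\<lparr>pc := l + clen (Cond b c d)\<rparr>"
      unfolding run_add[of _ _ _ "Suc t"] 1 run_1 2 ..
    with True show ?thesis by simp
  next
    case False
    have 1: "step P \<omega> (s\<lparr>pc := l\<rparr>) = s\<lparr>pc := l + clen c + 2\<rparr>"
      using False cd(1,2) by (simp add: step_def halted_def exec_test_jump)
    show ?thesis using False assms(2)[OF False] cd(6) unfolding executes_def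
      by (simp add: run_Suc 1 add_ac)
  qed
qed

section \<open>Execution within a time bound\<close>

definition executes_within :: "(nat \<Rightarrow> real) \<Rightarrow> com \<Rightarrow> state \<Rightarrow> nat \<Rightarrow> state \<Rightarrow> bool" where
  "executes_within \<omega> c s T s' \<longleftrightarrow> (\<exists>t\<le>T. executes \<omega> c s t s')"

lemma executes_within_Block:
  "list_all jump_free is \<Longrightarrow> length is \<le> T \<Longrightarrow> s' = fold (exec \<omega>) is s \<Longrightarrow>
    executes_within \<omega> (Block is) s T s'"
  unfolding executes_within_def using executes_Block by blast

lemma executes_within_Seq:
  "executes_within \<omega> c s T s' \<Longrightarrow> executes_within \<omega> d s' T' s'' \<Longrightarrow> T + T' \<le> U \<Longrightarrow>
    executes_within \<omega> (c ;; d) s U s''"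
  unfolding executes_within_def using executes_Seq by (meson add_mono order_trans)

lemma executes_within_Cond:
  assumes "test_holds b s \<Longrightarrow> executes_within \<omega> c s T s'"
    "\<not> test_holds b s \<Longrightarrow> executes_within \<omega> d s T s'" "T + 2 \<le> U"
  shows "executes_within \<omega> (Cond b c d) s U s'"
proof (cases "test_holds b s")
  case True
  then obtain t where "t \<le> T" "executes \<omega> c s t s'" using assms(1) by (auto simp: executes_within_def)
  then show ?thesis using executes_Cond[of b s \<omega> c t s' d] True assms(3)
    unfolding executes_within_def by (intro exI[of _ "t + 2"]) auto
next
  case False
  then obtain t where "t \<le> T" "executes \<omega> d s t s'" using assms(2) by (auto simp: executes_within_def)
  then show ?thesis using executes_Cond[of b s \<omega> c t s' d] False assms(3)
    unfolding executes_within_def by (intro exI[of _ "t + 1"]) auto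
qed

text \<open>The invariant counts completed rounds, so a single induction gives termination after
  exactly m rounds, correctness and time: two jumps per round plus the final failing test.\<close>

lemma executes_within_While:
  assumes "I 0 s"
    and "\<And>i s. i < m \<Longrightarrow> I i s \<Longrightarrow>
      test_holds b s \<and> (\<exists>s'. executes_within \<omega> c s T s' \<and> I (Suc i) s')"
    and "\<And>s. I m s \<Longrightarrow> \<not> test_holds b s"
  shows "\<exists>s'. executes_within \<omega> (While b c) s (m * (T + 2) + 1) s' \<and> I m s'"
proof -
  have "\<exists>s'. executes_within \<omega> (While b c) s ((m - i) * (T + 2) + 1) s' \<and> I m s'" if "i \<le> m" "I i s" for i s
    using that
  proof (induction i arbitrary: s rule: inc_induct)
    case base
    then show ?case using executes_While_False[OF assms(3)] unfolding executes_within_def by force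
  next
    case (step i)
    obtain s1 t1 where 1: "test_holds b s" "t1 \<le> T" "executes \<omega> c s t1 s1" "I (Suc i) s1"
      using assms(2)[of i s] step by (auto simp: executes_within_def)
    obtain s2 t2 where 2: "t2 \<le> (m - Suc i) * (T + 2) + 1" "executes \<omega> (While b c) s1 t2 s2" "I m s2"
      using step.IH[OF 1(4)] by (auto simp: executes_within_def)
    have "m - i = Suc (m - Suc i)" using step by simp
    then have "t1 + 2 + t2 \<le> (m - i) * (T + 2) + 1" using 1 2 by simp
    then show ?case using executes_While_True[OF 1(1,3) 2(2)] 2(3) unfolding executes_within_def by blast
  qed
  from this[of 0 s] assms(1) show ?thesis by simp
qed

lemma halted_run_stable:
  assumes "halted P (run P \<omega> s t)" "t \<le> u"
  shows "run P \<omega> s u = run P \<omega> s t"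
proof -
  have st: "step P \<omega> s' = s'" if "halted P s'" for s' using that by (simp add: step_def)
  have "run P \<omega> s (t + k) = run P \<omega> s t" for k
  proof (induction k)
    case (Suc k)
    have "run P \<omega> s (t + Suc k) = run P \<omega> (run P \<omega> s (t + k)) (Suc 0)"
      by (metis Nat.add_0_right add_Suc_right add_Suc_shift run_add)
    with Suc show ?case by (simp add: run_1 st assms)
  qed simp
  from this[of "u - t"] assms show ?thesis by simp
qed

lemma final_state_eq:
  assumes "halted P (run P \<omega> s t)"
  shows "final_state P \<omega> s = run P \<omega> s t"
  unfolding final_state_def
  using halted_run_stable[of P \<omega> s "LEAST t. halted P (run P \<omega> s t)" t] assms
  by (metis LeastI Least_le)

text \<open>The run is described at the bound T instead of the actual halting time. As T can be
  chosen independently of the samples, the final state becomes a run of fixed length and hence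
  measurable.\<close>

lemma compiled_run:
  assumes "executes_within \<omega> c s T s'" "pc s = 0"
  shows "halted (compile 0 c) (run (compile 0 c) \<omega> s T)"
    "run (compile 0 c) \<omega> s T = s'\<lparr>pc := clen c\<rparr>"
    "final_state (compile 0 c) \<omega> s = s'\<lparr>pc := clen c\<rparr>"
proof -
  obtain t where t: "t \<le> T" "executes \<omega> c s t s'" using assms by (auto simp: executes_within_def)
  have "code_at (compile 0 c) 0 c" unfolding code_at_def by force
  then have r: "run (compile 0 c) \<omega> s t = s'\<lparr>pc := clen c\<rparr>"
    using t(2) assms(2) unfolding executes_def by (metis add_0 state.update_convs(1) state.surjective)
  then have h: "halted (compile 0 c) (run (compile 0 c) \<omega> s t)" by (simp add: halted_def)
  show "run (compile 0 c) \<omega> s T = s'\<lparr>pc := clen c\<rparr>" "final_state (compile 0 c) \<omega> s = s'\<lparr>pc := clen c\<rparr>"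
    using halted_run_stable[OF h t(1)] final_state_eq[OF h] r by simp_all
  then show "halted (compile 0 c) (run (compile 0 c) \<omega> s T)" by (simp add: halted_def)
qed

section \<open>Finitely supported vectors and Chebyshev iteration\<close>

text \<open>One inner product space that contains every R^n, the dimension being the predicate
  \<open>in_dim\<close>. Statements about the class \<open>real_inner\<close> thus apply although n
  is a variable.\<close>

typedef fvec = "{f :: nat \<Rightarrow> real. finite {i. f i \<noteq> 0}}"
  morphisms coord Abs_fvec
  by (rule exI[of _ "\<lambda>_. 0"]) simp

setup_lifting type_definition_fvec

lemma finite_supp [simp]: "finite {i. coord x i \<noteq> 0}"
  using coord[of x] by simp

lemma fvec_eqI: "(\<And>i. coord x i = coord y i) \<Longrightarrow> x = y"
  by (metis coord_inject ext)

instantiation fvec :: real_vector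
begin

lift_definition zero_fvec :: fvec is "\<lambda>_. 0" by simp
lift_definition plus_fvec :: "fvec \<Rightarrow> fvec \<Rightarrow> fvec" is "\<lambda>f g i. f i + g i"
  subgoal for f g by (rule finite_subset[of _ "{i. f i \<noteq> 0} \<union> {i. g i \<noteq> 0}"]) auto
  done
lift_definition uminus_fvec :: "fvec \<Rightarrow> fvec" is "\<lambda>f i. - f i" by simp
lift_definition minus_fvec :: "fvec \<Rightarrow> fvec \<Rightarrow> fvec" is "\<lambda>f g i. f i - g i"
  subgoal for f g by (rule finite_subset[of _ "{i. f i \<noteq> 0} \<union> {i. g i \<noteq> 0}"]) auto
  done
lift_definition scaleR_fvec :: "real \<Rightarrow> fvec \<Rightarrow> fvec" is "\<lambda>r f i. r * f i"
  subgoal for r f by (rule finite_subset[of _ "{i. f i \<noteq> 0}"]) auto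
  done

instance
  by standard (transfer; simp add: algebra_simps fun_eq_iff)+

end

lemma coord_simps [simp]:
  "coord 0 i = 0" "coord (x + y) i = coord x i + coord y i" "coord (- x) i = - coord x i"
  "coord (x - y) i = coord x i - coord y i" "coord (r *\<^sub>R x) i = r * coord x i"
  by (transfer; simp)+

instantiation fvec :: real_inner
begin

definition "inner (x :: fvec) y = (\<Sum>i | coord x i \<noteq> 0. coord x i * coord y i)"
definition "norm (x :: fvec) = sqrt (inner x x)"
definition "sgn (x :: fvec) = x /\<^sub>R norm x"
definition "dist (x :: fvec) y = norm (x - y)"
definition "uniformity = (INF e\<in>{0<..}. principal {(x :: fvec, y). dist x y < e})"
definition "open (U :: fvec set) \<longleftrightarrow> (\<forall>x\<in>U. \<forall>\<^sub>F (x', y) in uniformity. x' = x \<longrightarrow> y \<in> U)"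

lemma inner_fvec_superset:
  assumes "finite S" "{i. coord x i \<noteq> 0} \<subseteq> S"
  shows "inner x y = (\<Sum>i\<in>S. coord x i * coord y i)"
  unfolding inner_fvec_def by (rule sum.mono_neutral_left) (use assms in auto)

instance
proof
  fix x y z :: fvec and r :: real
  let ?S = "{i. coord x i \<noteq> 0} \<union> {i. coord y i \<noteq> 0} \<union> {i. coord z i \<noteq> 0}"
  note sup = inner_fvec_superset[of ?S]
  show "inner x y = inner y x" by (subst (1 2) sup) (auto simp: mult.commute)
  show "inner (x + y) z = inner x z + inner y z"
    by (subst (1 2 3) sup) (auto simp: algebra_simps sum.distrib)
  show "inner (r *\<^sub>R x) y = r * inner x y"
    by (subst (1 2) sup) (auto simp: algebra_simps sum_distrib_left)
  show "0 \<le> inner x x" by (simp add: inner_fvec_def sum_nonneg)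
  show "(inner x x = 0) = (x = 0)"
    by (auto simp: inner_fvec_def sum_nonneg_eq_0_iff intro: fvec_eqI)
qed (simp_all add: norm_fvec_def sgn_fvec_def dist_fvec_def uniformity_fvec_def open_fvec_def)

end

definition vecn :: "nat \<Rightarrow> (nat \<Rightarrow> real) \<Rightarrow> fvec" where
  "vecn n f = Abs_fvec (\<lambda>i. if i < n then f i else 0)"

definition in_dim :: "nat \<Rightarrow> fvec \<Rightarrow> bool" where
  "in_dim n x \<longleftrightarrow> (\<forall>i\<ge>n. coord x i = 0)"

text \<open>Coordinates beyond the dimension are ignored in the argument and zero in the result, so
  a symmetric matrix is self-adjoint on the whole space.\<close>

definition mat_op :: "real mat \<Rightarrow> fvec \<Rightarrow> fvec" where
  "mat_op A x = vecn (dim_row A) (\<lambda>i. \<Sum>j<dim_col A. A $$ (i, j) * coord x j)"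

lemma coord_vecn [simp]: "coord (vecn n f) i = (if i < n then f i else 0)"
  unfolding vecn_def by (subst Abs_fvec_inverse) auto

lemma inner_in_dim:
  assumes "in_dim n x"
  shows "inner x y = (\<Sum>i<n. coord x i * coord y i)"
  by (rule inner_fvec_superset) (use assms in \<open>auto simp: in_dim_def not_le[symmetric]\<close>)

lemma in_dim_vecn [simp]: "in_dim n (vecn n f)"
  by (simp add: in_dim_def)

lemma in_dim_simps [simp, intro]:
  "in_dim n 0" "in_dim n x \<Longrightarrow> in_dim n y \<Longrightarrow> in_dim n (x + y)"
  "in_dim n x \<Longrightarrow> in_dim n y \<Longrightarrow> in_dim n (x - y)" "in_dim n x \<Longrightarrow> in_dim n (- x)"
  "in_dim n x \<Longrightarrow> in_dim n (r *\<^sub>R x)"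
  by (auto simp: in_dim_def)

lemma in_dim_mat_op [simp]: "dim_row A = n \<Longrightarrow> in_dim n (mat_op A x)"
  by (auto simp: mat_op_def)

lemma vecn_coord [simp]: "in_dim n x \<Longrightarrow> vecn n (coord x) = x"
  by (rule fvec_eqI) (auto simp: in_dim_def)

section \<open>Self-adjoint operators\<close>

definition selfadjoint :: "('a::real_inner \<Rightarrow> 'a) \<Rightarrow> bool" where
  "selfadjoint A \<longleftrightarrow> linear A \<and> (\<forall>x y. inner (A x) y = inner x (A y))"

lemma selfadjoint_linear: "selfadjoint A \<Longrightarrow> linear A"
  by (simp add: selfadjoint_def)

lemma selfadjoint_simps:
  assumes "selfadjoint A"
  shows "A (x + y) = A x + A y" "A (x - y) = A x - A y" "A (r *\<^sub>R x) = r *\<^sub>R A x" "A 0 = 0"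
    "A (- x) = - A x"
  using selfadjoint_linear[OF assms] by (simp_all add: linear_add linear_diff linear_scale linear_0 linear_neg)

lemma selfadjoint_swap: "selfadjoint A \<Longrightarrow> inner (A x) y = inner x (A y)"
  by (simp add: selfadjoint_def)

lemma selfadjoint_pencil:
  assumes "selfadjoint A" "selfadjoint B"
  shows "selfadjoint (\<lambda>x. A x + \<gamma> *\<^sub>R B x)"
  using assms unfolding selfadjoint_def
  by (auto intro!: linear_compose_add linear_compose_scale_right simp: inner_simps)

lemma selfadjoint_id_minus:
  assumes "selfadjoint A"
  shows "selfadjoint (\<lambda>x. x - c *\<^sub>R A x)"
  using assms unfolding selfadjoint_def
  by (auto intro!: linear_compose_sub linear_compose_scale_right linear_ident simp: inner_simps)

lemma selfadjoint_mat_op: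
  assumes A: "A \<in> carrier_mat n n" and sym: "sym_mat A"
  shows "selfadjoint (mat_op A)"
proof -
  have dim: "dim_row A = n" "dim_col A = n" using A by auto
  have s: "A $$ (i, j) = A $$ (j, i)" if "i < n" "j < n" for i j
    using sym that dim unfolding sym_mat_def by (metis index_transpose_mat(1))
  have 1: "linear (mat_op A)"
    by (rule linearI) (auto intro!: fvec_eqI simp: mat_op_def algebra_simps sum.distrib sum_distrib_left)
  have "inner (mat_op A x) y = inner x (mat_op A y)" for x y
  proof -
    have "inner (mat_op A x) y = (\<Sum>i<n. (\<Sum>j<n. A $$ (i, j) * coord x j) * coord y i)"
      by (subst inner_in_dim[of n]) (auto simp: dim mat_op_def)
    also have "\<dots> = (\<Sum>j<n. \<Sum>i<n. A $$ (j, i) * coord x j * coord y i)"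
      unfolding sum_distrib_right by (subst sum.swap) (intro sum.cong refl, simp add: s)
    also have "\<dots> = (\<Sum>j<n. (\<Sum>i<n. A $$ (j, i) * coord y i) * coord x j)"
      unfolding sum_distrib_right by (intro sum.cong refl) simp
    also have "\<dots> = inner (mat_op A y) x"
      by (subst inner_in_dim[of n]) (auto simp: dim mat_op_def)
    finally show ?thesis by (simp add: inner_commute)
  qed
  with 1 show ?thesis by (simp add: selfadjoint_def)
qed


text \<open>
  The pair is \<open>(W\<^sub>k(M) g, V\<^sub>k(M) g)\<close> for the Chebyshev polynomials of the fourth and third kind;
  the energy identity below is \<open>(1 - x) W\<^sub>k\<^sup>2 + (1 + x) V\<^sub>k\<^sup>2 = 2\<close>.
\<close>

fun cheb :: "('a::real_inner \<Rightarrow> 'a) \<Rightarrow> 'a \<Rightarrow> nat \<Rightarrow> 'a \<times> 'a" where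
  "cheb M g 0 = (g, g)"
| "cheb M g (Suc k) =
     (let (w, v) = cheb M g k in (M w + v + M v, M v - w + M w))"

lemma cheb_energy:
  assumes M: "selfadjoint M"
  shows "(let (w, v) = cheb M g k in
    inner w w - inner w (M w) + (inner v v + inner v (M v))) = 2 * inner g g"
proof (induction k)
  case 0
  then show ?case by simp
next
  case (Suc k)
  obtain w v where wv: "cheb M g k = (w, v)" by force
  define a where "a = M w"
  define b where "b = M v"
  define c where "c = M a"
  define d where "d = M b"
  note sw = selfadjoint_swap[OF M]
  \<comment> \<open>Moving M across the inner product leaves few independent products, and the claim
    becomes linear in these.\<close>
  have f: "inner w c = inner a a" "inner v c = inner a b" "inner w d = inner a b"
    "inner v d = inner b b" "inner w b = inner v a" "inner b c = inner a d"
    using sw[of w a] sw[of v a] sw[of w b] sw[of v b] sw[of w v] sw[of b a]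
    by (simp_all add: a_def b_def c_def d_def inner_commute)
  have "inner w w - inner w a + (inner v v + inner v b) = 2 * inner g g"
    using Suc by (simp add: wv a_def b_def)
  then have "inner (a + v + b) (a + v + b) - inner (a + v + b) (c + b + d)
     + (inner (b - w + a) (b - w + a) + inner (b - w + a) (d - a + c)) = 2 * inner g g"
    unfolding inner_add_left inner_add_right inner_diff_left inner_diff_right
      inner_commute[of v w] inner_commute[of a w] inner_commute[of b w] inner_commute[of a v]
      inner_commute[of b v] inner_commute[of b a] inner_commute[of c a] inner_commute[of c b]
    using f by (simp add: inner_commute)
  then show ?case
    by (simp add: wv selfadjoint_simps[OF M] a_def b_def c_def d_def)
qed

text \<open>Along u the iteration is a linear recurrence for two scalars W and V. The combinations s
  V + W and s V - W diagonalize it, with factors 1 + x + \<tau> and 1 + x - \<tau>. The first grows,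
  the second stays nonnegative because \<tau> \<le> 1 + x, and their sum bounds V from below. The
  separate y lets the rate depend on a threshold only, the eigenvalue being unknown to the
  algorithm.\<close>

lemma cheb_growth:
  assumes M: "selfadjoint M" and u: "M u = (1 + x) *\<^sub>R u" and y: "0 < y" "y \<le> x"
  shows "(1 + sqrt (2 * y)) ^ (2 * k) * (inner u g)\<^sup>2 \<le> 4 * (inner u (snd (cheb M g k)))\<^sup>2"
proof -
  have x: "0 < x" using y by simp
  define s where "s = sqrt ((2 + x) / x)"
  define \<tau> where "\<tau> = sqrt (x * (2 + x))"
  have s1: "1 \<le> s" unfolding s_def using x by simp
  have s2: "s * s = (2 + x) / x" unfolding s_def using x by simp
  have "x * s = sqrt (x\<^sup>2 * ((2 + x) / x))" unfolding s_def real_sqrt_mult using x by simp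
  then have \<tau>: "\<tau> = x * s" unfolding \<tau>_def using x by (simp add: power2_eq_square)
  have \<tau>': "\<tau> * s = 2 + x" using \<tau> s2 x by (simp add: field_simps)
  have \<tau>pos: "0 < \<tau>" using \<tau> x s1 by simp
  have \<tau>2: "\<tau> * \<tau> = x * (2 + x)" unfolding \<tau>_def using x by simp
  have \<tau>le: "\<tau> \<le> 1 + x"
  proof (rule power2_le_imp_le)
    show "\<tau>\<^sup>2 \<le> (1 + x)\<^sup>2" unfolding power2_eq_square \<tau>2 by (simp add: algebra_simps)
  qed (use x in simp)
  define c where "c = inner u g"
  have "\<exists>W V. inner u (fst (cheb M g k)) = W * c \<and> inner u (snd (cheb M g k)) = V * c
     \<and> s * V + W \<ge> s * (1 + x + \<tau>) ^ k \<and> s * V \<ge> W"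
  proof (induction k)
    case 0
    have "s * 1 + 1 \<ge> s * (1 + x + \<tau>) ^ 0" "s * 1 \<ge> 1" using s1 by auto
    then show ?case by (auto simp: c_def intro!: exI[of _ 1])
  next
    case (Suc k)
    then obtain W V where WV: "inner u (fst (cheb M g k)) = W * c" "inner u (snd (cheb M g k)) = V * c"
      "s * V + W \<ge> s * (1 + x + \<tau>) ^ k" "s * V \<ge> W" by blast
    obtain w v where wv: "cheb M g k = (w, v)" by force
    have Mw: "inner u (M w) = (1 + x) * (W * c)" "inner u (M v) = (1 + x) * (V * c)"
      using selfadjoint_swap[OF M, of u w] selfadjoint_swap[OF M, of u v] WV by (simp_all add: u wv)
    define W' where "W' = (1 + x) * W + V + (1 + x) * V"
    define V' where "V' = (1 + x) * V - W + (1 + x) * W"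
    have 1: "inner u (fst (cheb M g (Suc k))) = W' * c" "inner u (snd (cheb M g (Suc k))) = V' * c"
      using Mw WV by (simp_all add: wv inner_simps W'_def V'_def algebra_simps)
    have sx: "s * x = \<tau>" using \<tau> by simp
    have "s * V' + W' = (1 + x) * (s * V) + (s * x) * W + (1 + x) * W + (2 + x) * V"
      by (simp add: W'_def V'_def algebra_simps)
    also have "\<dots> = (1 + x + \<tau>) * (s * V + W)" unfolding sx \<tau>'[symmetric] by (simp add: algebra_simps)
    finally have e1: "s * V' + W' = (1 + x + \<tau>) * (s * V + W)" .
    have "s * V' - W' = (1 + x) * (s * V) + (s * x) * W - (1 + x) * W - (2 + x) * V"
      by (simp add: W'_def V'_def algebra_simps)
    also have "\<dots> = (1 + x - \<tau>) * (s * V - W)" unfolding sx \<tau>'[symmetric] by (simp add: algebra_simps)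
    finally have e2: "s * V' - W' = (1 + x - \<tau>) * (s * V - W)" .
    have "s * (1 + x + \<tau>) ^ Suc k \<le> s * V' + W'"
      unfolding e1 using mult_left_mono[OF WV(3), of "1 + x + \<tau>"] x \<tau>pos by (simp add: mult_ac)
    moreover have "s * V' - W' \<ge> 0" unfolding e2 using \<tau>le WV(4) by simp
    ultimately show ?case using 1 by force
  qed
  then obtain W V where WV: "inner u (snd (cheb M g k)) = V * c"
     "s * V + W \<ge> s * (1 + x + \<tau>) ^ k" "s * V \<ge> W" by blast
  have "s * (1 + x + \<tau>) ^ k \<le> s * (2 * V)" using WV by simp
  then have V: "(1 + x + \<tau>) ^ k \<le> 2 * V" using s1 by simp
  have "sqrt (2 * y) \<le> \<tau>" unfolding \<tau>_def using x y zero_le_square[of x]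
    by (intro real_sqrt_le_mono) (unfold distrib_left, linarith)
  then have "(1 + sqrt (2 * y)) ^ k \<le> (1 + x + \<tau>) ^ k" using x y by (intro power_mono) auto
  with V have "(1 + sqrt (2 * y)) ^ k \<le> 2 * V" by simp
  then have "((1 + sqrt (2 * y)) ^ k)\<^sup>2 \<le> (2 * V)\<^sup>2" using y by (intro power_mono) auto
  then have "((1 + sqrt (2 * y)) ^ k)\<^sup>2 * c\<^sup>2 \<le> (2 * V)\<^sup>2 * c\<^sup>2" by (intro mult_right_mono) auto
  then show ?thesis unfolding WV c_def by (simp add: power_mult_distrib power_mult[symmetric] mult_ac)
qed

text \<open>Split v into its part along u and an orthogonal rest. Both parts stay orthogonal under
  M, so the cross terms vanish, and the rest contributes a nonnegative amount.\<close>

lemma psd_ge_eigen_component: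
  assumes M: "selfadjoint M" and psd: "\<And>h. 0 \<le> inner h h + inner h (M h)"
    and u: "M u = \<mu> *\<^sub>R u" "inner u u = 1"
  shows "(1 + \<mu>) * (inner u v)\<^sup>2 \<le> inner v v + inner v (M v)"
proof -
  define r where "r = v - inner u v *\<^sub>R u"
  have v: "v = inner u v *\<^sub>R u + r" by (simp add: r_def)
  have ur: "inner u r = 0" by (simp add: r_def inner_simps u)
  have uMr: "inner u (M r) = 0" using selfadjoint_swap[OF M, of u r] u ur by simp
  have "inner v v + inner v (M v) = (1 + \<mu>) * (inner u v)\<^sup>2 + (inner r r + inner r (M r))"
    apply (subst (1 2 3 4) v)
    using ur uMr u by (simp add: inner_simps selfadjoint_simps[OF M] power2_eq_square algebra_simps inner_commute[of r u])
  with psd[of r] show ?thesis by simp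
qed

text \<open>With M = 1 - c A the energy identity expresses c times the form of A at w as 2 |g|^2
  minus the form of 1 + M at v. The bound c A \<le> 2 makes 1 + M positive semidefinite, so the
  subtracted term is at least 2 (u . v)^2, and the growth along u pushes this above 2 |g|^2.\<close>

lemma cheb_finds_negative:
  fixes A :: "'a::real_inner \<Rightarrow> 'a"
  assumes A: "selfadjoint A" and c: "0 < c" and ub: "\<And>h. c * inner h (A h) \<le> 2 * inner h h"
    and u: "A u = l *\<^sub>R u" "inner u u = 1" and x: "0 < x" "x \<le> - c * l"
    and H: "H \<le> (1 + sqrt (2 * x)) ^ (2 * k)" and g: "4 * inner g g < H * (inner u g)\<^sup>2"
  shows "inner (fst (cheb (\<lambda>h. h - c *\<^sub>R A h) g k)) (A (fst (cheb (\<lambda>h. h - c *\<^sub>R A h) g k))) < 0"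
proof -
  let ?M = "\<lambda>h. h - c *\<^sub>R A h"
  have M: "selfadjoint ?M" by (rule selfadjoint_id_minus[OF A])
  obtain w v where wv: "cheb ?M g k = (w, v)" by force
  have en: "inner w w - inner w (?M w) + (inner v v + inner v (?M v)) = 2 * inner g g"
    using cheb_energy[OF M, of g k] by (simp add: wv)
  have Mu: "?M u = (1 + - c * l) *\<^sub>R u" by (simp add: u algebra_simps)
  have "H * (inner u g)\<^sup>2 \<le> (1 + sqrt (2 * x)) ^ (2 * k) * (inner u g)\<^sup>2"
    using H by (intro mult_right_mono) auto
  also have "\<dots> \<le> 4 * (inner u v)\<^sup>2" using cheb_growth[OF M Mu x, of k g] by (simp add: wv)
  finally have gr: "4 * inner g g < 4 * (inner u v)\<^sup>2" using g by simp
  have "(1 + (1 + - c * l)) * (inner u v)\<^sup>2 \<le> inner v v + inner v (?M v)"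
  proof (rule psd_ge_eigen_component[OF M _ Mu u(2)])
    fix h show "0 \<le> inner h h + inner h (?M h)" using ub[of h] by (simp add: inner_simps)
  qed
  moreover have "2 * (inner u v)\<^sup>2 \<le> (1 + (1 + - c * l)) * (inner u v)\<^sup>2"
    using x by (intro mult_right_mono) auto
  ultimately have "c * inner w (A w) < 0" using en gr by (simp add: inner_simps)
  then show ?thesis using c by (simp add: wv zero_less_mult_iff mult_less_0_iff)
qed

text \<open>One step of Nesterov's scheme for a maximum over \<gamma>. For fixed \<gamma> the
  proximal step \<open>zp\<close> is explicit; what remains is a concave problem in the single
  variable \<gamma>, and \<open>opt\<close> is its optimality condition against the competitor
  \<gamma>'. It yields \<open>l \<gamma>' zp \<le> l \<gamma> zp\<close>, which replaces the usual
  argument with one fixed gradient.\<close>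

lemma accelerated_step:
  fixes A0 A1 :: "'a::real_inner \<Rightarrow> 'a" and b0 b1 x z xs :: 'a and c0 c1 s :: real
  assumes A0: "selfadjoint A0" and A1: "selfadjoint A1"
  defines "q \<equiv> \<lambda>\<gamma> x. inner x (A0 x) + 2 * inner b0 x + c0 + s * inner x x
                 + \<gamma> * (inner x (A1 x) + 2 * inner b1 x + c1)"
  assumes psd: "\<And>\<gamma> h. \<gamma>1 \<le> \<gamma> \<Longrightarrow> \<gamma> \<le> \<gamma>2 \<Longrightarrow> 0 \<le> inner h (A0 h) + s * inner h h + \<gamma> * inner h (A1 h)"
    and ub: "\<And>\<gamma> h. \<gamma>1 \<le> \<gamma> \<Longrightarrow> \<gamma> \<le> \<gamma>2 \<Longrightarrow>
      inner h (A0 h) + s * inner h h + \<gamma> * inner h (A1 h) \<le> \<Lambda> * inner h h"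
    and \<Lambda>: "0 < \<Lambda>" and t: "1 \<le> t"
    and y: "y = x + (1 / t) *\<^sub>R (z - x)"
    and P: "P = A0 y + s *\<^sub>R y + b0" and Q: "Q = A1 y + b1"
    and \<gamma>: "\<gamma>1 \<le> \<gamma>" "\<gamma> \<le> \<gamma>2"
    and zp: "zp = z - (t / \<Lambda>) *\<^sub>R (P + \<gamma> *\<^sub>R Q)"
    and xp: "xp = x + (1 / t) *\<^sub>R (zp - x)"
    and opt: "(\<gamma>' - \<gamma>) * (inner y (A1 y) + 2 * inner b1 y + c1 + 2 * inner Q (zp - y)) \<le> 0"
    and \<gamma>': "\<gamma>1 \<le> \<gamma>'" "\<gamma>' \<le> \<gamma>2"
  shows "t\<^sup>2 * (q \<gamma>' xp - q \<gamma> xs) + \<Lambda> * inner (zp - xs) (zp - xs)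
    \<le> (t\<^sup>2 - t) * (q \<gamma>' x - q \<gamma> xs) + \<Lambda> * inner (z - xs) (z - xs)"
proof -
  have alg: "t\<^sup>2 * (a + 2 * i) = (t\<^sup>2 - t) * (a + 2 * j) + t * (a + 2 * k)"
    if "t * i = t * j + (k - j)" for a i j k :: real
  proof -
    have "t\<^sup>2 * (a + 2 * i) = t\<^sup>2 * a + 2 * t * (t * i)" by (simp add: power2_eq_square algebra_simps)
    then show ?thesis unfolding that by (simp add: power2_eq_square algebra_simps)
  qed
  define G where "G = (\<lambda>\<gamma>. P + \<gamma> *\<^sub>R Q)"
  define l where "l = (\<lambda>\<gamma> v. q \<gamma> y + 2 * inner (G \<gamma>) (v - y))"
  have exp: "q \<gamma> (y + h) = q \<gamma> y + 2 * inner (G \<gamma>) h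
      + (inner h (A0 h) + s * inner h h + \<gamma> * inner h (A1 h))" for \<gamma> h
  proof -
    have e: "inner y (A0 h) = inner (A0 y) h" "inner y (A1 h) = inner (A1 y) h"
      "inner h (A0 y) = inner (A0 y) h" "inner h (A1 y) = inner (A1 y) h" "inner h y = inner y h"
      using selfadjoint_swap[OF A0, of y h] selfadjoint_swap[OF A1, of y h] by (simp_all add: inner_commute)
    show ?thesis
      unfolding q_def G_def P Q selfadjoint_simps[OF A0] selfadjoint_simps[OF A1]
        inner_add_left inner_add_right inner_scaleR_left e by (simp add: algebra_simps)
  qed
  have lower: "l \<gamma> v \<le> q \<gamma> v" if "\<gamma>1 \<le> \<gamma>" "\<gamma> \<le> \<gamma>2" for \<gamma> v
    using exp[of \<gamma> "v - y"] psd[OF that, of "v - y"] by (simp add: l_def)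
  have upper: "q \<gamma> v \<le> l \<gamma> v + \<Lambda> * inner (v - y) (v - y)" if "\<gamma>1 \<le> \<gamma>" "\<gamma> \<le> \<gamma>2" for \<gamma> v
    using exp[of \<gamma> "v - y"] ub[OF that, of "v - y"] by (simp add: l_def)
  have xy: "xp - y = (1 / t) *\<^sub>R (zp - z)" by (simp add: xp y algebra_simps)
  have "t\<^sup>2 * q \<gamma>' xp \<le> t\<^sup>2 * (l \<gamma>' xp + \<Lambda> * inner (xp - y) (xp - y))"
    using upper[OF \<gamma>', of xp] by (intro mult_left_mono) auto
  also have "\<dots> = t\<^sup>2 * l \<gamma>' xp + \<Lambda> * inner (zp - z) (zp - z)"
    unfolding xy inner_scaleR_left inner_scaleR_right using t by (simp add: field_simps power2_eq_square del: inner_diff_left inner_diff_right)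
  also have "t\<^sup>2 * l \<gamma>' xp = (t\<^sup>2 - t) * l \<gamma>' x + t * l \<gamma>' zp"
  proof -
    have "xp - y = (x - y) + (1 / t) *\<^sub>R ((zp - y) - (x - y))" by (simp add: xp)
    then have "inner (G \<gamma>') (xp - y) = inner (G \<gamma>') (x - y) + (1/t) * (inner (G \<gamma>') (zp - y) - inner (G \<gamma>') (x - y))"
      by (simp add: inner_simps)
    then have "t * inner (G \<gamma>') (xp - y) = t * inner (G \<gamma>') (x - y) + (inner (G \<gamma>') (zp - y) - inner (G \<gamma>') (x - y))"
      using t by (simp add: field_simps)
    then show ?thesis unfolding l_def by (rule alg)
  qed
  also have "(t\<^sup>2 - t) * l \<gamma>' x \<le> (t\<^sup>2 - t) * q \<gamma>' x"
    using lower[OF \<gamma>'] t by (intro mult_left_mono) (auto simp: power2_eq_square)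
  also have "t * l \<gamma>' zp \<le> t * l \<gamma> zp"
  proof -
    have "l \<gamma>' zp - l \<gamma> zp = (\<gamma>' - \<gamma>) * (inner y (A1 y) + 2 * inner b1 y + c1 + 2 * inner Q (zp - y))"
      by (simp add: l_def q_def G_def inner_simps algebra_simps)
    then show ?thesis using opt t by (intro mult_left_mono) auto
  qed
  also have "t * l \<gamma> zp = t * l \<gamma> xs + \<Lambda> * (2 * inner (z - zp) (zp - xs))"
  proof -
    have "z - zp = (t / \<Lambda>) *\<^sub>R G \<gamma>" by (simp add: zp G_def)
    then have "\<Lambda> * inner (z - zp) (zp - xs) = t * inner (G \<gamma>) (zp - xs)" using \<Lambda> by simp
    then show ?thesis by (simp add: l_def inner_simps algebra_simps)
  qed
  also have "t * l \<gamma> xs \<le> t * q \<gamma> xs" using lower[OF \<gamma>] t by (intro mult_left_mono) auto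
  \<comment> \<open>The three-point identity; its last term cancels the quadratic term of the
    smoothness bound.\<close>
  also have "2 * inner (z - zp) (zp - xs) = inner (z - xs) (z - xs) - inner (zp - xs) (zp - xs)
       - inner (zp - z) (zp - z)"
    by (simp add: inner_diff_left inner_diff_right inner_commute[of xs z] inner_commute[of xs zp] inner_commute[of zp z])
  finally show ?thesis by (simp add: algebra_simps)
qed

section \<open>Vector programs\<close>

text \<open>
  Abstract scalar \<open>j\<close> lives in real register \<open>10 + j\<close>; lower real registers are scratch. Vector slot
  \<open>k\<close> starts at the memory address kept in index register \<open>20 + k\<close>. Slots 0 and 1 are the input
  vectors \<open>b0\<close> and \<open>b1\<close> at their place in the input, the other slots lie behind the input, where
  the memory is initially zero. Index registers 5 to 12 hold 1, \<open>n\<close>, the two entry counts, the start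
  of the two index lists and the start of the two value lists; index registers 0 to 4 are scratch.
\<close>

record astate =
  R :: "nat \<Rightarrow> real"
  V :: "nat \<Rightarrow> fvec"
  dr :: nat

locale ram_instance =
  fixes n :: nat and A0 A1 :: "real mat" and nm :: "nat \<Rightarrow> nat"
  assumes A0: "A0 \<in> carrier_mat n n" and A1: "A1 \<in> carrier_mat n n" and n: "0 < n"
    and nm0: "\<And>e. e < length (nz_entries A0) \<Longrightarrow>
      nm (3 + 2 * e) = fst (nz_entries A0 ! e) \<and> nm (4 + 2 * e) = snd (nz_entries A0 ! e)"
    and nm1: "\<And>e. e < length (nz_entries A1) \<Longrightarrow>
      nm (3 + 2 * length (nz_entries A0) + 2 * e) = fst (nz_entries A1 ! e) \<and>
      nm (4 + 2 * length (nz_entries A0) + 2 * e) = snd (nz_entries A1 ! e)"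
begin

abbreviation n0 where "n0 \<equiv> length (nz_entries A0)"
abbreviation n1 where "n1 \<equiv> length (nz_entries A1)"

definition adr :: "nat \<Rightarrow> nat" where
  "adr k = (if k < 2 then 7 + k * n else 7 + 2 * n + n0 + n1 + (k - 2) * n)"

definition sim :: "state \<Rightarrow> astate \<Rightarrow> bool" where
  "sim s \<sigma> \<longleftrightarrow> nmem s = nm \<and> nreg s 5 = 1 \<and> nreg s 6 = n \<and> nreg s 7 = n0 \<and> nreg s 8 = n1
     \<and> nreg s 9 = 3 \<and> nreg s 10 = 3 + 2 * n0 \<and> nreg s 11 = 7 + 2 * n \<and> nreg s 12 = 7 + 2 * n + n0
     \<and> (\<forall>k<20. nreg s (20 + k) = adr k)
     \<and> (\<forall>e<n0. rmem s (7 + 2 * n + e) = A0 $$ (nz_entries A0 ! e))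
     \<and> (\<forall>e<n1. rmem s (7 + 2 * n + n0 + e) = A1 $$ (nz_entries A1 ! e))
     \<and> (\<forall>k<20. in_dim n (V \<sigma> k) \<and> (\<forall>i<n. rmem s (adr k + i) = coord (V \<sigma> k) i))
     \<and> (\<forall>j. rreg s (10 + j) = R \<sigma> j) \<and> draws s = dr \<sigma>"

lemma adr_disjoint:
  assumes "k \<noteq> k'" "i < n" "i' < n"
  shows "adr k + i \<noteq> adr k' + i'"
proof -
  have *: "adr k + i < adr k'" if "k < k'" "i < n" for k k' i
  proof -
    have "adr k + n \<le> adr k'"
    proof (cases "k < 2")
      case True
      have 1: "k * n + n \<le> k' * n" using mult_le_mono1[of "Suc k" k' n] \<open>k < k'\<close> by simp
      have 2: "k * n + n \<le> 2 * n" using mult_le_mono1[of "Suc k" 2 n] True by simp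
      have 3: "adr k = 7 + k * n" "k' < 2 \<Longrightarrow> adr k' = 7 + k' * n" "\<not> k' < 2 \<Longrightarrow> 7 + 2 * n \<le> adr k'"
        using True by (simp_all add: adr_def)
      show ?thesis using 1 2 3 by (cases "k' < 2") linarith+
    next
      case False
      then have "Suc (k - 2) * n \<le> (k' - 2) * n" using that by (intro mult_le_mono1) auto
      then show ?thesis using False that by (simp add: adr_def)
    qed
    with that show ?thesis by simp
  qed
  show ?thesis using *[of k k' i] *[of k' k i'] assms by (cases "k < k'") auto
qed

lemma adr_values: "i < n \<Longrightarrow> e < n0 + n1 \<Longrightarrow> adr k + i \<noteq> 7 + 2 * n + e"
proof -
  assume "i < n" "e < n0 + n1"
  moreover have "k * n + n \<le> 2 * n" if "k < 2" using mult_le_mono1[of "Suc k" 2 n] that by simp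
  moreover have "k < 2 \<Longrightarrow> adr k = 7 + k * n" "\<not> k < 2 \<Longrightarrow> 7 + 2 * n + n0 + n1 \<le> adr k"
    by (simp_all add: adr_def)
  ultimately show ?thesis by (cases "k < 2") linarith+
qed

text \<open>Frame rule for operations that write one vector slot. Scratch registers may change
  freely; the other slots and the stored matrix values survive because the blocks are
  disjoint.\<close>

lemma sim_vec:
  assumes s: "sim s \<sigma>" and d: "d < 20" and v: "in_dim n v"
    and nr: "\<And>r. 5 \<le> r \<Longrightarrow> nreg s' r = nreg s r" and rr: "\<And>r. 10 \<le> r \<Longrightarrow> rreg s' r = rreg s r"
    and nmm: "nmem s' = nmem s" and dd: "draws s' = dd"
    and in_blk: "\<And>i. i < n \<Longrightarrow> rmem s' (adr d + i) = coord v i"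
    and out_blk: "\<And>p. (\<And>i. i < n \<Longrightarrow> p \<noteq> adr d + i) \<Longrightarrow> rmem s' p = rmem s p"
  shows "sim s' (\<sigma>\<lparr>V := (V \<sigma>)(d := v), dr := dd\<rparr>)"
proof -
  have "rmem s' (7 + 2 * n + e) = rmem s (7 + 2 * n + e)" if "e < n0 + n1" for e
    by (rule out_blk) (metis adr_values that)
  note vals = this this[of "n0 + _"]
  have "rmem s' (adr k + i) = rmem s (adr k + i)" if "k \<noteq> d" "i < n" for k i
    by (rule out_blk) (metis adr_disjoint that)
  then show ?thesis using s vals
    unfolding sim_def by (auto simp: nr rr nmm dd in_blk v add.assoc)
qed

lemma sim_scalar:
  assumes s: "sim s \<sigma>"
    and nr: "\<And>r. 5 \<le> r \<Longrightarrow> nreg s' r = nreg s r" and rr: "\<And>j. rreg s' (10 + j) = R' j"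
    and nmm: "nmem s' = nmem s" and dd: "draws s' = draws s" and rmm: "rmem s' = rmem s"
  shows "sim s' (\<sigma>\<lparr>R := R'\<rparr>)"
  using s unfolding sim_def by (auto simp: nr rr nmm dd rmm)

text \<open>Unit of cost. A vector loop takes at most 16 instructions per coordinate or nonzero
  entry and a small constant, which is absorbed because n > 0.\<close>

definition U :: nat where "U = 20 * (n + n0 + n1)"

lemma U_ge: "20 \<le> U" "20 * n \<le> U" using n by (auto simp: U_def)

text \<open>A weakest precondition for total correctness, with T counted in units of
  \<open>U\<close>. The postcondition sees only the abstract state, so programs are verified by
  applying rules backwards.\<close>

definition wx :: "(nat \<Rightarrow> real) \<Rightarrow> com \<Rightarrow> nat \<Rightarrow> (astate \<Rightarrow> bool) \<Rightarrow> astate \<Rightarrow> bool" where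
  "wx \<omega> c T Q \<sigma> \<longleftrightarrow> (\<forall>s. sim s \<sigma> \<longrightarrow>
     (\<exists>s' \<sigma>'. executes_within \<omega> c s (T * U) s' \<and> sim s' \<sigma>' \<and> Q \<sigma>'))"

lemma wxI:
  assumes "\<And>s. sim s \<sigma> \<Longrightarrow> \<exists>s' T'. executes_within \<omega> c s T' s' \<and> T' \<le> T * U \<and> sim s' \<sigma>'" and "Q \<sigma>'"
  shows "wx \<omega> c T Q \<sigma>"
  using assms unfolding wx_def executes_within_def by (meson order_trans)

lemma wx_mono:
  assumes "wx \<omega> c T Q \<sigma>" "T \<le> T'" "\<And>\<sigma>'. Q \<sigma>' \<Longrightarrow> Q' \<sigma>'"
  shows "wx \<omega> c T' Q' \<sigma>"
proof -
  have "T * U \<le> T' * U" using assms by simp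
  with assms(1,3) show ?thesis unfolding wx_def executes_within_def by (meson order_trans)
qed

lemma wx_Seq:
  assumes "wx \<omega> c T (\<lambda>\<sigma>'. wx \<omega> d T' Q \<sigma>') \<sigma>"
  shows "wx \<omega> (c ;; d) (T + T') Q \<sigma>"
  unfolding wx_def
proof (intro allI impI)
  fix s assume "sim s \<sigma>"
  then obtain s1 \<sigma>1 where 1: "executes_within \<omega> c s (T * U) s1" "sim s1 \<sigma>1" "wx \<omega> d T' Q \<sigma>1"
    using assms unfolding wx_def by blast
  then obtain s2 \<sigma>2 where 2: "executes_within \<omega> d s1 (T' * U) s2" "sim s2 \<sigma>2" "Q \<sigma>2"
    unfolding wx_def by blast
  show "\<exists>s' \<sigma>'. executes_within \<omega> (c ;; d) s ((T + T') * U) s' \<and> sim s' \<sigma>' \<and> Q \<sigma>'"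
    using executes_within_Seq[OF 1(1) 2(1)] 2 by (auto simp: algebra_simps)
qed

lemma wx_Cond:
  assumes "0 < R \<sigma> a \<Longrightarrow> wx \<omega> c T Q \<sigma>" "R \<sigma> a \<le> 0 \<Longrightarrow> wx \<omega> d T Q \<sigma>"
  shows "wx \<omega> (Cond (TR (10 + a)) c d) (T + 1) Q \<sigma>"
  unfolding wx_def
proof (intro allI impI)
  fix s assume s: "sim s \<sigma>"
  then have r: "rreg s (10 + a) = R \<sigma> a" by (simp add: sim_def)
  have U: "T * U + 2 \<le> (T + 1) * U" using U_ge by simp
  show "\<exists>s' \<sigma>'. executes_within \<omega> (Cond (TR (10 + a)) c d) s ((T + 1) * U) s' \<and> sim s' \<sigma>' \<and> Q \<sigma>'"
  proof (cases "0 < R \<sigma> a")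
    case True
    then obtain s' \<sigma>' where "executes_within \<omega> c s (T * U) s'" "sim s' \<sigma>'" "Q \<sigma>'"
      using assms(1) s unfolding wx_def by blast
    then show ?thesis using executes_within_Cond[OF _ _ U, of "TR (10 + a)" s \<omega> c s' d] True r by auto
  next
    case False
    then obtain s' \<sigma>' where "executes_within \<omega> d s (T * U) s'" "sim s' \<sigma>'" "Q \<sigma>'"
      using assms(2) s unfolding wx_def by force
    then show ?thesis using executes_within_Cond[OF _ _ U, of "TR (10 + a)" s \<omega> c s' d] False r by auto
  qed
qed

lemma wx_While:
  assumes "I 0 \<sigma>" and "\<And>i \<sigma>. i < m \<Longrightarrow> I i \<sigma> \<Longrightarrow> 0 < R \<sigma> a \<and> wx \<omega> c T (I (Suc i)) \<sigma>"
    and "\<And>\<sigma>. I m \<sigma> \<Longrightarrow> R \<sigma> a \<le> 0 \<and> Q \<sigma>"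
  shows "wx \<omega> (While (TR (10 + a)) c) (m * (T + 1) + 1) Q \<sigma>"
  unfolding wx_def
proof (intro allI impI)
  fix s assume s: "sim s \<sigma>"
  define J where "J = (\<lambda>i s. \<exists>\<sigma>. sim s \<sigma> \<and> I i \<sigma>)"
  have "\<exists>s'. executes_within \<omega> (While (TR (10 + a)) c) s (m * (T * U + 2) + 1) s' \<and> J m s'"
  proof (rule executes_within_While)
    show "J 0 s" using s assms(1) by (auto simp: J_def)
  next
    fix i s assume i: "i < m" "J i s"
    then obtain \<sigma> where s: "sim s \<sigma>" "I i \<sigma>" by (auto simp: J_def)
    then have "rreg s (10 + a) = R \<sigma> a" by (simp add: sim_def)
    with assms(2)[OF i(1) s(2)] s(1)
    show "test_holds (TR (10 + a)) s \<and> (\<exists>s'. executes_within \<omega> c s (T * U) s' \<and> J (Suc i) s')"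
      unfolding wx_def J_def test_holds.simps by metis
  next
    fix s assume "J m s"
    then obtain \<sigma> where s: "sim s \<sigma>" "I m \<sigma>" by (auto simp: J_def)
    then have "rreg s (10 + a) = R \<sigma> a" by (simp add: sim_def)
    with assms(3)[OF s(2)] show "\<not> test_holds (TR (10 + a)) s" by simp
  qed
  then obtain s' \<sigma>' where s': "executes_within \<omega> (While (TR (10 + a)) c) s (m * (T * U + 2) + 1) s'"
    "sim s' \<sigma>'" "I m \<sigma>'" unfolding J_def by blast
  have "m * (T * U + 2) \<le> m * ((T + 1) * U)" using U_ge by (intro mult_le_mono2) simp
  then have "m * (T * U + 2) + 1 \<le> (m * (T + 1) + 1) * U" using U_ge by (simp add: algebra_simps)
  then have "executes_within \<omega> (While (TR (10 + a)) c) s ((m * (T + 1) + 1) * U) s'"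
    using s'(1) unfolding executes_within_def by (meson order_trans)
  with s' assms(3)[OF s'(3)] show "\<exists>s' \<sigma>'. executes_within \<omega> (While (TR (10 + a)) c) s ((m * (T + 1) + 1) * U) s'
      \<and> sim s' \<sigma>' \<and> Q \<sigma>'" by blast
qed

end

definition "sConst a q = Block [RConst (10 + a) q]"
definition "sAdd a b c = Block [RAdd (10 + a) (10 + b) (10 + c)]"
definition "sSub a b c = Block [RSub (10 + a) (10 + b) (10 + c)]"
definition "sMul a b c = Block [RMul (10 + a) (10 + b) (10 + c)]"
definition "sDiv a b c = Block [RDiv (10 + a) (10 + b) (10 + c)]"
definition "sSqrt a b = Block [RSqrt (10 + a) (10 + b)]"
definition "sDim a = Block [ROfNat (10 + a) 6]"
definition "sWhile a c = While (TR (10 + a)) c"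
definition "sCond a c d = Cond (TR (10 + a)) c d"

text \<open>Index register 4 is set to zero so that \<open>NAdd\<close> can act as a move, which the
  machine does not have.\<close>

definition vLin :: "nat \<Rightarrow> nat \<Rightarrow> nat \<Rightarrow> nat \<Rightarrow> nat \<Rightarrow> com" where
  "vLin d a x b y =
     Block [NConst 4 0, NAdd 0 6 4, NAdd 1 (20 + x) 4, NAdd 2 (20 + y) 4, NAdd 3 (20 + d) 4] ;;
     While (TN 0) (Block
       [RLoad 0 1, RLoad 1 2, RMul 0 (10 + a) 0, RMul 1 (10 + b) 1, RAdd 0 0 1, RStore 3 0,
        NAdd 1 1 5, NAdd 2 2 5, NAdd 3 3 5, NSub 0 0 5])"

definition vDot :: "nat \<Rightarrow> nat \<Rightarrow> nat \<Rightarrow> com" where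
  "vDot a x y =
     Block [NConst 4 0, NAdd 0 6 4, NAdd 1 (20 + x) 4, NAdd 2 (20 + y) 4, RConst 2 0] ;;
     While (TN 0) (Block
       [RLoad 0 1, RLoad 1 2, RMul 0 0 1, RAdd 2 2 0, NAdd 1 1 5, NAdd 2 2 5, NSub 0 0 5]) ;;
     Block [RConst 0 0, RAdd (10 + a) 2 0]"

definition vNormal :: "nat \<Rightarrow> com" where
  "vNormal d =
     Block [NConst 4 0, NAdd 0 6 4, NAdd 3 (20 + d) 4] ;;
     While (TN 0) (Block [RNormal 0, RStore 3 0, NAdd 3 3 5, NSub 0 0 5])"

text \<open>Partial row sums are written to slot d while slot x is still being read, so the two
  slots must differ.\<close>

definition vMulAcc :: "nat \<Rightarrow> nat \<Rightarrow> nat \<Rightarrow> nat \<Rightarrow> nat \<Rightarrow> com" where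
  "vMulAcc cnt ip vp d x =
     Block [NConst 4 0, NAdd 0 cnt 4, NAdd 1 ip 4, NAdd 2 vp 4] ;;
     While (TN 0) (Block
       [NLoad 3 1, NAdd 3 3 (20 + d), NAdd 1 1 5, NLoad 4 1, NAdd 4 4 (20 + x), NAdd 1 1 5,
        RLoad 0 4, RLoad 1 2, RMul 0 1 0, RLoad 1 3, RAdd 1 1 0, RStore 3 1, NAdd 2 2 5, NSub 0 0 5])"

text \<open>The coefficient register \<open>z\<close> must hold zero.\<close>

definition vMul0 :: "nat \<Rightarrow> nat \<Rightarrow> nat \<Rightarrow> com" where
  "vMul0 z d x = vLin d z d z d ;; vMulAcc 7 9 11 d x"

definition vMul1 :: "nat \<Rightarrow> nat \<Rightarrow> nat \<Rightarrow> com" where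
  "vMul1 z d x = vLin d z d z d ;; vMulAcc 8 10 12 d x"

text \<open>The list enumerates the nonzero positions without repetition; the remaining positions
  contribute zero to the row sum.\<close>

lemma sum_nz_entries:
  assumes A: "A \<in> carrier_mat n n" and i: "i < n"
  shows "(\<Sum>e<length (nz_entries A). if fst (nz_entries A ! e) = i
      then A $$ (nz_entries A ! e) * f (snd (nz_entries A ! e)) else 0) = (\<Sum>j<n. A $$ (i, j) * f j)"
proof -
  let ?L = "nz_entries A" and ?g = "\<lambda>ij. if fst ij = i then A $$ ij * f (snd ij) else 0"
  have dist: "distinct ?L" unfolding nz_entries_def by (simp add: distinct_product)
  have set: "set ?L = {ij \<in> {..<n} \<times> {..<n}. A $$ ij \<noteq> 0}" using A by (auto simp: nz_entries_def)
  have "(\<Sum>e<length ?L. ?g (?L ! e)) = (\<Sum>ij\<in>set ?L. ?g ij)"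
    using sum.reindex_bij_betw[OF bij_betw_nth[OF dist refl refl], of ?g] by simp
  also have "\<dots> = (\<Sum>ij\<in>{..<n} \<times> {..<n}. ?g ij)"
    unfolding set by (rule sum.mono_neutral_left) auto
  also have "\<dots> = (\<Sum>k<n. \<Sum>j<n. ?g (k, j))" unfolding sum.cartesian_product by (intro sum.cong refl) auto
  also have "\<dots> = (\<Sum>k<n. if k = i then (\<Sum>j<n. A $$ (k, j) * f j) else 0)"
    by (intro sum.cong refl) auto
  also have "\<dots> = (\<Sum>j<n. A $$ (i, j) * f j)" using i by simp
  finally show ?thesis by simp
qed

context ram_instance
begin

lemma wx_scalar:
  assumes jf: "list_all jump_free is" "length is \<le> 20"
    and fx: "\<And>s. (\<forall>j. rreg s (10 + j) = R \<sigma> j) \<Longrightarrow> nreg s 6 = n \<Longrightarrow>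
      fold (exec \<omega>) is s = s\<lparr>pc := pc (fold (exec \<omega>) is s), rreg := rreg (fold (exec \<omega>) is s)\<rparr>
      \<and> (\<forall>j. rreg (fold (exec \<omega>) is s) (10 + j) = R' j)"
    and Q: "Q (\<sigma>\<lparr>R := R'\<rparr>)"
  shows "wx \<omega> (Block is) 1 Q \<sigma>"
proof (rule wxI)
  fix s assume s: "sim s \<sigma>"
  let ?s = "fold (exec \<omega>) is s"
  have f: "?s = s\<lparr>pc := pc ?s, rreg := rreg ?s\<rparr>" "\<And>j. rreg ?s (10 + j) = R' j"
    using fx[of s] s by (auto simp: sim_def)
  have e: "nreg ?s = nreg s" "nmem ?s = nmem s" "rmem ?s = rmem s" "draws ?s = draws s"
    by (subst f(1), simp)+
  have "sim ?s (\<sigma>\<lparr>R := R'\<rparr>)" by (rule sim_scalar[OF s]) (use f e in auto)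
  moreover have "executes_within \<omega> (Block is) s (length is) ?s"
    by (rule executes_within_Block) (use jf in auto)
  ultimately show "\<exists>s' T'. executes_within \<omega> (Block is) s T' s' \<and> T' \<le> 1 * U \<and> sim s' (\<sigma>\<lparr>R := R'\<rparr>)"
    using U_ge jf by (metis (no_types, lifting) mult_1 order_trans)
qed (rule Q)

lemma wx_scalars:
  "Q (\<sigma>\<lparr>R := (R \<sigma>)(a := of_rat q)\<rparr>) \<Longrightarrow> wx \<omega> (sConst a q) 1 Q \<sigma>"
  "Q (\<sigma>\<lparr>R := (R \<sigma>)(a := R \<sigma> b + R \<sigma> c)\<rparr>) \<Longrightarrow> wx \<omega> (sAdd a b c) 1 Q \<sigma>"
  "Q (\<sigma>\<lparr>R := (R \<sigma>)(a := R \<sigma> b - R \<sigma> c)\<rparr>) \<Longrightarrow> wx \<omega> (sSub a b c) 1 Q \<sigma>"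
  "Q (\<sigma>\<lparr>R := (R \<sigma>)(a := R \<sigma> b * R \<sigma> c)\<rparr>) \<Longrightarrow> wx \<omega> (sMul a b c) 1 Q \<sigma>"
  "Q (\<sigma>\<lparr>R := (R \<sigma>)(a := R \<sigma> b / R \<sigma> c)\<rparr>) \<Longrightarrow> wx \<omega> (sDiv a b c) 1 Q \<sigma>"
  "Q (\<sigma>\<lparr>R := (R \<sigma>)(a := sqrt (R \<sigma> b))\<rparr>) \<Longrightarrow> wx \<omega> (sSqrt a b) 1 Q \<sigma>"
  "Q (\<sigma>\<lparr>R := (R \<sigma>)(a := real n)\<rparr>) \<Longrightarrow> wx \<omega> (sDim a) 1 Q \<sigma>"
  unfolding sConst_def sAdd_def sSub_def sMul_def sDiv_def sSqrt_def sDim_def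
  by (erule wx_scalar[rotated 3]; simp add: set_r_def)+

lemmas wx_sCond = wx_Cond[folded sCond_def]
lemmas wx_sWhile = wx_While[folded sWhile_def]

lemma wx_vLin:
  assumes ix: "d < 20" "x < 20" "y < 20"
    and Q: "Q (\<sigma>\<lparr>V := (V \<sigma>)(d := R \<sigma> a *\<^sub>R V \<sigma> x + R \<sigma> b *\<^sub>R V \<sigma> y)\<rparr>)"
  shows "wx \<omega> (vLin d a x b y) 1 Q \<sigma>"
proof (rule wxI)
  fix s assume s: "sim s \<sigma>"
  let ?v = "R \<sigma> a *\<^sub>R V \<sigma> x + R \<sigma> b *\<^sub>R V \<sigma> y"
  have c: "nreg s 5 = 1" "nreg s 6 = n" "nreg s (20 + d) = adr d" "nreg s (20 + x) = adr x"
    "nreg s (20 + y) = adr y" "rreg s (10 + a) = R \<sigma> a" "rreg s (10 + b) = R \<sigma> b"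
    using s ix by (auto simp: sim_def)
  have vec: "in_dim n (V \<sigma> k) \<and> (\<forall>i<n. rmem s (adr k + i) = coord (V \<sigma> k) i)" if "k < 20" for k
    using s that by (auto simp: sim_def)
  let ?init = "[NConst 4 0, NAdd 0 6 4, NAdd 1 (20 + x) 4, NAdd 2 (20 + y) 4, NAdd 3 (20 + d) 4]"
  let ?body = "[RLoad 0 1, RLoad 1 2, RMul 0 (10 + a) 0, RMul 1 (10 + b) 1, RAdd 0 0 1, RStore 3 0,
        NAdd 1 1 5, NAdd 2 2 5, NAdd 3 3 5, NSub 0 0 5]"
  define I where "I = (\<lambda>i (t::state). i \<le> n \<and> nreg t 0 = n - i \<and> nreg t 1 = adr x + i \<and> nreg t 2 = adr y + i
    \<and> nreg t 3 = adr d + i \<and> (\<forall>r\<ge>5. nreg t r = nreg s r) \<and> (\<forall>r\<ge>10. rreg t r = rreg s r)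
    \<and> nmem t = nmem s \<and> draws t = draws s
    \<and> (\<forall>p. (\<forall>j<i. p \<noteq> adr d + j) \<longrightarrow> rmem t p = rmem s p)
    \<and> (\<forall>j<i. rmem t (adr d + j) = coord ?v j))"
  define s0 where "s0 = fold (exec \<omega>) ?init s"
  have e0: "executes_within \<omega> (Block ?init) s 5 s0"
    by (rule executes_within_Block[OF _ _ s0_def]) simp_all
  have "I 0 s0" using c by (simp add: I_def s0_def set_n_def)
  then have "\<exists>s'. executes_within \<omega> (While (TN 0) (Block ?body)) s0 (n * (10 + 2) + 1) s' \<and> I n s'"
  proof (rule executes_within_While)
    fix i t assume i: "i < n" and I: "I i t"
    define t' where "t' = fold (exec \<omega>) ?body t"
    \<comment> \<open>The target may coincide with a source: earlier rounds have changed only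
      coordinates below i.\<close>
    have rd: "rmem t (adr k + i) = coord (V \<sigma> k) i" if "k < 20" for k
    proof -
      have "adr k + i \<noteq> adr d + j" if "j < i" for j
        using adr_disjoint[of k d i j] that i by (cases "k = d") auto
      then show ?thesis using I vec[OF that] i by (simp add: I_def)
    qed
    have n5: "nreg t 5 = 1" "nreg t 0 = n - i" "nreg t 1 = adr x + i" "nreg t 2 = adr y + i" "nreg t 3 = adr d + i"
      "rreg t (10 + a) = R \<sigma> a" "rreg t (10 + b) = R \<sigma> b"
      using I c by (simp_all add: I_def)
    have nr: "nreg t' 0 = n - Suc i" "nreg t' 1 = adr x + Suc i" "nreg t' 2 = adr y + Suc i" "nreg t' 3 = adr d + Suc i"
      using n5 by (simp_all add: t'_def set_n_def set_r_def)
    have fr: "\<forall>r\<ge>5. nreg t' r = nreg t r" "\<forall>r\<ge>10. rreg t' r = rreg t r" "nmem t' = nmem t" "draws t' = draws t"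
      by (simp_all add: t'_def set_n_def set_r_def)
    have rm: "rmem t' = (rmem t)(adr d + i := coord ?v i)"
      using n5 rd[OF ix(2)] rd[OF ix(3)] by (simp add: t'_def set_n_def set_r_def)
    have "executes_within \<omega> (Block ?body) t 10 t'" by (rule executes_within_Block[OF _ _ t'_def]) simp_all
    moreover have "I (Suc i) t'" unfolding I_def
    proof (intro conjI allI impI)
      fix p assume "\<forall>j<Suc i. p \<noteq> adr d + j"
      then show "rmem t' p = rmem s p" unfolding rm using I by (simp add: I_def)
    next
      fix j assume "j < Suc i"
      then show "rmem t' (adr d + j) = coord ?v j" unfolding rm using I by (auto simp: I_def)
    qed (use I i nr fr in \<open>auto simp: I_def\<close>)
    moreover have "test_holds (TN 0) t" using I i by (simp add: I_def)
    ultimately show "test_holds (TN 0) t \<and> (\<exists>s'. executes_within \<omega> (Block ?body) t 10 s' \<and> I (Suc i) s')"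
      by blast
  qed (simp add: I_def)
  then obtain s' where s': "executes_within \<omega> (While (TN 0) (Block ?body)) s0 (n * (10 + 2) + 1) s'" "I n s'"
    by blast
  have "executes_within \<omega> (vLin d a x b y) s (12 * n + 6) s'"
    unfolding vLin_def by (rule executes_within_Seq[OF e0 s'(1)]) simp
  moreover have "12 * n + 6 \<le> 1 * U" using n by (simp add: U_def)
  moreover have "sim s' (\<sigma>\<lparr>V := (V \<sigma>)(d := ?v), dr := dr \<sigma>\<rparr>)"
    by (rule sim_vec[OF s ix(1)]) (use s'(2) vec ix s in \<open>auto simp: I_def sim_def\<close>)
  ultimately show "\<exists>s' T'. executes_within \<omega> (vLin d a x b y) s T' s' \<and> T' \<le> 1 * U \<and>
      sim s' (\<sigma>\<lparr>V := (V \<sigma>)(d := ?v)\<rparr>)" by (intro exI[of _ s'] exI[of _ "12 * n + 6"]) simp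
qed (rule Q)

lemma wx_vDot:
  assumes ix: "x < 20" "y < 20"
    and Q: "Q (\<sigma>\<lparr>R := (R \<sigma>)(a := inner (V \<sigma> x) (V \<sigma> y))\<rparr>)"
  shows "wx \<omega> (vDot a x y) 1 Q \<sigma>"
proof (rule wxI)
  fix s assume s: "sim s \<sigma>"
  have c: "nreg s 5 = 1" "nreg s 6 = n" "nreg s (20 + x) = adr x" "nreg s (20 + y) = adr y"
    using s ix by (auto simp: sim_def)
  have vec: "in_dim n (V \<sigma> k) \<and> (\<forall>i<n. rmem s (adr k + i) = coord (V \<sigma> k) i)" if "k < 20" for k
    using s that by (auto simp: sim_def)
  let ?init = "[NConst 4 0, NAdd 0 6 4, NAdd 1 (20 + x) 4, NAdd 2 (20 + y) 4, RConst 2 0]"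
  let ?body = "[RLoad 0 1, RLoad 1 2, RMul 0 0 1, RAdd 2 2 0, NAdd 1 1 5, NAdd 2 2 5, NSub 0 0 5]"
  let ?fin = "[RConst 0 0, RAdd (10 + a) 2 0]"
  define I where "I = (\<lambda>i (t::state). i \<le> n \<and> nreg t 0 = n - i \<and> nreg t 1 = adr x + i \<and> nreg t 2 = adr y + i
    \<and> (\<forall>r\<ge>5. nreg t r = nreg s r) \<and> (\<forall>r\<ge>10. rreg t r = rreg s r)
    \<and> nmem t = nmem s \<and> draws t = draws s \<and> rmem t = rmem s
    \<and> rreg t 2 = (\<Sum>j<i. coord (V \<sigma> x) j * coord (V \<sigma> y) j))"
  define s0 where "s0 = fold (exec \<omega>) ?init s"
  have e0: "executes_within \<omega> (Block ?init) s 5 s0"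
    by (rule executes_within_Block[OF _ _ s0_def]) simp_all
  have "I 0 s0" using c by (simp add: I_def s0_def set_n_def set_r_def)
  then have "\<exists>s'. executes_within \<omega> (While (TN 0) (Block ?body)) s0 (n * (7 + 2) + 1) s' \<and> I n s'"
  proof (rule executes_within_While)
    fix i t assume i: "i < n" and I: "I i t"
    define t' where "t' = fold (exec \<omega>) ?body t"
    have n5: "nreg t 5 = 1" "nreg t 0 = n - i" "nreg t 1 = adr x + i" "nreg t 2 = adr y + i" "rmem t = rmem s"
      using I c by (simp_all add: I_def)
    have nr: "nreg t' 0 = n - Suc i" "nreg t' 1 = adr x + Suc i" "nreg t' 2 = adr y + Suc i"
      using n5 by (simp_all add: t'_def set_n_def set_r_def)
    have fr: "\<forall>r\<ge>5. nreg t' r = nreg t r" "\<forall>r\<ge>10. rreg t' r = rreg t r" "nmem t' = nmem t" "draws t' = draws t"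
        "rmem t' = rmem t"
      by (simp_all add: t'_def set_n_def set_r_def)
    have rm: "rreg t' 2 = rreg t 2 + coord (V \<sigma> x) i * coord (V \<sigma> y) i"
      using n5 vec[OF ix(1)] vec[OF ix(2)] i by (simp add: t'_def set_n_def set_r_def)
    have "executes_within \<omega> (Block ?body) t 7 t'" by (rule executes_within_Block[OF _ _ t'_def]) simp_all
    moreover have "I (Suc i) t'" using I i nr fr rm by (auto simp: I_def)
    moreover have "test_holds (TN 0) t" using I i by (simp add: I_def)
    ultimately show "test_holds (TN 0) t \<and> (\<exists>s'. executes_within \<omega> (Block ?body) t 7 s' \<and> I (Suc i) s')"
      by blast
  qed (simp add: I_def)
  then obtain s1 where s1: "executes_within \<omega> (While (TN 0) (Block ?body)) s0 (n * (7 + 2) + 1) s1" "I n s1"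
    by blast
  let ?s = "fold (exec \<omega>) ?fin s1"
  have e2: "executes_within \<omega> (Block ?fin) s1 2 ?s" by (rule executes_within_Block[OF _ _ refl]) simp_all
  have "executes_within \<omega> (vDot a x y) s (9 * n + 8) ?s"
    unfolding vDot_def by (rule executes_within_Seq[OF e0 executes_within_Seq[OF s1(1) e2 order_refl]]) simp
  moreover have "9 * n + 8 \<le> 1 * U" using n by (simp add: U_def)
  moreover have "sim ?s (\<sigma>\<lparr>R := (R \<sigma>)(a := inner (V \<sigma> x) (V \<sigma> y))\<rparr>)"
    by (rule sim_scalar[OF s])
      (use s1(2) s vec[OF ix(1)] in \<open>auto simp: I_def sim_def set_r_def set_n_def inner_in_dim[of n]\<close>)
  ultimately show "\<exists>s' T'. executes_within \<omega> (vDot a x y) s T' s' \<and> T' \<le> 1 * U \<and>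
      sim s' (\<sigma>\<lparr>R := (R \<sigma>)(a := inner (V \<sigma> x) (V \<sigma> y))\<rparr>)"
    by (intro exI[of _ ?s] exI[of _ "9 * n + 8"]) simp
qed (rule Q)

lemma wx_vNormal:
  assumes ix: "d < 20"
    and Q: "Q (\<sigma>\<lparr>V := (V \<sigma>)(d := vecn n (\<lambda>i. \<omega> (dr \<sigma> + i))), dr := dr \<sigma> + n\<rparr>)"
  shows "wx \<omega> (vNormal d) 1 Q \<sigma>"
proof (rule wxI)
  fix s assume s: "sim s \<sigma>"
  let ?v = "vecn n (\<lambda>i. \<omega> (dr \<sigma> + i))"
  have c: "nreg s 5 = 1" "nreg s 6 = n" "nreg s (20 + d) = adr d" "draws s = dr \<sigma>"
    using s ix by (auto simp: sim_def)
  let ?init = "[NConst 4 0, NAdd 0 6 4, NAdd 3 (20 + d) 4]"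
  let ?body = "[RNormal 0, RStore 3 0, NAdd 3 3 5, NSub 0 0 5]"
  define I where "I = (\<lambda>i (t::state). i \<le> n \<and> nreg t 0 = n - i
    \<and> nreg t 3 = adr d + i \<and> (\<forall>r\<ge>5. nreg t r = nreg s r) \<and> (\<forall>r\<ge>10. rreg t r = rreg s r)
    \<and> nmem t = nmem s \<and> draws t = draws s + i
    \<and> (\<forall>p. (\<forall>j<i. p \<noteq> adr d + j) \<longrightarrow> rmem t p = rmem s p)
    \<and> (\<forall>j<i. rmem t (adr d + j) = coord ?v j))"
  define s0 where "s0 = fold (exec \<omega>) ?init s"
  have e0: "executes_within \<omega> (Block ?init) s 3 s0"
    by (rule executes_within_Block[OF _ _ s0_def]) simp_all
  have "I 0 s0" using c by (simp add: I_def s0_def set_n_def)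
  then have "\<exists>s'. executes_within \<omega> (While (TN 0) (Block ?body)) s0 (n * (4 + 2) + 1) s' \<and> I n s'"
  proof (rule executes_within_While)
    fix i t assume i: "i < n" and I: "I i t"
    define t' where "t' = fold (exec \<omega>) ?body t"
    have n5: "nreg t 5 = 1" "nreg t 0 = n - i" "nreg t 3 = adr d + i" "draws t = dr \<sigma> + i"
      using I c by (simp_all add: I_def)
    have nr: "nreg t' 0 = n - Suc i" "nreg t' 3 = adr d + Suc i" "draws t' = Suc (draws t)"
      using n5 by (simp_all add: t'_def set_n_def set_r_def)
    have fr: "\<forall>r\<ge>5. nreg t' r = nreg t r" "\<forall>r\<ge>10. rreg t' r = rreg t r" "nmem t' = nmem t"
      by (simp_all add: t'_def set_n_def set_r_def)
    have rm: "rmem t' = (rmem t)(adr d + i := coord ?v i)"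
      using n5 i by (simp add: t'_def set_n_def set_r_def)
    have "executes_within \<omega> (Block ?body) t 4 t'" by (rule executes_within_Block[OF _ _ t'_def]) simp_all
    moreover have "I (Suc i) t'" unfolding I_def
    proof (intro conjI allI impI)
      fix p assume "\<forall>j<Suc i. p \<noteq> adr d + j"
      then show "rmem t' p = rmem s p" unfolding rm using I by (simp add: I_def)
    next
      fix j assume "j < Suc i"
      then show "rmem t' (adr d + j) = coord ?v j" unfolding rm using I by (auto simp: I_def)
    qed (use I i nr fr in \<open>auto simp: I_def\<close>)
    moreover have "test_holds (TN 0) t" using I i by (simp add: I_def)
    ultimately show "test_holds (TN 0) t \<and> (\<exists>s'. executes_within \<omega> (Block ?body) t 4 s' \<and> I (Suc i) s')"
      by blast
  qed (simp add: I_def)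
  then obtain s' where s': "executes_within \<omega> (While (TN 0) (Block ?body)) s0 (n * (4 + 2) + 1) s'" "I n s'"
    by blast
  have "executes_within \<omega> (vNormal d) s (6 * n + 4) s'"
    unfolding vNormal_def by (rule executes_within_Seq[OF e0 s'(1)]) simp
  moreover have "6 * n + 4 \<le> 1 * U" using n by (simp add: U_def)
  moreover have "sim s' (\<sigma>\<lparr>V := (V \<sigma>)(d := ?v), dr := dr \<sigma> + n\<rparr>)"
    by (rule sim_vec[OF s ix(1)]) (use s'(2) ix s in \<open>auto simp: I_def sim_def\<close>)
  ultimately show "\<exists>s' T'. executes_within \<omega> (vNormal d) s T' s' \<and> T' \<le> 1 * U \<and>
      sim s' (\<sigma>\<lparr>V := (V \<sigma>)(d := ?v), dr := dr \<sigma> + n\<rparr>)" by (intro exI[of _ s'] exI[of _ "6 * n + 4"]) simp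
qed (rule Q)

lemma wx_vMulAcc:
  assumes ix: "d < 20" "x < 20" "d \<noteq> x" and A: "A \<in> carrier_mat n n"
    and regs: "\<And>s. sim s \<sigma> \<Longrightarrow> nreg s cnt = length (nz_entries A) \<and> nreg s ip = ib \<and> nreg s vp = vb"
      "5 \<le> cnt" "5 \<le> ip" "5 \<le> vp"
    and idx: "\<And>e. e < length (nz_entries A) \<Longrightarrow>
      nm (ib + 2 * e) = fst (nz_entries A ! e) \<and> nm (Suc (ib + 2 * e)) = snd (nz_entries A ! e)"
    and vals: "\<And>s e. sim s \<sigma> \<Longrightarrow> e < length (nz_entries A) \<Longrightarrow> rmem s (vb + e) = A $$ (nz_entries A ! e)"
    and vb: "\<And>e k i. e < length (nz_entries A) \<Longrightarrow> i < n \<Longrightarrow> adr k + i \<noteq> vb + e"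
    and len: "length (nz_entries A) \<le> n0 + n1"
    and Q: "Q (\<sigma>\<lparr>V := (V \<sigma>)(d := V \<sigma> d + mat_op A (V \<sigma> x))\<rparr>)"
  shows "wx \<omega> (vMulAcc cnt ip vp d x) 1 Q \<sigma>"
proof (rule wxI)
  fix s assume s: "sim s \<sigma>"
  let ?v = "V \<sigma> d + mat_op A (V \<sigma> x)" and ?L = "nz_entries A"
  let ?m = "length ?L"
  have c: "nreg s 5 = 1" "nreg s 6 = n" "nreg s (20 + d) = adr d" "nreg s (20 + x) = adr x" "nmem s = nm"
    "nreg s cnt = ?m" "nreg s ip = ib" "nreg s vp = vb"
    using s ix regs by (auto simp: sim_def)
  have vec: "in_dim n (V \<sigma> k) \<and> (\<forall>i<n. rmem s (adr k + i) = coord (V \<sigma> k) i)" if "k < 20" for k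
    using s that by (auto simp: sim_def)
  have Lb: "fst (?L ! e) < n" "snd (?L ! e) < n" if "e < ?m" for e
    using nth_mem[OF that] A by (auto simp: nz_entries_def)
  let ?init = "[NConst 4 0, NAdd 0 cnt 4, NAdd 1 ip 4, NAdd 2 vp 4]"
  let ?body = "[NLoad 3 1, NAdd 3 3 (20 + d), NAdd 1 1 5, NLoad 4 1, NAdd 4 4 (20 + x), NAdd 1 1 5,
        RLoad 0 4, RLoad 1 2, RMul 0 1 0, RLoad 1 3, RAdd 1 1 0, RStore 3 1, NAdd 2 2 5, NSub 0 0 5]"
  define part where "part = (\<lambda>i r. coord (V \<sigma> d) r + (\<Sum>e<i. if fst (?L ! e) = r
      then A $$ (?L ! e) * coord (V \<sigma> x) (snd (?L ! e)) else 0))"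
  define I where "I = (\<lambda>i (t::state). i \<le> ?m \<and> nreg t 0 = ?m - i \<and> nreg t 1 = ib + 2 * i \<and> nreg t 2 = vb + i
    \<and> (\<forall>r\<ge>5. nreg t r = nreg s r) \<and> (\<forall>r\<ge>10. rreg t r = rreg s r)
    \<and> nmem t = nmem s \<and> draws t = draws s
    \<and> (\<forall>p. (\<forall>j<n. p \<noteq> adr d + j) \<longrightarrow> rmem t p = rmem s p)
    \<and> (\<forall>r<n. rmem t (adr d + r) = part i r))"
  define s0 where "s0 = fold (exec \<omega>) ?init s"
  have e0: "executes_within \<omega> (Block ?init) s 4 s0"
    by (rule executes_within_Block[OF _ _ s0_def]) simp_all
  have "I 0 s0" using c vec[OF ix(1)] regs(2-4) by (simp add: I_def s0_def set_n_def part_def)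
  then have "\<exists>s'. executes_within \<omega> (While (TN 0) (Block ?body)) s0 (?m * (14 + 2) + 1) s' \<and> I ?m s'"
  proof (rule executes_within_While)
    fix i t assume i: "i < ?m" and I: "I i t"
    define t' where "t' = fold (exec \<omega>) ?body t"
    let ?a = "fst (?L ! i)" and ?b = "snd (?L ! i)"
    have rx: "rmem t (adr x + ?b) = coord (V \<sigma> x) ?b"
      using I vec[OF ix(2)] Lb[OF i] adr_disjoint[OF ix(3)[symmetric] Lb(2)[OF i]] by (simp add: I_def)
    have rv: "rmem t (vb + i) = A $$ (?L ! i)"
      using I vals[OF s i] vb[OF i, of _ d] by (simp add: I_def) (metis)
    have rd: "rmem t (adr d + ?a) = part i ?a" using I Lb[OF i] by (simp add: I_def)
    have ii: "nm (ib + 2 * i) = ?a" "nm (Suc (ib + 2 * i)) = ?b" using idx[OF i] by auto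
    have rm: "rmem t' = (rmem t)(adr d + ?a := part i ?a + A $$ (?L ! i) * coord (V \<sigma> x) ?b)"
      using I c rx rv rd ii by (simp add: t'_def I_def set_n_def set_r_def add.commute)
    have n5: "nreg t 5 = 1" "nreg t 0 = ?m - i" "nreg t 1 = ib + 2 * i" "nreg t 2 = vb + i"
      using I c by (simp_all add: I_def)
    have nr: "nreg t' 0 = ?m - Suc i" "nreg t' 1 = ib + 2 * Suc i" "nreg t' 2 = vb + Suc i"
      using n5 by (simp_all add: t'_def set_n_def set_r_def)
    have fr: "\<forall>r\<ge>5. nreg t' r = nreg t r" "\<forall>r\<ge>10. rreg t' r = rreg t r" "nmem t' = nmem t" "draws t' = draws t"
      by (simp_all add: t'_def set_n_def set_r_def)
    have "executes_within \<omega> (Block ?body) t 14 t'" by (rule executes_within_Block[OF _ _ t'_def]) simp_all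
    moreover have "I (Suc i) t'" unfolding I_def
    proof (intro conjI allI impI)
      fix p assume "\<forall>j<n. p \<noteq> adr d + j"
      then show "rmem t' p = rmem s p" unfolding rm using I Lb[OF i] by (simp add: I_def)
    next
      fix r assume "r < n"
      then show "rmem t' (adr d + r) = part (Suc i) r"
        unfolding rm using I by (auto simp: I_def part_def)
    qed (use I i nr fr in \<open>auto simp: I_def\<close>)
    moreover have "test_holds (TN 0) t" using I i by (simp add: I_def)
    ultimately show "test_holds (TN 0) t \<and> (\<exists>s'. executes_within \<omega> (Block ?body) t 14 s' \<and> I (Suc i) s')"
      by blast
  qed (simp add: I_def)
  then obtain s' where s': "executes_within \<omega> (While (TN 0) (Block ?body)) s0 (?m * (14 + 2) + 1) s'" "I ?m s'"
    by blast
  have "executes_within \<omega> (vMulAcc cnt ip vp d x) s (16 * ?m + 5) s'"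
    unfolding vMulAcc_def by (rule executes_within_Seq[OF e0 s'(1)]) simp
  moreover have "16 * ?m + 5 \<le> 1 * U" using n len by (simp add: U_def)
  moreover have "sim s' (\<sigma>\<lparr>V := (V \<sigma>)(d := ?v), dr := dr \<sigma>\<rparr>)"
  proof (rule sim_vec[OF s ix(1)])
    show "in_dim n ?v" using vec[OF ix(1)] A by auto
    fix i assume i: "i < n"
    have "rmem s' (adr d + i) = part ?m i" using s'(2) i by (simp add: I_def)
    also have "\<dots> = coord ?v i" unfolding part_def sum_nz_entries[OF A i] using A i by (simp add: mat_op_def)
    finally show "rmem s' (adr d + i) = coord ?v i" .
  qed (use s'(2) s in \<open>auto simp: I_def sim_def\<close>)
  ultimately show "\<exists>s' T'. executes_within \<omega> (vMulAcc cnt ip vp d x) s T' s' \<and> T' \<le> 1 * U \<and>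
      sim s' (\<sigma>\<lparr>V := (V \<sigma>)(d := ?v)\<rparr>)" by (intro exI[of _ s'] exI[of _ "16 * ?m + 5"]) simp
qed (rule Q)

lemma wx_vMul0:
  assumes ix: "d < 20" "x < 20" "d \<noteq> x" and z: "R \<sigma> z = 0"
    and Q: "Q (\<sigma>\<lparr>V := (V \<sigma>)(d := mat_op A0 (V \<sigma> x))\<rparr>)"
  shows "wx \<omega> (vMul0 z d x) 2 Q \<sigma>"
proof -
  have "wx \<omega> (vMul0 z d x) (1 + 1) Q \<sigma>" unfolding vMul0_def
  proof (rule wx_Seq, rule wx_vLin[OF ix(1) ix(1) ix(1)],
      rule wx_vMulAcc[OF ix A0, where ib = 3 and vb = "7 + 2 * n"])
    fix e k i assume "e < n0" "i < n"
    then show "adr k + i \<noteq> 7 + 2 * n + e" by (intro adr_values) auto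
  qed (use nm0 Q ix z in \<open>auto simp: sim_def add_ac eval_nat_numeral\<close>)
  then show ?thesis by (simp add: numeral_2_eq_2)
qed

lemma wx_vMul1:
  assumes ix: "d < 20" "x < 20" "d \<noteq> x" and z: "R \<sigma> z = 0"
    and Q: "Q (\<sigma>\<lparr>V := (V \<sigma>)(d := mat_op A1 (V \<sigma> x))\<rparr>)"
  shows "wx \<omega> (vMul1 z d x) 2 Q \<sigma>"
proof -
  have "wx \<omega> (vMul1 z d x) (1 + 1) Q \<sigma>" unfolding vMul1_def
  proof (rule wx_Seq, rule wx_vLin[OF ix(1) ix(1) ix(1)],
      rule wx_vMulAcc[OF ix A1, where ib = "3 + 2 * n0" and vb = "7 + 2 * n + n0"])
    fix e k i assume "e < n1" "i < n"
    then show "adr k + i \<noteq> 7 + 2 * n + n0 + e" using adr_values[of i "n0 + e" k] by (simp add: add.assoc)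
  qed (use nm1 Q ix z in \<open>auto simp: sim_def add_ac eval_nat_numeral\<close>)
  then show ?thesis by (simp add: numeral_2_eq_2)
qed

lemmas wx_prims = wx_scalars wx_vLin wx_vDot wx_vNormal wx_vMul0 wx_vMul1

end

section \<open>Measurability and Gaussian vectors\<close>

definition std_normal :: "real measure" where
  "std_normal = density lborel (\<lambda>x. ennreal (std_normal_density x))"

lemma samples_eq: "samples = (\<Pi>\<^sub>M i\<in>UNIV. std_normal)"
  by (simp add: samples_def std_normal_def)

lemma sets_std_normal [measurable_cong, simp]: "sets std_normal = sets borel"
  by (simp add: std_normal_def)

lemma space_std_normal [simp]: "space std_normal = UNIV"
  by (simp add: std_normal_def)

lemma space_samples [simp]: "space samples = UNIV"
  by (simp add: samples_eq space_PiM)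

lemma measurable_sample [measurable]: "(\<lambda>\<omega>. \<omega> i) \<in> borel_measurable samples"
proof -
  have "(\<lambda>\<omega>. \<omega> i) \<in> measurable samples std_normal"
    unfolding samples_eq by (rule measurable_component_singleton) simp
  then show ?thesis by (simp cong: measurable_cong_sets)
qed

text \<open>Measurability is demanded for every register and memory cell separately, so no
  measurable space of states has to be set up.\<close>

definition measurable_state :: "((nat \<Rightarrow> real) \<Rightarrow> state) \<Rightarrow> bool" where
  "measurable_state f \<longleftrightarrow>
     (\<lambda>\<omega>. pc (f \<omega>)) \<in> measurable samples (count_space UNIV) \<and>
     (\<lambda>\<omega>. draws (f \<omega>)) \<in> measurable samples (count_space UNIV) \<and>
     (\<forall>a. (\<lambda>\<omega>. nreg (f \<omega>) a) \<in> measurable samples (count_space UNIV)) \<and>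
     (\<forall>a. (\<lambda>\<omega>. nmem (f \<omega>) a) \<in> measurable samples (count_space UNIV)) \<and>
     (\<forall>a. (\<lambda>\<omega>. rreg (f \<omega>) a) \<in> borel_measurable samples) \<and>
     (\<forall>a. (\<lambda>\<omega>. rmem (f \<omega>) a) \<in> borel_measurable samples)"

lemma measurable_state_exec:
  assumes "measurable_state f"
  shows "measurable_state (\<lambda>\<omega>. exec \<omega> i (f \<omega>))"
proof -
  have [measurable]: "(\<lambda>\<omega>. pc (f \<omega>)) \<in> measurable samples (count_space UNIV)"
     "(\<lambda>\<omega>. draws (f \<omega>)) \<in> measurable samples (count_space UNIV)"
     "\<And>a. (\<lambda>\<omega>. nreg (f \<omega>) a) \<in> measurable samples (count_space UNIV)"
     "\<And>a. (\<lambda>\<omega>. nmem (f \<omega>) a) \<in> measurable samples (count_space UNIV)"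
     "\<And>a. (\<lambda>\<omega>. rreg (f \<omega>) a) \<in> borel_measurable samples"
     "\<And>a. (\<lambda>\<omega>. rmem (f \<omega>) a) \<in> borel_measurable samples"
    using assms by (auto simp: measurable_state_def)
  \<comment> \<open>Under indirect addressing the address is random too, but it takes countably many
    values, and for each fixed address the content is measurable.\<close>
  have [measurable]: "(\<lambda>\<omega>. nmem (f \<omega>) (nreg (f \<omega>) b)) \<in> measurable samples (count_space UNIV)" for b
    by (rule measurable_compose_countable[of "\<lambda>i \<omega>. nmem (f \<omega>) i"]) measurable
  have [measurable]: "(\<lambda>\<omega>. rmem (f \<omega>) (nreg (f \<omega>) b)) \<in> borel_measurable samples" for b
    by (rule measurable_compose_countable[of "\<lambda>i \<omega>. rmem (f \<omega>) i"]) measurable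
  have [measurable]: "(\<lambda>\<omega>. \<omega> (draws (f \<omega>))) \<in> borel_measurable samples"
    by (rule measurable_compose_countable[of "\<lambda>i \<omega>. \<omega> i"]) measurable
  show ?thesis unfolding measurable_state_def
    by (cases i; intro conjI allI; simp add: set_n_def set_r_def fun_upd_def if_distrib cong: if_cong; measurable)
qed

lemma measurable_state_step:
  assumes f: "measurable_state f"
  shows "measurable_state (\<lambda>\<omega>. step P \<omega> (f \<omega>))"
proof -
  \<comment> \<open>The instruction to be executed depends on the random program counter; g fixes
    the counter, which again has countably many values.\<close>
  define g where "g = (\<lambda>i \<omega>. if length P \<le> i then f \<omega> else exec \<omega> (P ! i) (f \<omega>))"
  have g: "measurable_state (g i)" for i
    unfolding g_def using f measurable_state_exec[OF f] by (cases "length P \<le> i") simp_all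
  have eq: "step P \<omega> (f \<omega>) = g (pc (f \<omega>)) \<omega>" for \<omega> by (simp add: g_def step_def halted_def)
  have pc: "(\<lambda>\<omega>. pc (f \<omega>)) \<in> measurable samples (count_space UNIV)" using f by (simp add: measurable_state_def)
  show ?thesis unfolding measurable_state_def eq
    by (intro conjI allI; rule measurable_compose_countable[OF _ pc]; use g in \<open>simp add: measurable_state_def\<close>)
qed

lemma measurable_state_run: "measurable_state (\<lambda>\<omega>. run P \<omega> s t)"
proof (induction t)
  case 0
  then show ?case by (simp add: measurable_state_def)
next
  case (Suc t)
  have "run P \<omega> s (Suc t) = step P \<omega> (run P \<omega> s t)" for \<omega> by (simp add: run_def)
  with measurable_state_step[OF Suc] show ?case by simp
qed

interpretation smp: sequence_space std_normal
proof -
  interpret prob_space std_normal unfolding std_normal_def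
    by (rule prob_space_normal_density) simp
  show "sequence_space std_normal" by standard
qed

interpretation sp: prob_space samples
  unfolding samples_eq by (rule smp.prob_space_axioms)

lemma distr_sample: "distr samples borel (\<lambda>\<omega>. \<omega> i) = std_normal"
proof -
  have "distr samples std_normal (\<lambda>\<omega>. \<omega> i) = std_normal"
    unfolding samples_eq by (rule smp.PiM_component) simp
  then show ?thesis by (metis distr_cong sets_std_normal)
qed

lemma distributed_sample: "distributed samples lborel (\<lambda>\<omega>. \<omega> i) std_normal_density"
proof -
  have "distr samples lborel (\<lambda>\<omega>. \<omega> i) = distr samples borel (\<lambda>\<omega>. \<omega> i)"
    by (rule distr_cong) auto
  then show ?thesis unfolding distributed_def by (simp add: distr_sample std_normal_def)
qed

lemma indep_samples: "sp.indep_vars (\<lambda>_. borel) (\<lambda>i \<omega>. \<omega> i) UNIV"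
proof -
  have "sp.indep_vars (\<lambda>_. std_normal) (\<lambda>i \<omega>. \<omega> i) UNIV"
  proof (subst sp.indep_vars_iff_distr_eq_PiM')
    show "UNIV \<noteq> {}" by simp
    show "(\<lambda>\<omega>. \<omega> i) \<in> measurable samples std_normal" for i
      using measurable_sample[of i] by (simp cong: measurable_cong_sets)
    have "distr samples std_normal (\<lambda>\<omega>. \<omega> i) = std_normal" for i
      by (metis distr_cong distr_sample sets_std_normal)
    then show "distr samples (Pi\<^sub>M UNIV (\<lambda>i. std_normal)) (\<lambda>x. \<lambda>i\<in>UNIV. x i) =
        Pi\<^sub>M UNIV (\<lambda>i. distr samples std_normal (\<lambda>\<omega>. \<omega> i))"
      by (simp add: samples_eq distr_id restrict_UNIV)
  qed
  then show ?thesis unfolding sp.indep_vars_def2 by (simp cong: measurable_cong_sets)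
qed

section \<open>Small ball and norm estimates for Gaussian vectors\<close>

lemma std_normal_density_le: "std_normal_density x \<le> 1 / 2"
proof -
  have "2 \<le> sqrt (2 * pi)" using pi_ge_two by (intro real_le_rsqrt) auto
  then have "1 / sqrt (2 * pi) \<le> 1 / 2" by (intro divide_left_mono) auto
  moreover have "exp (- x\<^sup>2 / 2) \<le> 1" by simp
  ultimately have "1 / sqrt (2 * pi) * exp (- x\<^sup>2 / 2) \<le> 1 / 2 * 1" by (intro mult_mono) auto
  then show ?thesis by (simp add: std_normal_density_def)
qed

text \<open>The product with a unit vector is again standard normal. Its density is at most 1/2 and
  the interval has length 2 t.\<close>

lemma gaussian_small_ball:
  assumes u: "(\<Sum>i<n. (u i)\<^sup>2) = 1" and t: "0 \<le> t"
  shows "measure samples {\<omega>. \<bar>\<Sum>i<n. u i * \<omega> i\<bar> \<le> t} \<le> t"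
proof -
  \<comment> \<open>Zero coefficients are dropped because the sum rule for independent normals needs
    positive deviations and a nonempty index set.\<close>
  let ?I = "{i. i < n \<and> u i \<noteq> 0}"
  have sum_eq: "(\<Sum>i<n. u i * \<omega> i) = (\<Sum>i\<in>?I. 0 + u i * \<omega> i)" for \<omega>
    by (rule sum.mono_neutral_cong_right) auto
  have "(\<Sum>i\<in>?I. (\<bar>u i\<bar> * 1)\<^sup>2) = (\<Sum>i<n. (u i)\<^sup>2)"
    by (rule sum.mono_neutral_cong_left) auto
  then have sq: "(\<Sum>i\<in>?I. (\<bar>u i\<bar> * 1)\<^sup>2) = 1" using u by simp
  have ne: "?I \<noteq> {}"
  proof
    assume "?I = {}"
    then have "(\<Sum>i<n. (u i)\<^sup>2) = 0" by (intro sum.neutral) auto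
    with u show False by simp
  qed
  have ind: "sp.indep_vars (\<lambda>_. borel) (\<lambda>i \<omega>. 0 + u i * \<omega> i) ?I"
    by (rule sp.indep_vars_compose2[OF sp.indep_vars_subset[OF indep_samples]]) auto
  have D: "distributed samples lborel (\<lambda>\<omega>. \<Sum>i\<in>?I. 0 + u i * \<omega> i)
     (normal_density (\<Sum>i\<in>?I. 0 + u i * 0) (sqrt (\<Sum>i\<in>?I. (\<bar>u i\<bar> * 1)\<^sup>2)))"
  proof (rule sp.sum_indep_normal[OF _ ne ind])
    fix i assume "i \<in> ?I"
    then show "distributed samples lborel (\<lambda>\<omega>. 0 + u i * \<omega> i) (normal_density (0 + u i * 0) (\<bar>u i\<bar> * 1))"
      by (intro sp.normal_density_affine distributed_sample) auto
  qed auto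
  have D': "distributed samples lborel (\<lambda>\<omega>. \<Sum>i<n. u i * \<omega> i) std_normal_density"
    using D unfolding sq sum_eq[symmetric] by simp
  have "emeasure samples ((\<lambda>\<omega>. \<Sum>i<n. u i * \<omega> i) -` {-t..t} \<inter> space samples)
      = (\<integral>\<^sup>+x. ennreal (std_normal_density x) * indicator {-t..t} x \<partial>lborel)"
    by (rule distributed_emeasure[OF D']) simp
  also have "\<dots> \<le> (\<integral>\<^sup>+x. ennreal (1 / 2) * indicator {-t..t} x \<partial>lborel)"
    by (intro nn_integral_mono mult_right_mono ennreal_leI std_normal_density_le) auto
  also have "\<dots> = ennreal (1 / 2) * ennreal (2 * t)"
    using t by (simp add: nn_integral_cmult_indicator)
  also have "\<dots> = ennreal t" using t by (subst ennreal_mult[symmetric]) auto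
  finally have "emeasure samples ((\<lambda>\<omega>. \<Sum>i<n. u i * \<omega> i) -` {-t..t} \<inter> space samples) \<le> ennreal t" .
  moreover have "(\<lambda>\<omega>. \<Sum>i<n. u i * \<omega> i) -` {-t..t} \<inter> space samples = {\<omega>. \<bar>\<Sum>i<n. u i * \<omega> i\<bar> \<le> t}"
    by auto
  ultimately show ?thesis using t by (simp add: sp.emeasure_eq_measure)
qed

text \<open>Markov's inequality, the expected squared norm being n.\<close>

lemma gaussian_norm_bound:
  assumes q: "0 < q" and n: "0 < n"
  shows "measure samples {\<omega>. real n / q \<le> (\<Sum>i<n. (\<omega> i)\<^sup>2)} \<le> q"
proof -
  have one: "(\<integral>\<^sup>+\<omega>. ennreal ((\<omega> i)\<^sup>2) \<partial>samples) = 1" for i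
  proof -
    have hb: "has_bochner_integral lborel (\<lambda>x. std_normal_density x * x ^ (2 * 1)) (fact (2 * 1) / (2 ^ 1 * fact 1))"
      by (rule std_normal_moment_even)
    have "(\<integral>\<^sup>+\<omega>. ennreal ((\<omega> i)\<^sup>2) \<partial>samples) = (\<integral>\<^sup>+x. ennreal (x\<^sup>2) \<partial>distr samples borel (\<lambda>\<omega>. \<omega> i))"
      by (subst nn_integral_distr) auto
    also have "\<dots> = (\<integral>\<^sup>+x. ennreal (std_normal_density x) * ennreal (x\<^sup>2) \<partial>lborel)"
      unfolding distr_sample std_normal_def by (subst nn_integral_density) auto
    also have "\<dots> = (\<integral>\<^sup>+x. ennreal (std_normal_density x * x ^ (2 * 1)) \<partial>lborel)"
      by (intro nn_integral_cong) (simp add: ennreal_mult' power2_eq_square)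
    also have "\<dots> = ennreal (fact (2 * 1) / (2 ^ 1 * fact 1))"
      using hb by (subst nn_integral_eq_integral) (auto simp: has_bochner_integral_iff fact_2)
    finally show ?thesis by (simp add: fact_2)
  qed
  have S: "(\<integral>\<^sup>+\<omega>. ennreal (\<Sum>i<n. (\<omega> i)\<^sup>2) \<partial>samples) = of_nat n"
  proof -
    have "(\<integral>\<^sup>+\<omega>. ennreal (\<Sum>i<n. (\<omega> i)\<^sup>2) \<partial>samples) = (\<integral>\<^sup>+\<omega>. (\<Sum>i<n. ennreal ((\<omega> i)\<^sup>2)) \<partial>samples)"
      by (intro nn_integral_cong) (simp add: sum_ennreal)
    also have "\<dots> = (\<Sum>i<n. \<integral>\<^sup>+\<omega>. ennreal ((\<omega> i)\<^sup>2) \<partial>samples)" by (intro nn_integral_sum) auto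
    finally show ?thesis by (simp add: one)
  qed
  have "emeasure samples {\<omega> \<in> space samples. 1 \<le> ennreal (q / n) * ennreal (\<Sum>i<n. (\<omega> i)\<^sup>2)}
     \<le> ennreal (q / n) * (\<integral>\<^sup>+\<omega>. ennreal (\<Sum>i<n. (\<omega> i)\<^sup>2) * indicator (space samples) \<omega> \<partial>samples)"
    by (rule nn_integral_Markov_inequality) (auto simp del: space_samples)
  also have "\<dots> = ennreal (q / n) * of_nat n" using S by simp
  also have "\<dots> = ennreal q"
    unfolding ennreal_of_nat_eq_real_of_nat using q n by (subst ennreal_mult[symmetric]) auto
  finally have "emeasure samples {\<omega> \<in> space samples. 1 \<le> ennreal (q / n) * ennreal (\<Sum>i<n. (\<omega> i)\<^sup>2)} \<le> ennreal q" .
  moreover have "(1 \<le> ennreal (q / n) * ennreal (\<Sum>i<n. (\<omega> i)\<^sup>2)) = (real n / q \<le> (\<Sum>i<n. (\<omega> i)\<^sup>2))" for \<omega>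
    using q n by (subst ennreal_mult[symmetric]) (auto simp: sum_nonneg field_simps ennreal_1[symmetric] simp del: ennreal_1)
  ultimately show ?thesis using q by (simp add: sp.emeasure_eq_measure)
qed

text \<open>Each of the two estimates is used with failure probability q / 2. Outside both events 4
  |g|^2 < 8 n / q, and (u . g)^2 \<ge> q^2 / 4; the quotient of these bounds is 32 n / q^3.\<close>

lemma gaussian_overlap:
  assumes u: "(\<Sum>i<n. (u i)\<^sup>2) = 1" and n: "0 < n" and q: "0 < q"
  shows "measure samples {\<omega>. \<not> 4 * (\<Sum>i<n. (\<omega> i)\<^sup>2) < 32 * real n / q ^ 3 * (\<Sum>i<n. u i * \<omega> i)\<^sup>2} \<le> q"
proof -
  let ?A = "{\<omega>. \<bar>\<Sum>i<n. u i * \<omega> i\<bar> \<le> q / 2}" and ?B = "{\<omega>. real n / (q / 2) \<le> (\<Sum>i<n. (\<omega> i)\<^sup>2)}"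
  have m: "?A \<in> sets samples" "?B \<in> sets samples"
  proof -
    have "{\<omega> \<in> space samples. \<bar>\<Sum>i<n. u i * \<omega> i\<bar> \<le> q / 2} \<in> sets samples" by measurable
    then show "?A \<in> sets samples" by simp
    have "{\<omega> \<in> space samples. real n / (q / 2) \<le> (\<Sum>i<n. (\<omega> i)\<^sup>2)} \<in> sets samples" by measurable
    then show "?B \<in> sets samples" by simp
  qed
  have "{\<omega>. \<not> 4 * (\<Sum>i<n. (\<omega> i)\<^sup>2) < 32 * real n / q ^ 3 * (\<Sum>i<n. u i * \<omega> i)\<^sup>2} \<subseteq> ?A \<union> ?B"
  proof
    fix \<omega> assume "\<omega> \<in> {\<omega>. \<not> 4 * (\<Sum>i<n. (\<omega> i)\<^sup>2) < 32 * real n / q ^ 3 * (\<Sum>i<n. u i * \<omega> i)\<^sup>2}"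
    then have bad: "32 * real n / q ^ 3 * (\<Sum>i<n. u i * \<omega> i)\<^sup>2 \<le> 4 * (\<Sum>i<n. (\<omega> i)\<^sup>2)" by simp
    show "\<omega> \<in> ?A \<union> ?B"
    proof (rule ccontr)
      assume "\<omega> \<notin> ?A \<union> ?B"
      then have a: "q / 2 < \<bar>\<Sum>i<n. u i * \<omega> i\<bar>" and b: "(\<Sum>i<n. (\<omega> i)\<^sup>2) < real n / (q / 2)" by auto
      have "(q / 2)\<^sup>2 \<le> (\<Sum>i<n. u i * \<omega> i)\<^sup>2" using a q by (simp add: abs_le_square_iff[symmetric])
      then have "32 * real n / q ^ 3 * (q / 2)\<^sup>2 \<le> 32 * real n / q ^ 3 * (\<Sum>i<n. u i * \<omega> i)\<^sup>2"
        using q by (intro mult_left_mono) auto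
      moreover have "32 * real n / q ^ 3 * (q / 2)\<^sup>2 = 4 * (real n / (q / 2))"
        using q by (simp add: field_simps power2_eq_square power3_eq_cube)
      ultimately show False using bad b by simp
    qed
  qed
  then have "measure samples {\<omega>. \<not> 4 * (\<Sum>i<n. (\<omega> i)\<^sup>2) < 32 * real n / q ^ 3 * (\<Sum>i<n. u i * \<omega> i)\<^sup>2}
      \<le> measure samples (?A \<union> ?B)"
    using m by (intro sp.finite_measure_mono) auto
  also have "\<dots> \<le> measure samples ?A + measure samples ?B" using m by (intro measure_Un_le) auto
  also have "\<dots> \<le> q / 2 + q / 2"
    using gaussian_small_ball[OF u, of "q / 2"] gaussian_norm_bound[OF _ n, of "q / 2"] q by (intro add_mono) auto
  finally show ?thesis by simp
qed

section \<open>Adaptive tests on fresh blocks of samples\<close>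

fun test_path :: "(bool list \<Rightarrow> (nat \<Rightarrow> real) \<Rightarrow> bool) \<Rightarrow> nat \<Rightarrow> nat \<Rightarrow> (nat \<Rightarrow> real) \<Rightarrow> nat \<Rightarrow> bool list" where
  "test_path f n d \<omega> 0 = []"
| "test_path f n d \<omega> (Suc j) = test_path f n d \<omega> j @ [f (test_path f n d \<omega> j) (\<lambda>i. \<omega> (d + j * n + i))]"

lemma measurable_shift [measurable]: "(\<lambda>\<omega> i. \<omega> (d + i)) \<in> measurable samples samples"
proof -
  have "(\<lambda>\<omega> i. \<omega> (d + i)) \<in> measurable samples (\<Pi>\<^sub>M i\<in>UNIV. std_normal)"
    by (rule measurable_PiM_single') (auto simp: measurable_cong_sets[OF refl sets_std_normal])
  then show ?thesis by (simp add: samples_eq)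
qed

lemma measurable_test_path:
  assumes f: "\<And>l. {\<omega>. f l \<omega>} \<in> sets samples"
  shows "(\<lambda>\<omega>. test_path f n d \<omega> j) \<in> measurable samples (count_space UNIV)"
proof (induction j)
  case (Suc j)
  have p: "Measurable.pred samples (f l)" for l using f[of l] by (simp add: pred_def)
  have "(\<lambda>\<omega>. (\<lambda>l \<omega>. l @ [f l (\<lambda>i. \<omega> (d + j * n + i))]) (test_path f n d \<omega> j) \<omega>) \<in> measurable samples (count_space UNIV)"
  proof (rule measurable_compose_countable[OF _ Suc])
    fix l
    have "(\<lambda>\<omega>. f l (\<lambda>i. \<omega> (d + j * n + i))) \<in> measurable samples (count_space UNIV)"
      by (rule measurable_compose[OF measurable_shift p])
    then show "(\<lambda>\<omega>. l @ [f l (\<lambda>i. \<omega> (d + j * n + i))]) \<in> measurable samples (count_space UNIV)"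
      by (rule measurable_compose) simp
  qed
  then show ?case by simp
qed simp

text \<open>This locality separates the past of test j from its own block of samples.\<close>

lemma test_path_cong:
  assumes "\<And>l \<omega> \<omega>'. (\<And>i. i < n \<Longrightarrow> \<omega> i = \<omega>' i) \<Longrightarrow> f l \<omega> = f l \<omega>'"
    and "\<And>i. i < d + j * n \<Longrightarrow> \<omega> i = \<omega>' i"
  shows "test_path f n d \<omega> j = test_path f n d \<omega>' j"
  using assms(2)
proof (induction j)
  case (Suc j)
  have "test_path f n d \<omega> j = test_path f n d \<omega>' j" by (rule Suc.IH) (simp add: Suc.prems)
  moreover have "f l (\<lambda>i. \<omega> (d + j * n + i)) = f l (\<lambda>i. \<omega>' (d + j * n + i))" for l
    by (rule assms(1)) (simp add: Suc.prems)
  ultimately show ?case by simp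
qed simp

text \<open>The sample sequence is distributed like a prefix of length d + j n followed by an
  independent copy of the whole sequence. The history depends on the prefix alone, so for each fixed
  prefix the bad event is that of a fixed test, and Fubini gives the bound q.\<close>

lemma adaptive_failure:
  fixes d j n :: nat and f bad :: "bool list \<Rightarrow> (nat \<Rightarrow> real) \<Rightarrow> bool" and q :: real
  assumes loc: "\<And>l \<omega> \<omega>'. (\<And>i. i < n \<Longrightarrow> \<omega> i = \<omega>' i) \<Longrightarrow> f l \<omega> = f l \<omega>'"
    and f: "\<And>l. {\<omega>. f l \<omega>} \<in> sets samples"
    and bad: "\<And>l. {\<omega>. bad l \<omega>} \<in> sets samples" "\<And>l. measure samples {\<omega>. bad l \<omega>} \<le> q"
  defines "F \<equiv> \<lambda>j. {\<omega>. bad (test_path f n d \<omega> j) (\<lambda>i. \<omega> (d + j * n + i))}"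
  shows "F j \<in> sets samples" "measure samples (F j) \<le> q"
proof -
  let ?D = "d + j * n"
  have b: "Measurable.pred samples (bad l)" for l using bad(1)[of l] by (simp add: pred_def)
  have mb: "Measurable.pred samples (\<lambda>\<omega>. (\<lambda>l \<omega>. bad l (\<lambda>i. \<omega> (?D + i))) (test_path f n d \<omega> j) \<omega>)"
    by (rule measurable_compose_countable[OF _ measurable_test_path[OF f]])
      (rule measurable_compose[OF measurable_shift b])
  then show F: "F j \<in> sets samples" unfolding F_def by (simp add: pred_def)
  have q: "0 \<le> q" using bad(2) measure_nonneg order_trans by blast
  have S: "samples = distr (samples \<Otimes>\<^sub>M samples) samples (\<lambda>(\<omega>, \<omega>'). comb_seq ?D \<omega> \<omega>')"
    unfolding samples_eq by (rule smp.PiM_comb_seq[symmetric])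
  have mc: "(\<lambda>(\<omega>, \<omega>'). comb_seq ?D \<omega> \<omega>') \<in> measurable (samples \<Otimes>\<^sub>M samples) samples"
    unfolding samples_eq by (rule measurable_comb_seq)
  have pre: "(\<lambda>(\<omega>, \<omega>'). comb_seq ?D \<omega> \<omega>') -` F j \<inter> space (samples \<Otimes>\<^sub>M samples)
      = {(\<omega>, \<omega>'). bad (test_path f n d \<omega> j) \<omega>'}"
  proof -
    have "test_path f n d (comb_seq ?D \<omega> \<omega>') j = test_path f n d \<omega> j" for \<omega> \<omega>'
      by (rule test_path_cong[OF loc]) (auto simp: comb_seq_def)
    moreover have "bad l (\<lambda>i. comb_seq ?D \<omega> \<omega>' (?D + i)) = bad l \<omega>'" for l \<omega> \<omega>'
      by (rule arg_cong[of _ _ "bad l"]) (simp add: comb_seq_def fun_eq_iff)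
    ultimately show ?thesis by (auto simp: F_def space_pair_measure)
  qed
  have ms: "{(\<omega>, \<omega>'). bad (test_path f n d \<omega> j) \<omega>'} \<in> sets (samples \<Otimes>\<^sub>M samples)"
    unfolding pre[symmetric] by (rule measurable_sets[OF mc F])
  have "emeasure samples (F j) = emeasure (samples \<Otimes>\<^sub>M samples) {(\<omega>, \<omega>'). bad (test_path f n d \<omega> j) \<omega>'}"
    by (subst S, subst emeasure_distr[OF mc F]) (simp only: pre)
  also have "\<dots> = (\<integral>\<^sup>+\<omega>. emeasure samples (Pair \<omega> -` {(\<omega>, \<omega>'). bad (test_path f n d \<omega> j) \<omega>'}) \<partial>samples)"
    by (rule sp.emeasure_pair_measure_alt[OF ms])
  also have "\<dots> \<le> (\<integral>\<^sup>+\<omega>. ennreal q \<partial>samples)"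
  proof (rule nn_integral_mono)
    fix \<omega>
    have "Pair \<omega> -` {(\<omega>, \<omega>'). bad (test_path f n d \<omega> j) \<omega>'} = {\<omega>'. bad (test_path f n d \<omega> j) \<omega>'}" by auto
    then show "emeasure samples (Pair \<omega> -` {(\<omega>, \<omega>'). bad (test_path f n d \<omega> j) \<omega>'}) \<le> ennreal q"
      using bad(2) q by (simp add: sp.emeasure_eq_measure)
  qed
  also have "\<dots> = ennreal q" using sp.emeasure_space_1 by simp
  finally show "measure samples (F j) \<le> q" using q by (simp add: sp.emeasure_eq_measure)
qed

section \<open>Symmetric matrices\<close>

text \<open>Compactness comes from Tychonoff's theorem: all coordinates from n on are pinned to 0,
  which embeds the box into a product of real lines.\<close>

lemma box_attains_min:
  fixes F G :: "(nat \<Rightarrow> real) \<Rightarrow> real"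
  assumes F: "continuous_on UNIV F" and G: "continuous_on UNIV G"
    and f0: "\<And>i. f0 i \<in> (if i < n then {-r..r} else {0})" "G f0 \<le> 0"
  shows "\<exists>f. (\<forall>i. f i \<in> (if i < n then {-r..r} else {0})) \<and> G f \<le> 0 \<and>
    (\<forall>g. (\<forall>i. g i \<in> (if i < n then {-r..r} else {0})) \<longrightarrow> G g \<le> 0 \<longrightarrow> F f \<le> F g)"
proof -
  let ?B = "\<lambda>i. if i < n then {-r..r} else {0 :: real}"
  have "compactin (product_topology (\<lambda>_. euclidean) UNIV) (PiE UNIV ?B)"
    by (auto simp: compactin_PiE)
  then have "compact (PiE UNIV ?B)" by (simp add: euclidean_product_topology)
  then have "compact (PiE UNIV ?B \<inter> {f. G f \<le> 0})"
    by (intro compact_Int_closed closed_Collect_le G continuous_intros)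
  moreover have "f0 \<in> PiE UNIV ?B \<inter> {f. G f \<le> 0}" using f0 unfolding PiE_UNIV_domain by blast
  then have "PiE UNIV ?B \<inter> {f. G f \<le> 0} \<noteq> {}" by blast
  ultimately obtain f where "f \<in> PiE UNIV ?B \<inter> {f. G f \<le> 0}"
      "\<forall>g\<in>PiE UNIV ?B \<inter> {f. G f \<le> 0}. F f \<le> F g"
    using continuous_attains_inf[of "PiE UNIV ?B \<inter> {f. G f \<le> 0}" F] continuous_on_subset[OF F] by blast
  then show ?thesis unfolding PiE_UNIV_domain by (intro exI[of _ f]) blast
qed

lemma abs_coord_le:
  assumes "in_dim n x" "inner x x \<le> r\<^sup>2" "0 \<le> r"
  shows "\<bar>coord x i\<bar> \<le> r"
proof (cases "i < n")
  case True
  have "(coord x i)\<^sup>2 \<le> (\<Sum>j<n. (coord x j)\<^sup>2)" using True by (intro member_le_sum) auto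
  also have "\<dots> = inner x x" by (simp add: inner_in_dim[OF assms(1)] power2_eq_square)
  finally have "(coord x i)\<^sup>2 \<le> r\<^sup>2" using assms by simp
  then show ?thesis using assms by (metis abs_le_square_iff abs_of_nonneg)
qed (use assms in \<open>auto simp: in_dim_def\<close>)

text \<open>The minimizer is taken over the box around the ball and may lie outside the ball; it
  only has to compete with the feasible points of the ball.\<close>

lemma fvec_attains_min:
  assumes F: "continuous_on UNIV (\<lambda>f. F (vecn n f))" and G: "continuous_on UNIV (\<lambda>f. G (vecn n f))"
    and x0: "in_dim n x0" "inner x0 x0 \<le> r\<^sup>2" "G x0 \<le> (0::real)" and r: "0 \<le> r"
  shows "\<exists>x. in_dim n x \<and> G x \<le> 0 \<and>
    (\<forall>y. in_dim n y \<longrightarrow> inner y y \<le> r\<^sup>2 \<longrightarrow> G y \<le> 0 \<longrightarrow> F x \<le> (F y :: real))"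
proof -
  have box: "coord y i \<in> (if i < n then {-r..r} else {0})" if "in_dim n y" "inner y y \<le> r\<^sup>2" for y i
    using abs_coord_le[OF that r, of i] that by (auto simp: in_dim_def abs_le_iff)
  obtain f where f: "G (vecn n f) \<le> 0"
    "\<forall>g. (\<forall>i. g i \<in> (if i < n then {-r..r} else {0})) \<longrightarrow> G (vecn n g) \<le> 0 \<longrightarrow> F (vecn n f) \<le> F (vecn n g)"
    using box_attains_min[OF F G, of "coord x0" n r] box[OF x0(1,2)] x0 by auto
  show ?thesis
  proof (intro exI[of _ "vecn n f"] conjI allI impI)
    fix y assume y: "in_dim n y" "inner y y \<le> r\<^sup>2" "G y \<le> 0"
    then show "F (vecn n f) \<le> F y" using f(2)[rule_format, of "coord y"] box[OF y(1,2)] by simp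
  qed (use f in auto)
qed

lemma continuous_inner_vecn [continuous_intros]:
  "continuous_on UNIV (\<lambda>f. inner b (vecn n f))"
proof -
  have "inner b (vecn n f) = (\<Sum>i<n. f i * coord b i)" for f
    by (subst inner_commute, subst inner_in_dim[of n]) auto
  then show ?thesis by (auto intro!: continuous_intros)
qed

lemma continuous_form_vecn [continuous_intros]:
  assumes "M \<in> carrier_mat n n"
  shows "continuous_on UNIV (\<lambda>f. inner (vecn n f) (mat_op M (vecn n f)))"
proof -
  have "inner (vecn n f) (mat_op M (vecn n f)) = (\<Sum>i<n. f i * (\<Sum>j<n. M $$ (i, j) * f j))" for f
    using assms by (subst inner_in_dim[of n]) (auto simp: mat_op_def)
  then show ?thesis by (auto intro!: continuous_intros)
qed

lemma continuous_sq_vecn [continuous_intros]: "continuous_on UNIV (\<lambda>f. inner (vecn n f) (vecn n f))"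
proof -
  have "inner (vecn n f) (vecn n f) = (\<Sum>i<n. f i * f i)" for f
    by (subst inner_in_dim[of n]) auto
  then show ?thesis by (auto intro!: continuous_intros)
qed

text \<open>A minimizer u of the form on the unit sphere is an eigenvector: with the residual w = A
  u - l u, the minimality along u - s w reads 0 \<le> b s^2 - 2 s a for all s, where a = |w|^2, and
  this forces a = 0.\<close>

lemma min_eigenvector:
  assumes M: "M \<in> carrier_mat n n" "sym_mat M" and n: "0 < n"
  shows "\<exists>u l. in_dim n u \<and> inner u u = 1 \<and> mat_op M u = l *\<^sub>R u \<and>
    (\<forall>h. in_dim n h \<longrightarrow> l * inner h h \<le> inner h (mat_op M h))"
proof -
  note A = selfadjoint_mat_op[OF M]
  let ?A = "mat_op M"
  let ?e = "vecn n (\<lambda>i. if i = 0 then 1 else 0)"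
  have e: "inner ?e ?e = 1"
  proof -
    have "inner ?e ?e = (\<Sum>i<n. coord ?e i * coord ?e i)" by (rule inner_in_dim) simp
    also have "\<dots> = (\<Sum>i<n. if i = 0 then 1 else 0)" by (intro sum.cong) auto
    also have "\<dots> = 1" using n by (subst sum.delta) auto
    finally show ?thesis .
  qed
  have c1: "continuous_on UNIV (\<lambda>f. inner (vecn n f) (?A (vecn n f)))" by (rule continuous_form_vecn[OF M(1)])
  \<comment> \<open>The unit sphere is written as one inequality to fit the constraint G \<le>
    0.\<close>
  have c2: "continuous_on UNIV (\<lambda>f. \<bar>inner (vecn n f) (vecn n f) - 1\<bar>)" by (intro continuous_intros)
  obtain u where u: "in_dim n u" "\<bar>inner u u - 1\<bar> \<le> 0"
    "\<forall>y. in_dim n y \<longrightarrow> inner y y \<le> 1\<^sup>2 \<longrightarrow> \<bar>inner y y - 1\<bar> \<le> 0 \<longrightarrow> inner u (?A u) \<le> inner y (?A y)"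
    using fvec_attains_min[of "\<lambda>x. inner x (?A x)" n "\<lambda>x. \<bar>inner x x - 1\<bar>" ?e 1, OF c1 c2] e
    by auto
  define l where "l = inner u (?A u)"
  have u1: "inner u u = 1" using u(2) by simp
  have ally: "l \<le> inner y (?A y)" if "in_dim n y" "inner y y = 1" for y
    using u(3)[rule_format, OF that(1)] that(2) by (simp add: l_def)
  have ray: "l * inner h h \<le> inner h (?A h)" if h: "in_dim n h" for h
  proof (cases "h = 0")
    case False
    let ?y = "(1 / norm h) *\<^sub>R h"
    have nz: "norm h \<noteq> 0" using False by simp
    have y1: "inner ?y ?y = 1" using nz by (simp add: power2_norm_eq_inner[symmetric] power2_eq_square)
    have "l \<le> inner ?y (?A ?y)" by (rule ally[OF in_dim_simps(5)[OF h] y1])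
    also have "\<dots> = inner h (?A h) / (norm h)\<^sup>2"
      by (simp add: selfadjoint_simps[OF A] power2_eq_square)
    finally show ?thesis using nz by (simp add: power2_norm_eq_inner[symmetric] field_simps)
  qed simp
  define w where "w = ?A u - l *\<^sub>R u"
  have wd: "in_dim n w" unfolding w_def using M u(1) by auto
  define a where "a = inner w w"
  define b where "b = inner w (?A w) - l * inner w w"
  have b0: "0 \<le> b" using ray[OF wd] by (simp add: b_def)
  have a0: "0 \<le> a" by (simp add: a_def)
  have exp: "0 \<le> b * (s * s) - 2 * s * a" for s
  proof -
    have Auw: "inner u (?A w) = inner w (?A u)" using selfadjoint_swap[OF A, of u w] by (simp add: inner_commute)
    have "inner w (?A u) = a + l * inner w u" by (simp add: a_def w_def inner_diff_right)
    moreover have "l * inner (u - s *\<^sub>R w) (u - s *\<^sub>R w) \<le> inner (u - s *\<^sub>R w) (?A (u - s *\<^sub>R w))"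
      by (rule ray) (use u wd in auto)
    moreover have "inner u (?A u) = l * inner u u" by (simp add: l_def u1)
    ultimately show ?thesis
      by (simp add: selfadjoint_simps[OF A] inner_diff_left inner_diff_right Auw b_def inner_commute[of u w] algebra_simps)
  qed
  have "a = 0"
  proof (rule ccontr)
    assume "a \<noteq> 0"
    then have "0 < a" using a0 by simp
    \<comment> \<open>Any t > 0 with b t < 2 a gives a contradiction; the added 1 covers b =
      0.\<close>
    define t where "t = a / (b + 1)"
    have "(b + 1) * t = a" unfolding t_def using b0 by simp
    then have t2: "b * t + t = a" by (simp only: distrib_right mult_1)
    have t: "0 < t" unfolding t_def using \<open>0 < a\<close> b0 by simp
    have "0 \<le> t * (b * t - 2 * a)" using exp[of t] by (simp add: algebra_simps)
    then have "2 * a \<le> b * t" using t by (simp add: zero_le_mult_iff)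
    with t t2 \<open>0 < a\<close> show False by linarith
  qed
  then have "?A u = l *\<^sub>R u" by (simp add: a_def w_def)
  then show ?thesis using u u1 ray by blast
qed

section \<open>Transfer between the two representations of vectors\<close>

definition to_f :: "nat \<Rightarrow> real vec \<Rightarrow> fvec" where
  "to_f n x = vecn n (\<lambda>i. x $ i)"

lemma in_dim_to_f [simp]: "in_dim n (to_f n x)" by (simp add: to_f_def)

lemma to_f_vec [simp]: "to_f n (Matrix.vec n f) = vecn n f"
  by (rule fvec_eqI) (simp add: to_f_def)

lemma dot_to_f: "x \<in> carrier_vec n \<Longrightarrow> y \<in> carrier_vec n \<Longrightarrow> x \<bullet> y = inner (to_f n x) (to_f n y)"
  by (subst inner_in_dim[of n]) (auto simp: to_f_def scalar_prod_def lessThan_atLeast0)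

lemma mat_to_f:
  "A \<in> carrier_mat n n \<Longrightarrow> x \<in> carrier_vec n \<Longrightarrow> to_f n (A *\<^sub>v x) = mat_op A (to_f n x)"
  by (rule fvec_eqI) (auto simp: to_f_def mat_op_def scalar_prod_def lessThan_atLeast0 intro!: sum.cong)

lemma form_to_f:
  assumes "A \<in> carrier_mat n n" "x \<in> carrier_vec n"
  shows "x \<bullet> (A *\<^sub>v x) = inner (to_f n x) (mat_op A (to_f n x))"
  unfolding mat_to_f[OF assms, symmetric] by (rule dot_to_f) (use assms in auto)

lemma quad_to_f:
  assumes "A \<in> carrier_mat n n" "b \<in> carrier_vec n" "x \<in> carrier_vec n"
  shows "quad A b c x = inner (to_f n x) (mat_op A (to_f n x)) + 2 * inner (to_f n b) (to_f n x) + c"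
  unfolding quad_def form_to_f[OF assms(1,3)] dot_to_f[OF assms(2,3)] ..

lemma mat_op_pencil:
  "A \<in> carrier_mat n n \<Longrightarrow> B \<in> carrier_mat n n \<Longrightarrow>
    mat_op (pencil A B \<gamma>) x = mat_op A x + \<gamma> *\<^sub>R mat_op B x"
  by (rule fvec_eqI)
    (auto simp: pencil_def mat_op_def sum.distrib sum_distrib_left algebra_simps)

lemma euclid_norm_to_f: "x \<in> carrier_vec n \<Longrightarrow> euclid_norm x = norm (to_f n x)"
  unfolding euclid_norm_def norm_eq_sqrt_inner by (subst dot_to_f[of x n x]) auto

lemma to_f_of_f: "in_dim n x \<Longrightarrow> \<exists>y\<in>carrier_vec n. to_f n y = x"
  by (rule bexI[of _ "Matrix.vec n (coord x)"]) auto

lemma norm_le_sum_abs: "in_dim n x \<Longrightarrow> norm x \<le> (\<Sum>i<n. \<bar>coord x i\<bar>)"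
  using L2_set_le_sum_abs[of "coord x" "{..<n}"]
  unfolding norm_eq_sqrt_inner L2_set_def power2_eq_square by (subst inner_in_dim[of n]) auto

lemma spectral_norm_bound:
  assumes A: "A \<in> carrier_mat n n" and s: "spectral_norm A \<le> 1" and sym: "sym_mat A"
  shows "\<bar>inner x (mat_op A x)\<bar> \<le> inner x x"
proof -
  note sa = selfadjoint_mat_op[OF A sym]
  \<comment> \<open>A supremum of reals bounds its members only if the set is bounded; the sum of
    all absolute entries is a crude bound.\<close>
  have bdd: "bdd_above ((\<lambda>x. euclid_norm (A *\<^sub>v x)) ` {x \<in> carrier_vec n. euclid_norm x \<le> 1})"
  proof (rule bdd_aboveI2)
    fix x assume "x \<in> {x \<in> carrier_vec n. euclid_norm x \<le> 1}"
    then have x: "x \<in> carrier_vec n" "norm (to_f n x) \<le> 1" by (auto simp: euclid_norm_to_f[of _ n])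
    have "inner (to_f n x) (to_f n x) \<le> 1\<^sup>2" using x(2) by (simp add: power2_norm_eq_inner[symmetric] power_le_one)
    then have c: "\<bar>coord (to_f n x) j\<bar> \<le> 1" for j by (intro abs_coord_le[of n]) auto
    have "euclid_norm (A *\<^sub>v x) = norm (mat_op A (to_f n x))"
      using A x by (simp add: euclid_norm_to_f[of _ n] mat_to_f)
    also have "\<dots> \<le> (\<Sum>i<n. \<bar>coord (mat_op A (to_f n x)) i\<bar>)" using A by (intro norm_le_sum_abs) auto
    also have "\<dots> \<le> (\<Sum>i<n. \<Sum>j<n. \<bar>A $$ (i, j)\<bar>)"
    proof (rule sum_mono)
      fix i assume "i \<in> {..<n}"
      then have "\<bar>coord (mat_op A (to_f n x)) i\<bar> = \<bar>\<Sum>j<n. A $$ (i, j) * coord (to_f n x) j\<bar>"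
        using A by (simp add: mat_op_def)
      also have "\<dots> \<le> (\<Sum>j<n. \<bar>A $$ (i, j) * coord (to_f n x) j\<bar>)" by (rule sum_abs)
      also have "\<dots> \<le> (\<Sum>j<n. \<bar>A $$ (i, j)\<bar>)"
      proof (rule sum_mono)
        fix j show "\<bar>A $$ (i, j) * coord (to_f n x) j\<bar> \<le> \<bar>A $$ (i, j)\<bar>"
          unfolding abs_mult by (rule mult_left_le[OF c]) simp
      qed
      finally show "\<bar>coord (mat_op A (to_f n x)) i\<bar> \<le> (\<Sum>j<n. \<bar>A $$ (i, j)\<bar>)" .
    qed
    finally show "euclid_norm (A *\<^sub>v x) \<le> (\<Sum>i<n. \<Sum>j<n. \<bar>A $$ (i, j)\<bar>)" .
  qed
  have one: "norm (mat_op A x) \<le> 1" if x: "in_dim n x" "norm x \<le> 1" for x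
  proof -
    obtain y where y: "y \<in> carrier_vec n" "to_f n y = x" using to_f_of_f[OF x(1)] by blast
    have "euclid_norm (A *\<^sub>v y) \<le> spectral_norm A" unfolding spectral_norm_def
      using A x y bdd by (intro cSUP_upper) (auto simp: euclid_norm_to_f[of _ n])
    then show ?thesis using s A y by (simp add: euclid_norm_to_f[of _ n] mat_to_f)
  qed
  \<comment> \<open>For a vector outside R^n only its truncation enters the form, and truncation
    does not increase the norm.\<close>
  let ?t = "vecn n (coord x)"
  have t1: "mat_op A ?t = mat_op A x" using A by (intro fvec_eqI) (auto simp: mat_op_def)
  have tt: "inner ?t ?t = inner ?t x" by (subst (1 2) inner_in_dim[of n]) auto
  have "0 \<le> inner (x - ?t) (x - ?t)" by simp
  then have t2: "inner ?t ?t \<le> inner x x" using tt by (simp add: inner_diff_left inner_diff_right inner_commute)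
  have t3: "inner x (mat_op A x) = inner ?t (mat_op A ?t)"
    unfolding t1 inner_commute[of x] inner_commute[of ?t]
    using A by (subst (1 2) inner_in_dim[of n]) auto
  have "\<bar>inner ?t (mat_op A ?t)\<bar> \<le> inner ?t ?t"
  proof (cases "?t = 0")
    case False
    then have nz: "0 < norm ?t" by simp
    have "norm (mat_op A ((1 / norm ?t) *\<^sub>R ?t)) \<le> 1" using nz by (intro one) auto
    then have "norm (mat_op A ?t) \<le> norm ?t"
      using nz by (simp add: selfadjoint_simps[OF sa] field_simps)
    then have "norm ?t * norm (mat_op A ?t) \<le> norm ?t * norm ?t" by (intro mult_left_mono) auto
    then show ?thesis using Cauchy_Schwarz_ineq2[of ?t "mat_op A ?t"]
      by (simp add: power2_norm_eq_inner[symmetric] power2_eq_square)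
  qed (simp add: selfadjoint_simps[OF sa])
  then show ?thesis using t2 t3 by simp
qed

text \<open>\<open>lambda_min\<close> is a \<open>Min\<close>, which is a lower bound only for a
  finite set. Eigenvalues are roots of the monic characteristic polynomial.\<close>

lemma finite_eigenvalues:
  assumes "(A :: real mat) \<in> carrier_mat n n"
  shows "finite {k. eigenvalue A k}"
proof -
  have "{k. eigenvalue A k} = {k. poly (char_poly A) k = 0}" by (simp add: eigenvalue_root_char_poly[OF assms])
  moreover have "char_poly A \<noteq> 0" using degree_monic_char_poly[OF assms] by (metis leading_coeff_0_iff zero_neq_one)
  ultimately show ?thesis by (simp add: poly_roots_finite)
qed

text \<open>The minimum l of the Rayleigh quotient is itself an eigenvalue, hence
  \<open>lambda_min\<close> is at most l.\<close>

lemma lambda_min_le_form: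
  assumes A: "A \<in> carrier_mat n n" "sym_mat A" and n: "0 < n" and l: "\<xi> \<le> lambda_min A" and x: "in_dim n x"
  shows "\<xi> * inner x x \<le> inner x (mat_op A x)"
proof -
  obtain u l where u: "in_dim n u" "inner u u = 1" "mat_op A u = l *\<^sub>R u"
    "\<forall>h. in_dim n h \<longrightarrow> l * inner h h \<le> inner h (mat_op A h)" using min_eigenvector[OF A n] by blast
  let ?y = "Matrix.vec n (coord u)"
  have f: "to_f n ?y = u" using u(1) by simp
  have "A *\<^sub>v ?y = l \<cdot>\<^sub>v ?y"
  proof (rule eq_vecI)
    fix i assume "i < dim_vec (l \<cdot>\<^sub>v ?y)"
    then have i: "i < n" by simp
    have "(A *\<^sub>v ?y) $ i = coord (to_f n (A *\<^sub>v ?y)) i" using i by (simp add: to_f_def)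
    also have "to_f n (A *\<^sub>v ?y) = l *\<^sub>R u" using mat_to_f[OF A(1) vec_carrier, of "coord u"] f u(3) by (simp only:)
    also have "coord (l *\<^sub>R u) i = l * coord u i" by simp
    finally show "(A *\<^sub>v ?y) $ i = (l \<cdot>\<^sub>v ?y) $ i" using i by simp
  qed (use A in auto)
  moreover have "?y \<noteq> 0\<^sub>v n"
  proof
    assume "?y = 0\<^sub>v n"
    then have "u = to_f n (0\<^sub>v n)" using f by (simp only:)
    also have "\<dots> = 0" by (rule fvec_eqI) (simp add: to_f_def)
    finally have "u = 0" .
    then show False using u(2) by simp
  qed
  ultimately have "eigenvalue A l" unfolding eigenvalue_def eigenvector_def
    using A by (intro exI[of _ ?y]) auto
  then have "lambda_min A \<le> l" unfolding lambda_min_def using finite_eigenvalues[OF A(1)] by (intro Min_le) auto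
  then have "\<xi> * inner x x \<le> l * inner x x" using l by (intro mult_right_mono) auto
  then show ?thesis using u(4) x by force
qed

lemma eigenvalue_form:
  assumes A: "A \<in> carrier_mat n n" and k: "eigenvalue A k"
  shows "\<exists>d. in_dim n d \<and> inner d d = 1 \<and> inner d (mat_op A d) = k"
proof -
  obtain v where v: "v \<in> carrier_vec n" "v \<noteq> 0\<^sub>v n" "A *\<^sub>v v = k \<cdot>\<^sub>v v"
    using k A unfolding eigenvalue_def eigenvector_def by auto
  let ?v = "to_f n v"
  have nz: "?v \<noteq> 0"
  proof
    assume "?v = 0"
    then have "v $ i = 0" if "i < n" for i using that by (metis coord_simps(1) coord_vecn to_f_def)
    then show False using v(1,2) by (auto simp: vec_eq_iff)
  qed
  have m: "mat_op A ?v = k *\<^sub>R ?v"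
  proof -
    have "mat_op A ?v = to_f n (k \<cdot>\<^sub>v v)" using mat_to_f[OF A v(1)] v(3) by (simp only:)
    also have "\<dots> = k *\<^sub>R ?v" by (rule fvec_eqI) (use v(1) in \<open>simp add: to_f_def\<close>)
    finally show ?thesis .
  qed
  have sm: "mat_op A (r *\<^sub>R ?v) = r *\<^sub>R mat_op A ?v" for r
    by (rule fvec_eqI) (simp add: mat_op_def sum_distrib_left mult_ac)
  let ?d = "(1 / norm ?v) *\<^sub>R ?v"
  have 1: "inner ?d ?d = 1" using nz by (simp add: power2_norm_eq_inner[symmetric] power2_eq_square)
  have "inner ?d (mat_op A ?d) = k * inner ?d ?d" by (simp add: sm m)
  with 1 show ?thesis by (intro exI[of _ ?d]) auto
qed

section \<open>The problem instance\<close>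

lemma nnz_eq_length: "nnz A = length (nz_entries A)"
proof -
  have d: "distinct (nz_entries A)" unfolding nz_entries_def by (simp add: distinct_product)
  have "set (nz_entries A) = {(i, j). i < dim_row A \<and> j < dim_col A \<and> A $$ (i, j) \<noteq> 0}"
    by (auto simp: nz_entries_def)
  then show ?thesis using distinct_card[OF d] by (simp add: nnz_def)
qed

locale gtrs =
  fixes n :: nat and A0 A1 :: "real mat" and b0 b1 :: "real vec" and c0 c1 \<xi> \<zeta> \<gamma>h \<epsilon> p :: real
  assumes asm_A: "assumption_A n A0 A1 b0 b1 c1" and reg: "regular A0 A1 \<xi> \<zeta>"
    and gh0: "0 \<le> \<gamma>h" and ghx: "\<xi> \<le> lambda_min (pencil A0 A1 \<gamma>h)"
    and eps0: "0 < \<epsilon>" and eps1: "\<epsilon> \<le> (\<zeta> / \<xi>) ^ 3 * \<xi>" and p0: "0 < p"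
begin

abbreviation "B0 \<equiv> mat_op A0"
abbreviation "B1 \<equiv> mat_op A1"
definition "\<beta>0 = to_f n b0"
definition "\<beta>1 = to_f n b1"
definition "\<kappa> = \<zeta> / \<xi>"
definition "q0 x = inner x (B0 x) + 2 * inner \<beta>0 x + c0"
definition "q1 x = inner x (B1 x) + 2 * inner \<beta>1 x + c1"
definition "form \<gamma> h = inner h (B0 h) + \<gamma> * inner h (B1 h)"

lemma carriers: "A0 \<in> carrier_mat n n" "A1 \<in> carrier_mat n n" "sym_mat A0" "sym_mat A1"
  "b0 \<in> carrier_vec n" "b1 \<in> carrier_vec n"
  using asm_A by (auto simp: assumption_A_def)

lemma sa0: "selfadjoint B0" and sa1: "selfadjoint B1"
  using selfadjoint_mat_op carriers by blast+

lemma n_pos: "0 < n"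
proof (rule ccontr)
  assume "\<not> 0 < n"
  obtain k where "eigenvalue A0 k" using asm_A by (auto simp: assumption_A_def)
  then obtain d where "in_dim n d" "inner d d = 1" using eigenvalue_form[OF carriers(1)] by blast
  then show False using \<open>\<not> 0 < n\<close> by (simp add: inner_in_dim[of n])
qed

lemma B_bound: "\<bar>inner x (B0 x)\<bar> \<le> inner x x" "\<bar>inner x (B1 x)\<bar> \<le> inner x x"
  using spectral_norm_bound carriers asm_A by (auto simp: assumption_A_def)

lemma beta_bound: "norm \<beta>0 \<le> 1" "norm \<beta>1 \<le> 1" "\<bar>c1\<bar> \<le> 1"
  using asm_A carriers by (auto simp: assumption_A_def \<beta>0_def \<beta>1_def euclid_norm_to_f[of _ n])

lemma in_dim_beta [simp]: "in_dim n \<beta>0" "in_dim n \<beta>1" by (simp_all add: \<beta>0_def \<beta>1_def)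

lemma in_dim_B [simp]: "in_dim n (B0 x)" "in_dim n (B1 x)" using carriers by auto

lemma pencil_carrier: "pencil A0 A1 \<gamma> \<in> carrier_mat n n" "sym_mat (pencil A0 A1 \<gamma>)"
proof -
  show c: "pencil A0 A1 \<gamma> \<in> carrier_mat n n" using carriers by (simp add: pencil_def)
  have s: "A0 $$ (i, j) = A0 $$ (j, i)" "A1 $$ (i, j) = A1 $$ (j, i)" if "i < n" "j < n" for i j
    using carriers that unfolding sym_mat_def by (metis carrier_matD index_transpose_mat(1))+
  show "sym_mat (pencil A0 A1 \<gamma>)" unfolding sym_mat_def
    by (rule eq_matI) (use carriers s in \<open>auto simp: pencil_def\<close>)
qed

lemma pencil_form: "inner h (mat_op (pencil A0 A1 \<gamma>) h) = form \<gamma> h"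
  by (simp add: mat_op_pencil[OF carriers(1,2)] form_def inner_add_right)

lemma form_scale: "form \<gamma> (r *\<^sub>R h) = r\<^sup>2 * form \<gamma> h"
  by (simp add: form_def selfadjoint_simps[OF sa0] selfadjoint_simps[OF sa1] power2_eq_square algebra_simps)

section \<open>Strong convexity at the given multiplier and the semidefinite interval\<close>

lemma form_hat: "in_dim n x \<Longrightarrow> \<xi> * inner x x \<le> form \<gamma>h x"
  using lambda_min_le_form[OF pencil_carrier n_pos ghx] by (simp add: pencil_form)

lemma pos_semidef_iff: "pos_semidef (pencil A0 A1 \<gamma>) \<longleftrightarrow> (\<forall>x. in_dim n x \<longrightarrow> 0 \<le> form \<gamma> x)"
proof -
  have d: "dim_row (pencil A0 A1 \<gamma>) = n" using pencil_carrier(1) by blast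
  have "x \<bullet> (pencil A0 A1 \<gamma> *\<^sub>v x) = form \<gamma> (to_f n x)" if "x \<in> carrier_vec n" for x
    using form_to_f[OF pencil_carrier(1) that] by (simp add: pencil_form)
  then show ?thesis unfolding pos_semidef_def d by (metis in_dim_to_f to_f_of_f)
qed

lemma xi_pos: "0 < \<xi>" and xi_le: "\<xi> \<le> 1"
  using reg by (auto simp: regular_def xi_star_def)

text \<open>\<open>gamma_plus\<close> is a \<open>GREATEST\<close>, so its value is known only once
  a maximum exists. A direction of negative curvature of A1 bounds the set, and the supremum belongs
  to it because the form at a fixed x is affine in the multiplier.\<close>

lemma gamma_max: "\<exists>s. s \<in> Gamma A0 A1 \<and> (\<forall>y\<in>Gamma A0 A1. y \<le> s)"
proof -
  let ?G = "Gamma A0 A1"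
  have G: "\<gamma> \<in> ?G \<longleftrightarrow> 0 \<le> \<gamma> \<and> (\<forall>x. in_dim n x \<longrightarrow> 0 \<le> form \<gamma> x)" for \<gamma>
    by (simp add: Gamma_def pos_semidef_iff)
  have "0 \<le> form \<gamma>h x" if "in_dim n x" for x
    using form_hat[OF that] xi_pos by (meson inner_ge_zero less_imp_le mult_nonneg_nonneg order_trans)
  then have ne: "\<gamma>h \<in> ?G" using gh0 by (simp add: G)
  obtain k where "k < 0" "eigenvalue A1 k" using asm_A by (auto simp: assumption_A_def)
  then obtain d where d: "in_dim n d" "inner d (B1 d) < 0" using eigenvalue_form[OF carriers(2)] by blast
  have bd: "y \<le> inner d (B0 d) / - inner d (B1 d)" if "y \<in> ?G" for y
  proof -
    have "0 \<le> inner d (B0 d) + y * inner d (B1 d)" using that d by (simp add: G form_def)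
    then show ?thesis using d(2) by (subst pos_le_divide_eq) auto
  qed
  then have bdd: "bdd_above ?G" by (intro bdd_aboveI)
  let ?s = "Sup ?G"
  have up: "\<forall>y\<in>?G. y \<le> ?s" using bdd by (simp add: cSup_upper)
  have "?s \<in> ?G" unfolding G
  proof (intro conjI allI impI)
    show "0 \<le> ?s" using up ne gh0 by force
    fix x assume x: "in_dim n x"
    show "0 \<le> form ?s x"
    proof (rule ccontr)
      assume neg: "\<not> 0 \<le> form ?s x"
      let ?b = "inner x (B1 x)" and ?a = "inner x (B0 x)"
      have h0: "0 \<le> form \<gamma>h x" using ne x by (simp add: G)
      have "\<not> 0 \<le> ?b"
      proof
        assume "0 \<le> ?b"
        then have "\<gamma>h * ?b \<le> ?s * ?b" using up ne by (intro mult_right_mono) auto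
        then show False using neg h0 by (simp add: form_def)
      qed
      then have b: "?b < 0" by simp
      then have "?a / - ?b < ?s" using neg by (subst pos_divide_less_eq) (auto simp: form_def not_le)
      then obtain y where "y \<in> ?G" "?a / - ?b < y" using less_cSup_iff[of ?G "?a / - ?b"] ne bdd by auto
      then have "?a < y * - ?b" "0 \<le> form y x" using b x by (subst (asm) pos_divide_less_eq, auto simp: G)
      then show False by (simp add: form_def)
    qed
  qed
  with up show ?thesis by blast
qed

lemma zeta_ge1: "1 \<le> \<zeta>" and gamma_le_zeta: "\<gamma> \<in> Gamma A0 A1 \<Longrightarrow> \<gamma> \<le> \<zeta>"
proof -
  obtain s where s: "s \<in> Gamma A0 A1" "\<forall>y\<in>Gamma A0 A1. y \<le> s" using gamma_max by blast
  have "gamma_plus A0 A1 = s" unfolding gamma_plus_def by (rule Greatest_equality) (use s in auto)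
  then have "max 1 s \<le> \<zeta>" using reg by (simp add: regular_def zeta_star_def)
  then show "1 \<le> \<zeta>" "\<gamma> \<in> Gamma A0 A1 \<Longrightarrow> \<gamma> \<le> \<zeta>" using s by auto
qed

lemma gh_le: "\<gamma>h \<le> \<zeta>"
proof (rule gamma_le_zeta)
  have "0 \<le> form \<gamma>h x" if "in_dim n x" for x
    using form_hat[OF that] xi_pos by (meson inner_ge_zero less_imp_le mult_nonneg_nonneg order_trans)
  then show "\<gamma>h \<in> Gamma A0 A1" using gh0 by (simp add: Gamma_def pos_semidef_iff)
qed

lemma kappa_ge1: "1 \<le> \<kappa>" and kappa_xi: "\<kappa> * \<xi> = \<zeta>" and zeta_le_kappa: "\<zeta> \<le> \<kappa>"
proof -
  show "\<kappa> * \<xi> = \<zeta>" using xi_pos by (simp add: \<kappa>_def)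
  show "\<zeta> \<le> \<kappa>" unfolding \<kappa>_def using xi_pos xi_le zeta_ge1 by (simp add: pos_le_divide_eq mult_left_le)
  then show "1 \<le> \<kappa>" using zeta_ge1 by simp
qed

text \<open>Some direction is negative at 3/2 \<zeta>, beyond the semidefinite interval, while at
  \<gamma>h the form is at least \<xi>. So it falls with slope at least 2 \<xi> / (3 \<zeta>), and
  the remaining distance \<zeta> / 2 lowers it by \<xi> / 3.\<close>

lemma right_end_negative: "\<exists>v. in_dim n v \<and> inner v v = 1 \<and> form (2 * \<zeta>) v \<le> - \<xi> / 3"
proof -
  have "3 / 2 * \<zeta> \<notin> Gamma A0 A1" using gamma_le_zeta[of "3 / 2 * \<zeta>"] zeta_ge1 by auto
  then obtain x where x: "in_dim n x" "form (3 / 2 * \<zeta>) x < 0"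
    using zeta_ge1 by (auto simp: Gamma_def pos_semidef_iff not_le)
  have "x \<noteq> 0" using x(2) by (auto simp: form_def selfadjoint_simps[OF sa0] selfadjoint_simps[OF sa1])
  let ?v = "(1 / norm x) *\<^sub>R x"
  have v1: "inner ?v ?v = 1" using \<open>x \<noteq> 0\<close> by (simp add: power2_norm_eq_inner[symmetric] power2_eq_square)
  have vd: "in_dim n ?v" using x by simp
  have neg: "form (3 / 2 * \<zeta>) ?v < 0" unfolding form_scale using x \<open>x \<noteq> 0\<close> by (simp add: mult_less_0_iff)
  have hat: "\<xi> \<le> form \<gamma>h ?v" using form_hat[OF vd] v1 by simp
  define a where "a = inner ?v (B0 ?v)"
  define b where "b = inner ?v (B1 ?v)"
  have 1: "a + 3 / 2 * \<zeta> * b < 0" "\<xi> \<le> a + \<gamma>h * b" using neg hat by (auto simp: form_def a_def b_def)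
  have b: "b < 0"
  proof (rule ccontr)
    assume "\<not> b < 0"
    then have "\<gamma>h * b \<le> 3 / 2 * \<zeta> * b" using gh_le zeta_ge1 by (intro mult_right_mono) auto
    then show False using 1 xi_pos by linarith
  qed
  have "\<xi> \<le> (3 / 2 * \<zeta> - \<gamma>h) * - b" using 1 by (simp add: algebra_simps)
  also have "\<dots> \<le> (3 / 2 * \<zeta>) * - b" using b gh0 by (intro mult_right_mono) auto
  finally have "a + 2 * \<zeta> * b \<le> - \<xi> / 3" using 1(1) by (simp add: algebra_simps)
  then have "form (2 * \<zeta>) ?v \<le> - \<xi> / 3" by (simp add: form_def a_def b_def)
  with v1 vd show ?thesis by blast
qed

text \<open>In a direction with k < 0 at \<gamma> = 0 the bound \<xi> at \<gamma>h forces a slope b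
  > 0 with \<gamma>h b \<ge> \<xi> - k. Going at least as far to the left of 0 gives a value below -
  \<xi>.\<close>

lemma left_end_negative: "\<exists>v. in_dim n v \<and> inner v v = 1 \<and> form (- \<zeta>) v \<le> - \<xi> / 3"
proof -
  obtain k where k: "k < 0" "eigenvalue A0 k" using asm_A by (auto simp: assumption_A_def)
  then obtain d where d: "in_dim n d" "inner d d = 1" "inner d (B0 d) = k"
    using eigenvalue_form[OF carriers(1)] by blast
  define b where "b = inner d (B1 d)"
  have h: "\<xi> \<le> k + \<gamma>h * b" using form_hat[OF d(1)] d by (simp add: form_def b_def)
  then have "0 < \<gamma>h * b" using k xi_pos by linarith
  then have b: "0 < b" using gh0 by (simp add: zero_less_mult_iff)
  then have "\<gamma>h * b \<le> \<zeta> * b" using gh_le by (intro mult_right_mono) auto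
  then have "form (- \<zeta>) d \<le> - \<xi> / 3" using h k xi_pos d by (simp add: form_def b_def[symmetric])
  with d show ?thesis by blast
qed

lemma norm_bound:
  assumes x: "in_dim n x" and q1: "q1 x \<le> 0" and q0: "q0 x \<le> c0 + 2 * \<zeta> + 2 * sqrt (2 * \<kappa>)"
  shows "inner x x \<le> (6 * \<kappa>)\<^sup>2"
proof -
  define r where "r = norm x"
  have r0: "0 \<le> r" by (simp add: r_def)
  have rr: "inner x x = r * r" by (simp add: r_def power2_norm_eq_inner[symmetric] power2_eq_square)
  have cs: "\<bar>inner \<beta>0 x\<bar> \<le> r" "\<bar>inner \<beta>1 x\<bar> \<le> r"
    using Cauchy_Schwarz_ineq2[of \<beta>0 x] Cauchy_Schwarz_ineq2[of \<beta>1 x] beta_bound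
      mult_right_mono[of "norm \<beta>0" 1 "norm x"] mult_right_mono[of "norm \<beta>1" 1 "norm x"]
    by (auto simp: r_def)
  have f: "\<xi> * (r * r) \<le> form \<gamma>h x" using form_hat[OF x] by (simp add: rr)
  have "q0 x + \<gamma>h * q1 x \<le> q0 x" using q1 gh0 by (simp add: mult_nonneg_nonpos)
  then have "form \<gamma>h x + 2 * inner \<beta>0 x + c0 + \<gamma>h * (2 * inner \<beta>1 x + c1) \<le> c0 + 2 * \<zeta> + 2 * sqrt (2 * \<kappa>)"
    using q0 by (simp add: q0_def q1_def form_def algebra_simps)
  moreover have "- (\<zeta> * (2 * r + 1)) \<le> \<gamma>h * (2 * inner \<beta>1 x + c1)"
  proof -
    have "\<bar>\<gamma>h * (2 * inner \<beta>1 x + c1)\<bar> \<le> \<zeta> * (2 * r + 1)"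
      unfolding abs_mult using cs beta_bound gh0 gh_le r0 by (intro mult_mono) auto
    then show ?thesis by linarith
  qed
  ultimately have "\<xi> * (r * r) \<le> 2 * r + 2 * (\<zeta> * r) + 3 * \<zeta> + 2 * sqrt (2 * \<kappa>)"
    using f cs by (simp add: algebra_simps)
  moreover have "r \<le> \<zeta> * r" using zeta_ge1 r0 by (simp add: mult_le_cancel_right1)
  ultimately have 1: "\<xi> * (r * r) \<le> 4 * (\<zeta> * r) + 3 * \<zeta> + 2 * sqrt (2 * \<kappa>)" by linarith
  have sq: "sqrt (2 * \<kappa>) \<le> 3 / 2 * \<kappa>"
  proof (rule real_le_lsqrt)
    have "\<kappa> * 1 \<le> \<kappa> * \<kappa>" using kappa_ge1 by (intro mult_left_mono) auto
    then show "2 * \<kappa> \<le> (3 / 2 * \<kappa>)\<^sup>2" using kappa_ge1 by (simp add: power2_eq_square)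
  qed (use kappa_ge1 in auto)
  have xk: "1 \<le> \<kappa> * \<xi>" using kappa_xi zeta_ge1 by simp
  have "\<xi> * (r * r) \<le> \<xi> * (4 * \<kappa> * r + 6 * \<kappa> * \<kappa>)"
  proof -
    have "\<kappa> * 1 \<le> \<kappa> * (\<kappa> * \<xi>)" using xk kappa_ge1 by (intro mult_left_mono) auto
    then have "\<kappa> \<le> \<zeta> * \<kappa>" unfolding kappa_xi by (simp add: mult.commute)
    moreover have "\<zeta> * 1 \<le> \<zeta> * \<kappa>" using kappa_ge1 zeta_ge1 by (intro mult_left_mono) auto
    moreover have "\<xi> * (4 * \<kappa> * r + 6 * \<kappa> * \<kappa>) = 4 * (\<zeta> * r) + 6 * (\<zeta> * \<kappa>)"
    proof -
      have "\<xi> * (4 * \<kappa> * r + 6 * \<kappa> * \<kappa>) = 4 * (\<kappa> * \<xi> * r) + 6 * (\<kappa> * \<xi> * \<kappa>)" by (simp add: algebra_simps)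
      then show ?thesis unfolding kappa_xi .
    qed
    ultimately show ?thesis using 1 sq by linarith
  qed
  then have 2: "r * r \<le> 4 * \<kappa> * r + 6 * \<kappa> * \<kappa>" using xi_pos by simp
  have "r \<le> 6 * \<kappa>"
  proof (rule ccontr)
    assume "\<not> r \<le> 6 * \<kappa>"
    then have "6 * \<kappa> < r" by simp
    then have "6 * \<kappa> * r \<le> r * r" "\<kappa> * (6 * \<kappa>) < \<kappa> * r" using r0 kappa_ge1 by (auto intro!: mult_right_mono)
    moreover have "0 < \<kappa> * \<kappa>" using kappa_ge1 by simp
    ultimately show False using 2 by (simp add: algebra_simps)
  qed
  then show ?thesis unfolding rr power2_eq_square using r0 by (intro mult_mono) auto
qed

text \<open>If the origin is infeasible, the direction from \<open>right_end_negative\<close> has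
  A1-curvature at most - 1 / (2 \<kappa>). A step of length sqrt (c1 / b) \<le> sqrt (2 \<kappa>)
  cancels c1, and its sign is chosen to make the linear term of q1 nonpositive.\<close>

lemma feasible_point: "\<exists>y. in_dim n y \<and> q1 y \<le> 0 \<and> q0 y \<le> c0 + 2 * \<zeta> + 2 * sqrt (2 * \<kappa>)"
proof (cases "c1 \<le> 0")
  case True
  have "0 \<le> sqrt (2 * \<kappa>)" using kappa_ge1 by simp
  then have "q1 0 \<le> 0" "q0 0 \<le> c0 + 2 * \<zeta> + 2 * sqrt (2 * \<kappa>)"
    using True zeta_ge1 by (auto simp: q0_def q1_def selfadjoint_simps[OF sa0] selfadjoint_simps[OF sa1])
  then show ?thesis by (intro exI[of _ 0]) auto
next
  case False
  then have c1: "0 < c1" "c1 \<le> 1" using beta_bound by auto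
  obtain v where v: "in_dim n v" "inner v v = 1" "form (2 * \<zeta>) v \<le> - \<xi> / 3" using right_end_negative by blast
  define a where "a = inner v (B0 v)"
  define b where "b = - inner v (B1 v)"
  have 1: "a \<le> 2 * \<zeta> * b" "\<xi> \<le> a - \<gamma>h * b" using v form_hat[OF v(1)] xi_pos by (auto simp: form_def a_def b_def)
  have b: "0 < b"
  proof (rule ccontr)
    assume "\<not> 0 < b"
    then have "2 * \<zeta> * b \<le> \<gamma>h * b" using gh_le zeta_ge1 by (intro mult_right_mono_neg) auto
    then show False using 1 xi_pos by linarith
  qed
  have "\<xi> \<le> 2 * \<zeta> * b" using 1 b gh0 by (smt (verit) mult_nonneg_nonneg)
  then have "1 / b \<le> 2 * \<kappa>" unfolding \<kappa>_def using b xi_pos by (simp add: field_simps)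
  then have cb: "c1 / b \<le> 2 * \<kappa>" using c1 b by (smt (verit) divide_right_mono)
  define s where "s = (if inner \<beta>1 v \<le> 0 then sqrt (c1 / b) else - sqrt (c1 / b))"
  have s2: "s * s = c1 / b" using c1 b by (simp add: s_def)
  have sabs: "\<bar>s\<bar> \<le> sqrt (2 * \<kappa>)" using cb c1 b by (auto simp: s_def)
  have s1: "s * inner \<beta>1 v \<le> 0" using c1 b by (auto simp: s_def mult_nonneg_nonpos)
  let ?y = "s *\<^sub>R v"
  have "q1 ?y = (s * s) * - b + 2 * (s * inner \<beta>1 v) + c1"
    by (simp add: q1_def selfadjoint_simps[OF sa1] b_def)
  also have "(s * s) * - b = - c1" unfolding s2 using b by simp
  finally have q1: "q1 ?y \<le> 0" using s1 by simp
  have bv: "\<bar>inner \<beta>0 v\<bar> \<le> 1"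
  proof -
    have "norm v = 1" using v(2) by (simp add: norm_eq_sqrt_inner)
    then show ?thesis using Cauchy_Schwarz_ineq2[of \<beta>0 v] beta_bound(1) by simp
  qed
  have "\<bar>s * inner \<beta>0 v\<bar> \<le> sqrt (2 * \<kappa>) * 1" unfolding abs_mult using sabs bv kappa_ge1 by (intro mult_mono) auto
  moreover have "(s * s) * a \<le> (s * s) * (2 * \<zeta> * b)" using 1 by (intro mult_left_mono) auto
  moreover have "(s * s) * (2 * \<zeta> * b) = 2 * \<zeta> * c1" unfolding s2 using b by simp
  moreover have "2 * \<zeta> * c1 \<le> 2 * \<zeta>" using c1 zeta_ge1 by simp
  moreover have "q0 ?y = (s * s) * a + 2 * (s * inner \<beta>0 v) + c0"
    by (simp add: q0_def selfadjoint_simps[OF sa0] a_def)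
  ultimately have "q0 ?y \<le> c0 + 2 * \<zeta> + 2 * sqrt (2 * \<kappa>)" by linarith
  with q1 v show ?thesis by (intro exI[of _ ?y]) auto
qed

section \<open>Existence of an optimum on the boundary\<close>

lemma quad_q: 
  assumes "x \<in> carrier_vec n"
  shows "quad A0 b0 c0 x = q0 (to_f n x)" "quad A1 b1 c1 x = q1 (to_f n x)"
  using quad_to_f[OF carriers(1,5) assms, of c0] quad_to_f[OF carriers(2,6) assms, of c1]
  by (simp_all add: q0_def q1_def \<beta>0_def \<beta>1_def)

text \<open>Points worse than the feasible point can be disregarded, so the problem lives in a
  compact set; this also gives meaning to the \<open>LEAST\<close> in \<open>Opt\<close>. An
  interior minimizer is impossible because A0 has a direction of negative curvature.\<close>

lemma optimal_point:
  "\<exists>x. in_dim n x \<and> q1 x = 0 \<and> q0 x = Opt n A0 A1 b0 b1 c0 c1 \<and> inner x x \<le> (6 * \<kappa>)\<^sup>2"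
proof -
  let ?c = "c0 + 2 * \<zeta> + 2 * sqrt (2 * \<kappa>)"
  obtain y where y: "in_dim n y" "q1 y \<le> 0" "q0 y \<le> ?c" using feasible_point by blast
  have ct: "continuous_on UNIV (\<lambda>f. q0 (vecn n f))" "continuous_on UNIV (\<lambda>f. q1 (vecn n f))"
    unfolding q0_def q1_def by (intro continuous_intros carriers)+
  obtain x where x: "in_dim n x" "q1 x \<le> 0"
    "\<forall>z. in_dim n z \<longrightarrow> inner z z \<le> (6 * \<kappa>)\<^sup>2 \<longrightarrow> q1 z \<le> 0 \<longrightarrow> q0 x \<le> q0 z"
    using fvec_attains_min[OF ct y(1) norm_bound[OF y] y(2)] kappa_ge1 by auto
  have xy: "q0 x \<le> q0 y" using x(3) y norm_bound[OF y] by blast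
  have min: "q0 x \<le> q0 z" if "in_dim n z" "q1 z \<le> 0" for z
  proof (cases "q0 z \<le> ?c")
    case True
    then show ?thesis using x(3) that norm_bound[OF that True] by blast
  qed (use xy y in auto)
  have nb: "inner x x \<le> (6 * \<kappa>)\<^sup>2" using norm_bound[OF x(1,2)] xy y by simp
  have "q1 x = 0"
  proof (rule ccontr)
    assume "q1 x \<noteq> 0"
    then have neg: "q1 x < 0" using x by simp
    obtain k where k: "k < 0" "eigenvalue A0 k" using asm_A by (auto simp: assumption_A_def)
    then obtain d where d: "in_dim n d" "inner d (B0 d) = k"
      using eigenvalue_form[OF carriers(1)] by blast
    have ex0: "q0 (x + t *\<^sub>R d) = q0 x + 2 * t * (inner d (B0 x) + inner \<beta>0 d) + t * t * k" for t
      using selfadjoint_swap[OF sa0, of x d] d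
      by (simp add: q0_def selfadjoint_simps[OF sa0] inner_add_left inner_add_right inner_commute[of d] algebra_simps)
    have ex1: "q1 (x + t *\<^sub>R d) = q1 x + 2 * t * (inner d (B1 x) + inner \<beta>1 d) + t * t * inner d (B1 d)" for t
      using selfadjoint_swap[OF sa1, of x d] d
      by (simp add: q1_def selfadjoint_simps[OF sa1] inner_add_left inner_add_right inner_commute[of d "B1 x"] algebra_simps)
    define e where "e = inner d (B1 x) + inner \<beta>1 d"
    define f where "f = inner d (B1 d)"
    define g where "g = inner d (B0 x) + inner \<beta>0 d"
    \<comment> \<open>Small enough to keep q1 nonpositive; t \<le> 1 lets the quadratic term be
      estimated by a linear one.\<close>
    define t where "t = min 1 (- q1 x / (2 * \<bar>e\<bar> + \<bar>f\<bar> + 1))"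
    have t: "0 < t" "t \<le> 1" 
    proof -
      have "0 < - q1 x / (2 * \<bar>e\<bar> + \<bar>f\<bar> + 1)" using neg by (intro divide_pos_pos) auto
      then show "0 < t" "t \<le> 1" unfolding t_def by (simp_all only: min_less_iff_conj zero_less_one min.cobounded1 simp_thms)
    qed
    have tb: "t * (2 * \<bar>e\<bar> + \<bar>f\<bar> + 1) \<le> - q1 x"
    proof -
      have "t \<le> - q1 x / (2 * \<bar>e\<bar> + \<bar>f\<bar> + 1)" by (simp add: t_def)
      then show ?thesis by (subst (asm) pos_le_divide_eq) auto
    qed
    \<comment> \<open>The sign makes the linear term of q0 nonpositive, so that the negative
      curvature decides.\<close>
    define u where "u = (if g \<le> 0 then t else - t)"
    have u: "u * g \<le> 0" "u * u = t * t" "\<bar>u\<bar> = t" using t by (auto simp: u_def mult_nonneg_nonpos)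
    have "2 * u * e \<le> 2 * t * \<bar>e\<bar>"
      using u(3) by (metis abs_ge_self abs_mult mult.assoc mult_left_mono zero_le_numeral)
    moreover have "u * u * f \<le> t * \<bar>f\<bar>"
    proof -
      have "t * t * f \<le> t * 1 * \<bar>f\<bar>"
        using t by (smt (verit) mult_left_mono mult_nonneg_nonneg mult_right_mono mult_left_le abs_ge_self)
      then show ?thesis using u by simp
    qed
    ultimately have "q1 (x + u *\<^sub>R d) \<le> 0"
      unfolding ex1 e_def[symmetric] f_def[symmetric] using tb t by (simp add: algebra_simps)
    then have "q0 x \<le> q0 (x + u *\<^sub>R d)" using x d by (intro min) auto
    moreover have "q0 (x + u *\<^sub>R d) < q0 x"
    proof -
      have "u * u * k < 0" unfolding u(2) using t k by (simp add: mult_pos_neg)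
      then show ?thesis unfolding ex0 g_def[symmetric] using u(1) by (simp add: mult.assoc)
    qed
    ultimately show False by simp
  qed
  moreover have "Opt n A0 A1 b0 b1 c0 c1 = q0 x" unfolding Opt_def
  proof (rule Least_equality)
    obtain z where z: "z \<in> carrier_vec n" "to_f n z = x" using to_f_of_f[OF x(1)] by blast
    then show "\<exists>z\<in>carrier_vec n. quad A1 b1 c1 z \<le> 0 \<and> q0 x = quad A0 b0 c0 z"
      using x(2) by (auto simp: quad_q)
  next
    fix v assume "\<exists>z\<in>carrier_vec n. quad A1 b1 c1 z \<le> 0 \<and> v = quad A0 b0 c0 z"
    then show "q0 x \<le> v" using min by (auto simp: quad_q)
  qed
  ultimately show ?thesis using x(1) nb by auto
qed

text \<open>If both matrices vanished at a diagonal position, the form at \<gamma>h would vanish at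
  that unit vector, contradicting \<xi> > 0. Consequently operations of cost n are covered by
  N.\<close>

lemma dim_le_nnz: "n \<le> nnz A0 + nnz A1"
proof -
  let ?I = "\<lambda>A. {i. i < n \<and> (A :: real mat) $$ (i, i) \<noteq> 0}"
  have "i \<in> ?I A0 \<union> ?I A1" if i: "i < n" for i
  proof (rule ccontr)
    assume "i \<notin> ?I A0 \<union> ?I A1"
    then have z: "A0 $$ (i, i) = 0" "A1 $$ (i, i) = 0" using i by auto
    let ?e = "vecn n (\<lambda>j. if j = i then 1 else 0)"
    have form: "inner ?e y = coord y i" for y
    proof -
      have "inner ?e y = (\<Sum>j<n. coord ?e j * coord y j)" by (rule inner_in_dim) simp
      also have "\<dots> = (\<Sum>j<n. if j = i then coord y j else 0)" by (intro sum.cong) auto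
      also have "\<dots> = coord y i" using i by (subst sum.delta) auto
      finally show ?thesis .
    qed
    have c: "coord (mat_op A ?e) i = A $$ (i, i)" if "A \<in> carrier_mat n n" for A
    proof -
      have "coord (mat_op A ?e) i = (\<Sum>j<n. A $$ (i, j) * coord ?e j)" using that i by (simp add: mat_op_def)
      also have "\<dots> = (\<Sum>j<n. if j = i then A $$ (i, j) else 0)" by (intro sum.cong) auto
      also have "\<dots> = A $$ (i, i)" using i by (subst sum.delta) auto
      finally show ?thesis .
    qed
    have "\<xi> * 1 \<le> 0"
      using form_hat[of ?e] unfolding form_def form c[OF carriers(1)] c[OF carriers(2)] z using i by simp
    then show False using xi_pos by simp
  qed
  then have "{..<n} \<subseteq> ?I A0 \<union> ?I A1" by blast
  then have "n \<le> card (?I A0 \<union> ?I A1)" using card_mono[of "?I A0 \<union> ?I A1" "{..<n}"] by simp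
  also have "\<dots> \<le> card (?I A0) + card (?I A1)" by (rule card_Un_le)
  also have "\<dots> \<le> nnz A0 + nnz A1"
  proof (rule add_mono)
    have *: "card (?I A) \<le> nnz A" if A: "A \<in> carrier_mat n n" for A unfolding nnz_def
    proof (rule card_inj_on_le[of "\<lambda>i. (i, i)"])
      show "finite {(i, j). i < dim_row A \<and> j < dim_col A \<and> A $$ (i, j) \<noteq> 0}"
        by (rule finite_subset[of _ "{..<dim_row A} \<times> {..<dim_col A}"]) auto
    qed (use A in \<open>auto simp: inj_on_def\<close>)
    show "card (?I A0) \<le> nnz A0" "card (?I A1) \<le> nnz A1" using * carriers by blast+
  qed
  finally show ?thesis .
qed

lemma eigen_form: "\<exists>u l. in_dim n u \<and> inner u u = 1 \<and> B0 u + \<gamma> *\<^sub>R B1 u = l *\<^sub>R u \<and>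
    (\<forall>h. in_dim n h \<longrightarrow> l * inner h h \<le> form \<gamma> h)"
  using min_eigenvector[OF pencil_carrier n_pos, of \<gamma>]
  unfolding mat_op_pencil[OF carriers(1,2)] by (simp add: form_def inner_add_right)

text \<open>Extends bounds from R^n to all vectors, since the operator lemmas quantify over the
  whole space.\<close>

lemma form_trunc: "form \<gamma> h = form \<gamma> (vecn n (coord h))" "inner (vecn n (coord h)) (vecn n (coord h)) \<le> inner h h"
proof -
  let ?t = "vecn n (coord h)"
  have t1: "mat_op A ?t = mat_op A h" if "A \<in> carrier_mat n n" for A
    using that by (intro fvec_eqI) (auto simp: mat_op_def)
  have t3: "inner h (mat_op A h) = inner ?t (mat_op A ?t)" if "A \<in> carrier_mat n n" for A
    unfolding t1[OF that] inner_commute[of h] inner_commute[of ?t]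
    using that by (subst (1 2) inner_in_dim[of n]) auto
  show "form \<gamma> h = form \<gamma> ?t" unfolding form_def using t3 carriers by simp
  have tt: "inner ?t ?t = inner ?t h" by (subst (1 2) inner_in_dim[of n]) auto
  have "0 \<le> inner (h - ?t) (h - ?t)" by simp
  then show "inner ?t ?t \<le> inner h h" using tt by (simp add: inner_diff_left inner_diff_right inner_commute)
qed

lemma form_abs: "\<bar>form \<gamma> h\<bar> \<le> (1 + \<bar>\<gamma>\<bar>) * inner h h"
proof -
  have "\<bar>\<gamma> * inner h (B1 h)\<bar> \<le> \<bar>\<gamma>\<bar> * inner h h" unfolding abs_mult using B_bound by (intro mult_left_mono) auto
  then show ?thesis using B_bound(1)[of h] unfolding form_def by (simp add: distrib_right)
qed

end

section \<open>The algorithm\<close>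

text \<open>
  Scalars: 0 to 6 are the input parameters, 7 to 9 and 19 the constants 0, 1, 2, -1, 10 the
  regularization, 13 the number of bisection steps, 14 and 15 the stopping threshold and growth
  factor of the Chebyshev iteration, 17 the stopping threshold of the descent, 18 the condition
  number, 20 and 21 the current bisection interval, 28 and 29 the two multipliers it produces.
  Slots: 8 and 9 are the directions of negative curvature, 10 and 11 the two descent sequences,
  15 the output. Assignments are repeated where both branches of a conditional must have equal cost.
\<close>

definition setup_code :: com where
  "setup_code =
     sConst 8 1 ;; sConst 9 2 ;; sConst 19 (-1) ;; sDiv 18 1 0 ;;
     sMul 26 18 18 ;; sMul 26 26 18 ;; sConst 27 72 ;; sMul 26 26 27 ;; sDiv 10 3 26 ;;
     sConst 27 3 ;; sMul 27 27 1 ;; sDiv 11 9 27 ;; sSub 12 7 11 ;;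
     sDiv 26 10 27 ;; sMul 26 26 9 ;; sSqrt 26 26 ;; sAdd 26 26 8 ;; sMul 15 26 26 ;;
     sConst 27 4 ;; sMul 27 27 1 ;; sDiv 16 8 27 ;;
     sConst 27 288 ;; sMul 27 27 1 ;; sMul 27 27 18 ;; sMul 17 27 18 ;;
     sConst 27 8 ;; sMul 26 27 1 ;; sSub 24 26 10"

text \<open>The machine has neither logarithms nor rounding, so the number of halvings is found by
  carrying them out.\<close>

definition count_code :: com where
  "count_code = sWhile 24 (sDiv 26 26 9 ;; sAdd 13 13 8 ;; sSub 24 26 10)"

definition threshold_code :: com where
  "threshold_code =
     sMul 26 13 9 ;; sDiv 26 4 26 ;; sMul 27 26 26 ;; sMul 27 27 26 ;;
     sDim 26 ;; sConst 24 32 ;; sMul 26 26 24 ;; sDiv 14 26 27"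

text \<open>Scalar 23 tracks the guaranteed squared growth; comparing it with the threshold replaces
  an iteration count computed beforehand.\<close>

definition cheb_code :: com where
  "cheb_code =
     vMul0 7 4 2 ;; vMul1 7 6 2 ;; vLin 4 8 4 22 6 ;; vLin 4 8 2 12 4 ;;
     vMul0 7 5 3 ;; vMul1 7 6 3 ;; vLin 5 8 5 22 6 ;; vLin 5 8 3 12 5 ;;
     vLin 6 8 4 8 5 ;; vLin 4 8 6 8 3 ;; vLin 3 8 6 19 2 ;; vLin 2 8 4 7 4 ;;
     sMul 23 23 15 ;; sSub 24 14 23"

definition probe_code :: com where
  "probe_code =
     vNormal 2 ;; vLin 3 8 2 7 2 ;; sAdd 23 8 7 ;; sSub 24 14 23 ;;
     sWhile 24 cheb_code ;;
     vMul0 7 4 2 ;; vMul1 7 6 2 ;; vLin 4 8 4 22 6 ;; vDot 26 2 4 ;; sSub 24 7 26"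

text \<open>Scalar 20 is the end at which no negative curvature was found. A successful test moves
  the outer end 21 and stores its witness in slot W.\<close>

definition bisect_code :: "nat \<Rightarrow> com" where
  "bisect_code W =
     sAdd 22 20 21 ;; sDiv 22 22 9 ;; probe_code ;;
     sCond 24 (sAdd 21 22 7 ;; vLin W 8 2 7 2) (sAdd 20 22 7 ;; sAdd 20 22 7) ;;
     sSub 25 25 8"

definition side_code :: "nat \<Rightarrow> com" where
  "side_code W = sAdd 20 2 7 ;; sAdd 25 13 7 ;; sWhile 25 (bisect_code W)"

definition gradient_code :: com where
  "gradient_code =
     sMul 26 30 30 ;; sConst 27 4 ;; sMul 26 26 27 ;; sAdd 26 26 8 ;; sSqrt 26 26 ;; sAdd 26 26 8 ;;
     sDiv 31 26 9 ;; sDiv 32 8 31 ;; sMul 34 31 16 ;;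
     vLin 12 8 11 19 10 ;; vLin 12 8 10 32 12 ;;
     vMul0 7 13 12 ;; vLin 13 8 13 10 12 ;; vLin 13 8 13 8 0 ;;
     vMul1 7 14 12 ;; vLin 14 8 14 8 1"

text \<open>Scalars 33 and 35 describe the derivative in \<gamma> of the concave dual of the
  proximal step, an affine function of \<gamma>; 26 and 27 are its values at the right and left
  multiplier.\<close>

definition slope_code :: com where
  "slope_code =
     vDot 33 12 14 ;; vDot 26 12 1 ;; sAdd 33 33 26 ;; sAdd 33 33 6 ;;
     vDot 26 14 11 ;; vDot 27 14 12 ;; sSub 26 26 27 ;;
     vDot 27 14 13 ;; sMul 27 27 34 ;; sSub 26 26 27 ;; sMul 26 26 9 ;; sAdd 33 33 26 ;;
     vDot 35 14 14 ;; sMul 35 35 34 ;; sMul 35 35 9 ;;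
     sMul 26 29 35 ;; sSub 26 33 26 ;; sMul 27 28 35 ;; sSub 27 33 27"

text \<open>Maximizes the concave dual over the interval: the right end if it still increases there,
  the stationary point if the slope changes sign, otherwise the left end.\<close>

definition choose_code :: com where
  "choose_code =
     sCond 26 (sAdd 36 29 7 ;; sAdd 36 29 7) (sCond 27 (sDiv 36 33 35) (sAdd 36 28 7))"

definition prox_code :: com where
  "prox_code =
     vLin 6 8 13 36 14 ;; sSub 26 7 34 ;; vLin 11 8 11 26 6 ;;
     vLin 6 8 11 19 10 ;; vLin 10 8 10 32 6 ;;
     sAdd 30 31 7 ;; sMul 26 30 30 ;; sMul 26 26 3 ;; sSub 24 17 26"

definition descent_code :: com where
  "descent_code =
     vLin 10 7 2 7 2 ;; vLin 11 7 2 7 2 ;; sAdd 30 7 7 ;; sAdd 24 17 7 ;;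
     sWhile 24 (gradient_code ;; (slope_code ;; choose_code) ;; prox_code)"

definition round_code :: com where
  "round_code =
     vMul1 7 4 10 ;; vLin 14 8 4 8 1 ;; vDot 33 10 14 ;; vDot 26 10 1 ;; sAdd 33 33 26 ;; sAdd 33 33 6 ;;
     vMul0 7 4 10 ;; vLin 13 8 4 8 0 ;;
     sCond 33 (vLin 6 8 9 7 9 ;; sAdd 36 29 7) (vLin 6 8 8 7 8 ;; sAdd 36 28 7)"

definition root_code :: com where
  "root_code =
     vMul1 7 4 6 ;; vDot 35 6 4 ;; vDot 37 6 14 ;; vDot 38 6 13 ;; sMul 26 36 37 ;; sAdd 38 38 26 ;;
     sMul 26 37 37 ;; sMul 27 35 33 ;; sSub 26 26 27 ;; sSqrt 26 26 ;;
     sAdd 27 37 26 ;; sSub 27 7 27 ;; sDiv 27 27 35 ;;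
     sSub 26 26 37 ;; sDiv 26 26 35 ;;
     sMul 24 27 38 ;; sCond 24 (sAdd 27 26 7) (sAdd 27 27 7) ;;
     vLin 15 8 10 27 6"

definition main_code :: com where
  "main_code =
     setup_code ;; count_code ;; threshold_code ;;
     sMul 21 1 9 ;; side_code 9 ;; sAdd 29 21 7 ;;
     sSub 21 7 1 ;; side_code 8 ;; sAdd 28 21 7 ;;
     descent_code ;; round_code ;; root_code"

text \<open>
  The exact recurrence \<open>t\<^sup>2 - t = T\<^sup>2\<close> is needed: the reference value of the descent need not be the
  minimum, so the gap may be negative and an inequality would not do.
\<close>

fun momentum :: "nat \<Rightarrow> real" where
  "momentum 0 = 0"
| "momentum (Suc m) = (sqrt (momentum m * momentum m * 4 + 1) + 1) / 2"

lemma momentum_ge: "real m / 2 \<le> momentum m"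
proof (induction m)
  case (Suc m)
  have "0 \<le> momentum m" using Suc by (rule order_trans[rotated]) simp
  then have "2 * momentum m = sqrt ((2 * momentum m)\<^sup>2)" by (subst real_sqrt_abs) simp
  also have "\<dots> \<le> sqrt (momentum m * momentum m * 4 + 1)" by (simp add: power2_eq_square)
  finally show ?case using Suc by simp
qed simp

lemma momentum_square: "(momentum (Suc m))\<^sup>2 - momentum (Suc m) = (momentum m)\<^sup>2"
proof -
  have "(sqrt (momentum m * momentum m * 4 + 1))\<^sup>2 = momentum m * momentum m * 4 + 1" by simp
  then show ?thesis by (simp add: power2_eq_square field_simps)
qed

lemma momentum_ge1: "1 \<le> momentum (Suc m)"
proof -
  have "1 \<le> sqrt (momentum m * momentum m * 4 + 1)" by simp
  then show ?thesis by simp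
qed

context gtrs
begin

text \<open>Since |x*|^2 \<le> 36 \<kappa>^2, the factor 72 limits the cost of the regularization at
  x* to \<epsilon> / 2.\<close>

definition "sg = \<epsilon> / (\<kappa> * \<kappa> * \<kappa> * 72)"
text \<open>All tested multipliers satisfy |\<gamma>| \<le> 2 \<zeta>, so A(\<gamma>) \<le> 1 + 2
  \<zeta> \<le> 3 \<zeta> and cc A(\<gamma>) \<le> 2.\<close>

definition "cc = 2 / (3 * \<zeta>)"
text \<open>An eigenvalue of A(\<gamma>) below - sg / 2 becomes one of M above 1 + cc sg / 2 = 1 +
  sg / (3 \<zeta>); this is the rate that \<open>cheb_growth\<close> then guarantees.\<close>

definition "rho = sqrt (sg / (3 * \<zeta>) * 2) + 1"
text \<open>Both initial intervals are at most 4 \<zeta> wide, so the final width is at most sg /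
  2.\<close>

definition "steps = (LEAST k. 8 * \<zeta> / 2 ^ k \<le> sg)"
text \<open>Two bisections with \<open>steps\<close> tests each share p equally.\<close>

definition "pf = p / (real steps * 2)"
text \<open>The amplification that \<open>gaussian_overlap\<close> requires at failure probability
  \<open>pf\<close>.\<close>

definition "HH = real n * 32 / (pf * pf * pf)"
definition "iters = (LEAST k. HH \<le> (rho * rho) ^ k)"
text \<open>Twice the bound 4 \<zeta> 36 \<kappa>^2 on the initial potential, so that the final gap
  is at most \<epsilon> / 2.\<close>

definition "budget = 288 * \<zeta> * \<kappa> * \<kappa>"
definition "rounds = (LEAST m. budget \<le> momentum m * momentum m * \<epsilon>)"

definition prepared0 :: "astate \<Rightarrow> bool" where
  "prepared0 \<sigma> \<longleftrightarrow> R \<sigma> 0 = \<xi> \<and> R \<sigma> 1 = \<zeta> \<and> R \<sigma> 2 = \<gamma>h \<and> R \<sigma> 3 = \<epsilon> \<and> R \<sigma> 4 = p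
    \<and> R \<sigma> 5 = c0 \<and> R \<sigma> 6 = c1 \<and> R \<sigma> 7 = 0 \<and> R \<sigma> 8 = 1 \<and> R \<sigma> 9 = 2 \<and> R \<sigma> 10 = sg
    \<and> R \<sigma> 12 = - cc \<and> R \<sigma> 15 = rho * rho \<and> R \<sigma> 16 = 1 / (4 * \<zeta>)
    \<and> R \<sigma> 17 = budget \<and> R \<sigma> 19 = -1 \<and> V \<sigma> 0 = \<beta>0 \<and> V \<sigma> 1 = \<beta>1"

definition prepared :: "astate \<Rightarrow> bool" where
  "prepared \<sigma> \<longleftrightarrow> prepared0 \<sigma> \<and> R \<sigma> 13 = real steps \<and> R \<sigma> 14 = HH"

section \<open>Lengths of the loops\<close>

lemma sg_pos: "0 < sg"
  unfolding sg_def using eps0 kappa_ge1 by (intro divide_pos_pos mult_pos_pos) auto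

lemma steps_spec: "8 * \<zeta> / 2 ^ steps \<le> sg" and steps_less: "k < steps \<Longrightarrow> sg < 8 * \<zeta> / 2 ^ k"
proof -
  obtain j where "8 * \<zeta> / sg < 2 ^ j" using real_arch_pow[of 2 "8 * \<zeta> / sg"] by auto
  then have "8 * \<zeta> / 2 ^ j \<le> sg" using sg_pos by (simp add: field_simps)
  then show "8 * \<zeta> / 2 ^ steps \<le> sg" unfolding steps_def by (rule LeastI)
  show "k < steps \<Longrightarrow> sg < 8 * \<zeta> / 2 ^ k" unfolding steps_def using not_less_Least by force
qed

lemma rho_gt1: "1 < rho" unfolding rho_def using sg_pos zeta_ge1 by simp

lemma iters_spec: "HH \<le> (rho * rho) ^ iters" and iters_less: "k < iters \<Longrightarrow> (rho * rho) ^ k < HH"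
proof -
  have "1 < rho * rho" using rho_gt1 by (simp add: less_1_mult)
  then obtain j where "HH < (rho * rho) ^ j" using real_arch_pow by blast
  then have "HH \<le> (rho * rho) ^ j" by simp
  then show "HH \<le> (rho * rho) ^ iters" unfolding iters_def by (rule LeastI)
  show "k < iters \<Longrightarrow> (rho * rho) ^ k < HH" unfolding iters_def using not_less_Least by force
qed

lemma rounds_spec: "budget \<le> momentum rounds * momentum rounds * \<epsilon>"
  and rounds_less: "m < rounds \<Longrightarrow> momentum m * momentum m * \<epsilon> < budget"
proof -
  obtain j :: nat where m: "budget / \<epsilon> * 4 + 1 < real j" using reals_Archimedean2 by blast
  have b: "0 \<le> budget" unfolding budget_def using zeta_ge1 kappa_ge1 by simp
  then have m1: "1 \<le> real j" using m eps0 by (smt (verit) divide_nonneg_pos)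
  have "real j * 1 \<le> real j * real j" using m1 by (intro mult_left_mono) auto
  moreover have "real j / 2 * (real j / 2) \<le> momentum j * momentum j"
    using momentum_ge[of j] m1 by (intro mult_mono) auto
  moreover have "real j / 2 * (real j / 2) = real j * real j / 4" by simp
  ultimately have "4 * (budget / \<epsilon>) \<le> 4 * (momentum j * momentum j)" using m
    by (simp only: mult.commute[of _ 4] mult_1_right)
  then have "budget \<le> momentum j * momentum j * \<epsilon>" using eps0 by (simp add: field_simps)
  then show "budget \<le> momentum rounds * momentum rounds * \<epsilon>" unfolding rounds_def by (rule LeastI)
  show "m < rounds \<Longrightarrow> momentum m * momentum m * \<epsilon> < budget"
    unfolding rounds_def using not_less_Least by force
qed

end

locale gtrs_ram = gtrs + ram_instance n A0 A1 nm for nm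
begin

lemma wx_setup:
  assumes \<sigma>: "R \<sigma> 0 = \<xi>" "R \<sigma> 1 = \<zeta>" "R \<sigma> 2 = \<gamma>h" "R \<sigma> 3 = \<epsilon>" "R \<sigma> 4 = p" "R \<sigma> 5 = c0" "R \<sigma> 6 = c1"
      "R \<sigma> 7 = 0" "R \<sigma> 13 = 0" "V \<sigma> 0 = \<beta>0" "V \<sigma> 1 = \<beta>1"
    and Q: "\<And>\<sigma>'. prepared0 \<sigma>' \<Longrightarrow> R \<sigma>' 13 = 0 \<Longrightarrow> R \<sigma>' 24 = 8 * \<zeta> - sg \<Longrightarrow> R \<sigma>' 26 = 8 * \<zeta> \<Longrightarrow>
      dr \<sigma>' = dr \<sigma> \<Longrightarrow> Q \<sigma>'"
  shows "wx \<omega> setup_code 28 Q \<sigma>"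
  unfolding setup_code_def
  apply (rule wx_mono)
    apply (rule wx_Seq, rule wx_prims, simp add: \<sigma> del: One_nat_def)+
    apply (rule wx_prims, rule Q)
        apply (simp_all add: \<sigma> prepared0_def sg_def cc_def rho_def budget_def \<kappa>_def del: One_nat_def)
  done

lemma wx_count:
  assumes \<sigma>: "prepared0 \<sigma>" "R \<sigma> 13 = 0" "R \<sigma> 24 = 8 * \<zeta> - sg" "R \<sigma> 26 = 8 * \<zeta>"
    and Q: "\<And>\<sigma>'. prepared0 \<sigma>' \<Longrightarrow> R \<sigma>' 13 = real steps \<Longrightarrow> dr \<sigma>' = dr \<sigma> \<Longrightarrow> Q \<sigma>'"
  shows "wx \<omega> count_code (steps * 4 + 1) Q \<sigma>"
proof -
  define I where "I = (\<lambda>i \<sigma>'. prepared0 \<sigma>' \<and> R \<sigma>' 13 = real i \<and> R \<sigma>' 24 = 8 * \<zeta> / 2 ^ i - sg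
     \<and> R \<sigma>' 26 = 8 * \<zeta> / 2 ^ i \<and> dr \<sigma>' = dr \<sigma>)"
  have "wx \<omega> count_code (steps * (3 + 1) + 1) Q \<sigma>" unfolding count_code_def
  proof (rule wx_sWhile[where I = I])
    show "I 0 \<sigma>" using \<sigma> by (simp add: I_def)
    fix i \<sigma> assume i: "i < steps" and I: "I i \<sigma>"
    have "wx \<omega> (sDiv 26 26 9 ;; sAdd 13 13 8 ;; sSub 24 26 10) 3 (I (Suc i)) \<sigma>"
      apply (rule wx_mono)
        apply (rule wx_Seq, rule wx_prims)+
        apply (rule wx_prims)
        apply (use I in \<open>simp_all add: I_def prepared0_def\<close>)
      done
    then show "0 < R \<sigma> 24 \<and> wx \<omega> (sDiv 26 26 9 ;; sAdd 13 13 8 ;; sSub 24 26 10) 3 (I (Suc i)) \<sigma>"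
      using steps_less[OF i] I by (simp add: I_def)
  next
    fix \<sigma>' assume "I steps \<sigma>'"
    then show "R \<sigma>' 24 \<le> 0 \<and> Q \<sigma>'" using steps_spec Q by (simp add: I_def)
  qed
  then show ?thesis by simp
qed

lemma wx_threshold:
  assumes \<sigma>: "prepared0 \<sigma>" "R \<sigma> 13 = real steps"
    and Q: "\<And>\<sigma>'. prepared \<sigma>' \<Longrightarrow> dr \<sigma>' = dr \<sigma> \<Longrightarrow> Q \<sigma>'"
  shows "wx \<omega> threshold_code 8 Q \<sigma>"
  unfolding threshold_code_def
  apply (rule wx_mono)
    apply (rule wx_Seq, rule wx_prims, use \<sigma> in \<open>simp add: prepared0_def\<close>)+
    apply (rule wx_prims, rule Q)
     apply (use \<sigma> in \<open>simp_all add: prepared_def prepared0_def pf_def HH_def\<close>)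
  done

section \<open>Chebyshev tests and bisection on the machine\<close>

definition "pen \<gamma> h = B0 h + \<gamma> *\<^sub>R B1 h"

lemma inner_pen: "inner h (pen \<gamma> h) = form \<gamma> h" by (simp add: pen_def form_def inner_add_right)

definition same :: "nat set \<Rightarrow> nat set \<Rightarrow> astate \<Rightarrow> astate \<Rightarrow> bool" where
  "same J S \<sigma> \<sigma>' \<longleftrightarrow> (\<forall>j. j \<notin> J \<longrightarrow> R \<sigma>' j = R \<sigma> j) \<and> (\<forall>k. k \<notin> S \<longrightarrow> V \<sigma>' k = V \<sigma> k)"

lemma same_prepared:
  assumes "same J S \<sigma> \<sigma>'" "prepared \<sigma>" "J \<inter> {..19} = {}" "S \<inter> {..1} = {}"
  shows "prepared \<sigma>'"
proof -
  have "R \<sigma>' j = R \<sigma> j" if "j \<le> 19" for j using assms(1,3) that by (auto simp: same_def disjoint_iff)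
  moreover have "V \<sigma>' k = V \<sigma> k" if "k \<le> 1" for k using assms(1,4) that by (auto simp: same_def disjoint_iff)
  ultimately show ?thesis using assms(2) by (simp add: prepared_def prepared0_def)
qed

abbreviation "opM \<gamma> \<equiv> (\<lambda>h. h - cc *\<^sub>R pen \<gamma> h)"

lemma wx_cheb:
  assumes \<sigma>: "prepared \<sigma>" and Q: "\<And>\<sigma>'. same {23, 24} {2, 3, 4, 5, 6} \<sigma> \<sigma>' \<Longrightarrow>
      R \<sigma>' 23 = R \<sigma> 23 * (rho * rho) \<Longrightarrow> R \<sigma>' 24 = HH - R \<sigma>' 23 \<Longrightarrow>
      V \<sigma>' 2 = opM (R \<sigma> 22) (V \<sigma> 2) + V \<sigma> 3 + opM (R \<sigma> 22) (V \<sigma> 3) \<Longrightarrow>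
      V \<sigma>' 3 = opM (R \<sigma> 22) (V \<sigma> 3) - V \<sigma> 2 + opM (R \<sigma> 22) (V \<sigma> 2) \<Longrightarrow> dr \<sigma>' = dr \<sigma> \<Longrightarrow> Q \<sigma>'"
  shows "wx \<omega> cheb_code 18 Q \<sigma>"
  unfolding cheb_code_def
  apply (rule wx_mono)
    apply (rule wx_Seq, rule wx_prims; (use \<sigma> in \<open>simp add: prepared_def prepared0_def\<close>)?)+
    apply (rule wx_prims, rule Q)
         apply (use \<sigma> in \<open>simp_all add: same_def prepared_def prepared0_def pen_def algebra_simps\<close>)
  done

definition "test_vec \<gamma> g = fst (cheb (opM \<gamma>) g iters)"

lemma wx_test:
  assumes \<sigma>: "prepared \<sigma>"
    and Q: "\<And>\<sigma>'. same {23, 24, 26} {2, 3, 4, 5, 6} \<sigma> \<sigma>' \<Longrightarrow> dr \<sigma>' = dr \<sigma> + n \<Longrightarrow>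
      V \<sigma>' 2 = test_vec (R \<sigma> 22) (vecn n (\<lambda>i. \<omega> (dr \<sigma> + i))) \<Longrightarrow>
      R \<sigma>' 24 = - form (R \<sigma> 22) (V \<sigma>' 2) \<Longrightarrow> Q \<sigma>'"
  shows "wx \<omega> probe_code (iters * 19 + 12) Q \<sigma>"
proof -
  let ?g = "vecn n (\<lambda>i. \<omega> (dr \<sigma> + i))" and ?\<gamma> = "R \<sigma> 22"
  define I where "I = (\<lambda>i \<sigma>'. same {23, 24} {2, 3, 4, 5, 6} \<sigma> \<sigma>' \<and> dr \<sigma>' = dr \<sigma> + n
     \<and> (V \<sigma>' 2, V \<sigma>' 3) = cheb (opM ?\<gamma>) ?g i \<and> R \<sigma>' 23 = (rho * rho) ^ i \<and> R \<sigma>' 24 = HH - R \<sigma>' 23)"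
  have prep: "prepared \<sigma>'" if "I i \<sigma>'" for i \<sigma>'
    using same_prepared[OF _ \<sigma>, of "{23, 24}" "{2, 3, 4, 5, 6}" \<sigma>'] that by (simp add: I_def)
  have loop: "wx \<omega> (sWhile 24 cheb_code) (iters * (18 + 1) + 1) (I iters) \<sigma>0" if "I 0 \<sigma>0" for \<sigma>0
  proof (rule wx_sWhile[where I = I, OF that])
    fix i \<sigma>' assume i: "i < iters" and I: "I i \<sigma>'"
    have g: "R \<sigma>' 22 = ?\<gamma>" using I by (simp add: I_def same_def)
    obtain w v where wv: "cheb (opM ?\<gamma>) ?g i = (w, v)" by force
    have e: "V \<sigma>' 2 = w" "V \<sigma>' 3 = v" using I by (auto simp: I_def wv)
    have "wx \<omega> cheb_code 18 (I (Suc i)) \<sigma>'"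
      by (rule wx_cheb[OF prep[OF I]]) (use I in \<open>simp add: I_def same_def g wv e mult.commute\<close>)
    then show "0 < R \<sigma>' 24 \<and> wx \<omega> cheb_code 18 (I (Suc i)) \<sigma>'"
      using iters_less[OF i] I by (simp add: I_def)
  next
    fix \<sigma>' assume "I iters \<sigma>'"
    then show "R \<sigma>' 24 \<le> 0 \<and> I iters \<sigma>'" using iters_spec by (simp add: I_def)
  qed
  have fin: "wx \<omega> (vMul0 7 4 2 ;; vMul1 7 6 2 ;; vLin 4 8 4 22 6 ;; vDot 26 2 4 ;; sSub 24 7 26) 7 Q \<sigma>'"
    if I: "I iters \<sigma>'" for \<sigma>'
  proof -
    have s: "same {23, 24} {2, 3, 4, 5, 6} \<sigma> \<sigma>'" "dr \<sigma>' = dr \<sigma> + n" using I by (simp_all add: I_def)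
    have v2: "V \<sigma>' 2 = test_vec ?\<gamma> ?g" using I unfolding test_vec_def I_def by (metis fst_conv)
    have c: "R \<sigma>' 7 = 0" "R \<sigma>' 8 = 1" "R \<sigma>' 22 = ?\<gamma>"
      using prep[OF I] s by (simp_all add: prepared_def prepared0_def same_def)
    show ?thesis
      apply (rule wx_mono)
        apply (rule wx_Seq, rule wx_prims; (simp add: c)?)+
        apply (rule wx_prims, rule Q)
           apply (use s v2 c in \<open>simp_all add: same_def form_def inner_add_right\<close>)
      done
  qed
  show ?thesis unfolding probe_code_def
    apply (rule wx_mono)
      apply (rule wx_Seq, rule wx_prims; (use \<sigma> in \<open>simp add: prepared_def prepared0_def\<close>)?)+
      apply (rule wx_Seq, rule wx_mono[OF loop order_refl])
       apply (use \<sigma> in \<open>simp add: I_def same_def prepared_def prepared0_def\<close>)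
      apply (rule fin, assumption)
     apply simp_all
    done
qed

text \<open>The interval is a function of the history of outcomes, which brings the tests into the
  form of \<open>adaptive_failure\<close>. The second component is the outer end, so on the left
  side it is the smaller one.\<close>

fun interval :: "real \<Rightarrow> bool list \<Rightarrow> real \<times> real" where
  "interval e l = foldl (\<lambda>(a, b) t. if t then (a, (a + b) / 2) else ((a + b) / 2, b)) (\<gamma>h, e) l"

declare interval.simps [simp del]

lemma interval_Nil: "interval e [] = (\<gamma>h, e)" by (simp add: interval.simps)

lemma interval_snoc: "interval e (l @ [t]) = (let (a, b) = interval e l in
    if t then (a, (a + b) / 2) else ((a + b) / 2, b))"
  by (simp add: interval.simps split: prod.split)

definition "mid_of e l = (fst (interval e l) + snd (interval e l)) / 2"

definition "outcome e l g \<longleftrightarrow> form (mid_of e l) (test_vec (mid_of e l) (vecn n g)) < 0"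

text \<open>Before the first success slot W holds no witness; hence the disjunction in the
  invariant.\<close>

lemma wx_bisect:
  assumes \<sigma>: "prepared \<sigma>" and W: "W \<in> {8, 9}"
    and ab: "interval e l = (R \<sigma> 20, R \<sigma> 21)"
    and wit: "(\<not> True \<in> set l) \<or> form (R \<sigma> 21) (V \<sigma> W) < 0"
    and Q: "\<And>\<sigma>'. same {20, 21, 22, 23, 24, 25, 26} {2, 3, 4, 5, 6, W} \<sigma> \<sigma>' \<Longrightarrow> dr \<sigma>' = dr \<sigma> + n \<Longrightarrow>
      R \<sigma>' 25 = R \<sigma> 25 - 1 \<Longrightarrow>
      (let l' = l @ [outcome e l (\<lambda>i. \<omega> (dr \<sigma> + i))] in
        interval e l' = (R \<sigma>' 20, R \<sigma>' 21) \<and> ((\<not> True \<in> set l') \<or> form (R \<sigma>' 21) (V \<sigma>' W) < 0)) \<Longrightarrow> Q \<sigma>'"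
  shows "wx \<omega> (bisect_code W) (iters * 19 + 18) Q \<sigma>"
proof -
  let ?m = "mid_of e l" and ?g = "\<lambda>i. \<omega> (dr \<sigma> + i)"
  have m: "?m = (R \<sigma> 20 + R \<sigma> 21) / 2" by (simp add: mid_of_def ab)
  have W20: "W < 20" "W \<noteq> 2" using W by auto
  have rest: "wx \<omega> (probe_code ;;
     sCond 24 (sAdd 21 22 7 ;; vLin W 8 2 7 2) (sAdd 20 22 7 ;; sAdd 20 22 7) ;; sSub 25 25 8) (iters * 19 + 16) Q \<sigma>1"
    if s1: "same {22} {} \<sigma> \<sigma>1" "R \<sigma>1 22 = ?m" "dr \<sigma>1 = dr \<sigma>" for \<sigma>1
  proof -
    have p1: "prepared \<sigma>1" using same_prepared[OF s1(1) \<sigma>] by simp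
    have tl: "wx \<omega> (sCond 24 (sAdd 21 22 7 ;; vLin W 8 2 7 2) (sAdd 20 22 7 ;; sAdd 20 22 7) ;; sSub 25 25 8) 4 Q \<sigma>2"
      if s2: "same {23, 24, 26} {2, 3, 4, 5, 6} \<sigma>1 \<sigma>2" "dr \<sigma>2 = dr \<sigma>1 + n"
        "V \<sigma>2 2 = test_vec (R \<sigma>1 22) (vecn n (\<lambda>i. \<omega> (dr \<sigma>1 + i)))" "R \<sigma>2 24 = - form (R \<sigma>1 22) (V \<sigma>2 2)" for \<sigma>2
    proof -
      have p2: "prepared \<sigma>2" using same_prepared[OF s2(1) p1] by simp
      have c: "R \<sigma>2 7 = 0" "R \<sigma>2 8 = 1" "R \<sigma>2 22 = ?m"
        using p2 s1 s2 by (simp_all add: prepared_def prepared0_def same_def)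
      have oc: "outcome e l ?g \<longleftrightarrow> 0 < R \<sigma>2 24" using s1 s2 by (simp add: outcome_def)
      have f: "R \<sigma>2 24 = - form ?m (V \<sigma>2 2)" using s1 s2 by simp
      show ?thesis
      proof (rule wx_mono, rule wx_Seq, rule wx_sCond)
        assume t: "0 < R \<sigma>2 24"
        then have oc': "outcome e l ?g" using oc by simp
        show "wx \<omega> (sAdd 21 22 7 ;; vLin W 8 2 7 2) (1 + 1) (\<lambda>\<sigma>. wx \<omega> (sSub 25 25 8) 1 Q \<sigma>) \<sigma>2"
          apply (rule wx_Seq, rule wx_prims, rule wx_vLin)
             apply (simp_all add: W20 c del: One_nat_def)
          apply (rule wx_prims, rule Q)
             apply (use s1 s2 t f W in \<open>auto simp: same_def c oc' interval_snoc ab m\<close>)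
          done
      next
        assume t: "R \<sigma>2 24 \<le> 0"
        then have oc': "\<not> outcome e l ?g" using oc by simp
        show "wx \<omega> (sAdd 20 22 7 ;; sAdd 20 22 7) (1 + 1) (\<lambda>\<sigma>. wx \<omega> (sSub 25 25 8) 1 Q \<sigma>) \<sigma>2"
          apply (rule wx_Seq, rule wx_prims, rule wx_prims)
          apply (simp add: c del: One_nat_def)
          apply (rule wx_prims, rule Q)
             apply (use s1 s2 t f W wit in \<open>auto simp: same_def c oc' interval_snoc ab m\<close>)
          done
      qed simp_all
    qed
    show ?thesis
      apply (rule wx_mono)
        apply (rule wx_Seq, rule wx_test[OF p1], rule tl)
           apply assumption+
       apply simp_all
      done
  qed
  show ?thesis unfolding bisect_code_def
    apply (rule wx_mono)
      apply (rule wx_Seq, rule wx_prims, rule wx_Seq, rule wx_prims, rule rest)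
        apply (use \<sigma> in \<open>simp_all add: same_def m prepared_def prepared0_def\<close>)
    done
qed

lemma wx_side:
  assumes \<sigma>: "prepared \<sigma>" and W: "W \<in> {8, 9}"
    and e: "R \<sigma> 21 = e"
    and Q: "\<And>\<sigma>'. same {20, 21, 22, 23, 24, 25, 26} {2, 3, 4, 5, 6, W} \<sigma> \<sigma>' \<Longrightarrow>
      dr \<sigma>' = dr \<sigma> + steps * n \<Longrightarrow>
      (let l = test_path (outcome e) n (dr \<sigma>) \<omega> steps in
        R \<sigma>' 21 = snd (interval e l) \<and> ((\<not> True \<in> set l) \<or> form (R \<sigma>' 21) (V \<sigma>' W) < 0)) \<Longrightarrow> Q \<sigma>'"
  shows "wx \<omega> (side_code W) (steps * (iters * 19 + 19) + 3) Q \<sigma>"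
proof -
  define I where "I = (\<lambda>i \<sigma>'. same {20, 21, 22, 23, 24, 25, 26} {2, 3, 4, 5, 6, W} \<sigma> \<sigma>' \<and>
      dr \<sigma>' = dr \<sigma> + i * n \<and> R \<sigma>' 25 = real steps - real i \<and>
      (let l = test_path (outcome e) n (dr \<sigma>) \<omega> i in
        interval e l = (R \<sigma>' 20, R \<sigma>' 21) \<and> ((\<not> True \<in> set l) \<or> form (R \<sigma>' 21) (V \<sigma>' W) < 0)))"
  have prep: "prepared \<sigma>'" if "I i \<sigma>'" for i \<sigma>'
    using same_prepared[OF _ \<sigma>, of "{20, 21, 22, 23, 24, 25, 26}" "{2, 3, 4, 5, 6, W}" \<sigma>'] that W by (auto simp: I_def)
  have loop: "wx \<omega> (sWhile 25 (bisect_code W)) (steps * (iters * 19 + 18 + 1) + 1) Q \<sigma>0" if "I 0 \<sigma>0" for \<sigma>0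
  proof (rule wx_sWhile[where I = I, OF that])
    fix i \<sigma>' assume i: "i < steps" and I: "I i \<sigma>'"
    let ?l = "test_path (outcome e) n (dr \<sigma>) \<omega> i"
    have "wx \<omega> (bisect_code W) (iters * 19 + 18) (I (Suc i)) \<sigma>'"
    proof (rule wx_bisect[OF prep[OF I] W, of e ?l])
      show "interval e ?l = (R \<sigma>' 20, R \<sigma>' 21)" "(\<not> True \<in> set ?l) \<or> form (R \<sigma>' 21) (V \<sigma>' W) < 0"
        using I by (simp_all add: I_def Let_def)
    qed (use I in \<open>simp add: I_def same_def Let_def\<close>)
    then show "0 < R \<sigma>' 25 \<and> wx \<omega> (bisect_code W) (iters * 19 + 18) (I (Suc i)) \<sigma>'"
      using i I by (simp add: I_def)
  next
    fix \<sigma>' assume I: "I steps \<sigma>'"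
    have "Q \<sigma>'" by (rule Q) (use I in \<open>simp_all add: I_def Let_def\<close>)
    then show "R \<sigma>' 25 \<le> 0 \<and> Q \<sigma>'" using I by (simp add: I_def)
  qed
  show ?thesis unfolding side_code_def
    apply (rule wx_mono)
      apply (rule wx_Seq, rule wx_prims, rule wx_Seq, rule wx_prims, rule loop)
      apply (use \<sigma> e in \<open>simp_all add: I_def same_def prepared_def prepared0_def interval_Nil\<close>)
    done
qed

end

section \<open>Correctness\<close>

context gtrs_ram
begin

text \<open>Slots of a simulated state lie in R^n, so this may be assumed when reasoning about the
  abstract state.\<close>

lemma wx_in_dim:
  assumes "(\<And>k. k < 20 \<Longrightarrow> in_dim n (V \<sigma> k)) \<Longrightarrow> wx \<omega> c T Q \<sigma>"
  shows "wx \<omega> c T Q \<sigma>"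
  unfolding wx_def
proof (intro allI impI)
  fix s assume s: "sim s \<sigma>"
  then have "wx \<omega> c T Q \<sigma>" by (intro assms) (simp add: sim_def)
  with s show "\<exists>s' \<sigma>'. executes_within \<omega> c s (T * U) s' \<and> sim s' \<sigma>' \<and> Q \<sigma>'" by (simp add: wx_def)
qed

text \<open>One bottom eigenvector is fixed for every multiplier before any sample is drawn, so that
  bad luck is a fixed event for the fresh Gaussian vector.\<close>

definition "low_vec \<gamma> = (SOME u. \<exists>l. in_dim n u \<and> inner u u = 1 \<and> pen \<gamma> u = l *\<^sub>R u \<and>
    (\<forall>h. in_dim n h \<longrightarrow> l * inner h h \<le> form \<gamma> h))"

lemma low_vec:
  "\<exists>l. in_dim n (low_vec \<gamma>) \<and> inner (low_vec \<gamma>) (low_vec \<gamma>) = 1 \<and> pen \<gamma> (low_vec \<gamma>) = l *\<^sub>R low_vec \<gamma> \<and>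
    (\<forall>h. in_dim n h \<longrightarrow> l * inner h h \<le> form \<gamma> h)"
  unfolding low_vec_def by (rule someI_ex) (use eigen_form[of \<gamma>] in \<open>simp add: pen_def\<close>)

definition "unlucky e l g \<longleftrightarrow> \<not> 4 * (\<Sum>i<n. (g i)\<^sup>2)
    < 32 * real n / pf ^ 3 * (\<Sum>i<n. coord (low_vec (mid_of e l)) i * g i)\<^sup>2"

lemma selfadjoint_pen: "selfadjoint (pen \<gamma>)"
  unfolding pen_def by (rule selfadjoint_pencil[OF sa0 sa1])

text \<open>Contraposition of \<open>cheb_finds_negative\<close>: on good samples a bottom
  eigenvalue below - sg / 2 would have produced a vector of negative form.\<close>

lemma outcome_complete:
  assumes good: "\<not> unlucky e l g" and m: "\<bar>mid_of e l\<bar> \<le> 2 * \<zeta>" and no: "\<not> outcome e l g"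
  shows "- (sg / 2) * inner h h \<le> form (mid_of e l) h"
proof -
  let ?m = "mid_of e l"
  obtain lam where u: "in_dim n (low_vec ?m)" "inner (low_vec ?m) (low_vec ?m) = 1"
    "pen ?m (low_vec ?m) = lam *\<^sub>R low_vec ?m" "\<forall>h. in_dim n h \<longrightarrow> lam * inner h h \<le> form ?m h"
    using low_vec by blast
  have lam: "- (sg / 2) \<le> lam"
  proof (rule ccontr)
    assume "\<not> - (sg / 2) \<le> lam"
    then have neg: "lam < - (sg / 2)" by simp
    have cc: "0 < cc" unfolding cc_def using zeta_ge1 by simp
    have "form ?m (test_vec ?m (vecn n g)) < 0"
      unfolding test_vec_def inner_pen[symmetric]
    proof (rule cheb_finds_negative[OF selfadjoint_pen cc _ u(3,2), where H = HH and x = "sg / (3 * \<zeta>)"])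
      fix h :: fvec
      have "form ?m h \<le> (1 + \<bar>?m\<bar>) * inner h h" using form_abs[of ?m h] by linarith
      also have "\<dots> \<le> (3 * \<zeta>) * inner h h" using m zeta_ge1 by (intro mult_right_mono) auto
      finally have "cc * form ?m h \<le> cc * (3 * \<zeta> * inner h h)" using cc by (intro mult_left_mono) auto
      also have "\<dots> = 2 * inner h h" unfolding cc_def using zeta_ge1 by simp
      finally show "cc * inner h (pen ?m h) \<le> 2 * inner h h" by (simp add: inner_pen)
    next
      show "0 < sg / (3 * \<zeta>)" using sg_pos zeta_ge1 by simp
      have "cc * (sg / 2) \<le> cc * - lam" using neg cc by (intro mult_left_mono) auto
      then show "sg / (3 * \<zeta>) \<le> - cc * lam" by (simp add: cc_def)
      have "rho = 1 + sqrt (2 * (sg / (3 * \<zeta>)))" by (simp add: rho_def mult.commute)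
      then show "HH \<le> (1 + sqrt (2 * (sg / (3 * \<zeta>)))) ^ (2 * iters)"
        using iters_spec by (simp add: power_mult power2_eq_square)
      have "inner (vecn n g) (vecn n g) = (\<Sum>i<n. (g i)\<^sup>2)"
        by (subst inner_in_dim[of n]) (auto simp: power2_eq_square)
      moreover have "inner (low_vec ?m) (vecn n g) = (\<Sum>i<n. coord (low_vec ?m) i * g i)"
        using u(1) by (subst inner_in_dim[of n]) auto
      moreover have "HH = 32 * real n / pf ^ 3" by (simp add: HH_def power3_eq_cube)
      ultimately show "4 * inner (vecn n g) (vecn n g) < HH * (inner (low_vec ?m) (vecn n g))\<^sup>2"
        using good by (simp add: unlucky_def)
    qed
    then show False using no by (simp add: outcome_def)
  qed
  let ?h = "vecn n (coord h)"
  have "- (sg / 2) * inner h h \<le> - (sg / 2) * inner ?h ?h"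
    using form_trunc(2)[of h] sg_pos by (simp add: mult_left_mono)
  also have "\<dots> \<le> lam * inner ?h ?h" using lam by (intro mult_right_mono) auto
  also have "\<dots> \<le> form ?m ?h" using u(4) by simp
  finally show ?thesis using form_trunc(1)[of ?m h] by simp
qed

lemma form_hat_all: "- (sg / 2) * inner h h \<le> form \<gamma>h h"
proof -
  have "- (sg / 2) * inner h h \<le> 0" using sg_pos by simp
  also have "0 \<le> \<xi> * inner (vecn n (coord h)) (vecn n (coord h))" using xi_pos by simp
  also have "\<dots> \<le> form \<gamma>h (vecn n (coord h))" by (rule form_hat) simp
  finally show ?thesis using form_trunc(1) by simp
qed

text \<open>The upper bound on \<epsilon> enters here. It separates the tolerance - sg from the
  value - \<xi> / 3 at the outer ends.\<close>

lemma sg_le: "sg \<le> \<xi> / 72"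
proof -
  have "\<epsilon> \<le> \<kappa> * \<kappa> * \<kappa> * \<xi>" using eps1 by (simp add: \<kappa>_def power3_eq_cube mult.assoc)
  then have "sg \<le> (\<kappa> * \<kappa> * \<kappa> * \<xi>) / (\<kappa> * \<kappa> * \<kappa> * 72)" unfolding sg_def
    using kappa_ge1 by (intro divide_right_mono) auto
  then show ?thesis using kappa_ge1 by simp
qed

text \<open>The signed difference of the ends treats both directions at once. An unsuccessful test
  moves the inner end to a multiplier whose form is certified, and the outer end stays at e until
  the first success.\<close>

lemma bisection_invariant:
  assumes good: "\<And>j. j < steps \<Longrightarrow> \<not> unlucky e (test_path (outcome e) n d \<omega> j) (\<lambda>i. \<omega> (d + j * n + i))"
    and e: "e = 2 * \<zeta> \<or> e = - \<zeta>" and j: "j \<le> steps"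
  shows "let (a, b) = interval e (test_path (outcome e) n d \<omega> j) in
     b - a = (e - \<gamma>h) / 2 ^ j \<and> min \<gamma>h e \<le> a \<and> a \<le> max \<gamma>h e \<and> min \<gamma>h e \<le> b \<and> b \<le> max \<gamma>h e \<and>
     (\<forall>h. - (sg / 2) * inner h h \<le> form a h) \<and>
     (True \<in> set (test_path (outcome e) n d \<omega> j) \<or> b = e)"
  using j
proof (induction j)
  case 0
  then show ?case using form_hat_all by (auto simp: interval_Nil)
next
  case (Suc j)
  let ?l = "test_path (outcome e) n d \<omega> j" and ?g = "\<lambda>i. \<omega> (d + j * n + i)"
  obtain a b where ab: "interval e ?l = (a, b)" by force
  note IH = Suc.IH[unfolded ab Let_def prod.case]
  have IH: "b - a = (e - \<gamma>h) / 2 ^ j" "min \<gamma>h e \<le> a" "a \<le> max \<gamma>h e" "min \<gamma>h e \<le> b" "b \<le> max \<gamma>h e"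
     "\<forall>h. - (sg / 2) * inner h h \<le> form a h" "True \<in> set ?l \<or> b = e"
    using IH Suc.prems by auto
  have m: "mid_of e ?l = (a + b) / 2" by (simp add: mid_of_def ab)
  have mm: "min \<gamma>h e \<le> (a + b) / 2" "(a + b) / 2 \<le> max \<gamma>h e" using IH(2-5) by (simp_all add: field_simps)
  have abs: "\<bar>mid_of e ?l\<bar> \<le> 2 * \<zeta>" using mm e gh0 gh_le zeta_ge1 unfolding m by (auto simp: abs_le_iff min_def max_def split: if_splits)
  have half: "(a + b) / 2 - a = (e - \<gamma>h) / 2 ^ Suc j" "b - (a + b) / 2 = (e - \<gamma>h) / 2 ^ Suc j"
    using IH(1) by (simp_all add: field_simps)
  show ?case
  proof (cases "outcome e ?l ?g")
    case True
    then show ?thesis using IH mm half by (simp add: interval_snoc ab)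
  next
    case False
    then have "\<forall>h. - (sg / 2) * inner h h \<le> form ((a + b) / 2) h"
      using outcome_complete[OF good abs] Suc.prems m by simp
    then show ?thesis using False IH mm half by (auto simp: interval_snoc ab)
  qed
qed

text \<open>The ends differ by at most sg / 2 and A1 is bounded by 1, so the bound - sg / 2 at the
  inner end becomes - sg at the outer one. Without any success the outer end would still be e, where
  the form reaches - \<xi> / 3.\<close>

lemma bisection_result:
  assumes good: "\<And>j. j < steps \<Longrightarrow> \<not> unlucky e (test_path (outcome e) n d \<omega> j) (\<lambda>i. \<omega> (d + j * n + i))"
    and e: "e = 2 * \<zeta> \<or> e = - \<zeta>"
  defines "l \<equiv> test_path (outcome e) n d \<omega> steps"
  defines "b \<equiv> snd (interval e l)"
  shows "True \<in> set l" "- sg * inner h h \<le> form b h"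
    "e = 2 * \<zeta> \<Longrightarrow> \<gamma>h < b \<and> b \<le> 2 * \<zeta>" "e = - \<zeta> \<Longrightarrow> - \<zeta> \<le> b \<and> b < \<gamma>h"
proof -
  obtain a where ab: "interval e l = (a, b)" unfolding b_def by (metis prod.collapse)
  have I: "b - a = (e - \<gamma>h) / 2 ^ steps" "min \<gamma>h e \<le> a" "a \<le> max \<gamma>h e" "min \<gamma>h e \<le> b" "b \<le> max \<gamma>h e"
     "\<forall>h. - (sg / 2) * inner h h \<le> form a h" "True \<in> set l \<or> b = e"
    using bisection_invariant[OF good e order_refl] ab unfolding l_def by auto
  have "\<bar>b - a\<bar> \<le> sg / 2"
  proof -
    have "\<bar>e - \<gamma>h\<bar> \<le> 4 * \<zeta>" using e gh0 gh_le zeta_ge1 by auto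
    then have "\<bar>b - a\<bar> \<le> 4 * \<zeta> / 2 ^ steps" unfolding I(1) abs_divide by (simp add: divide_right_mono)
    also have "\<dots> = (8 * \<zeta> / 2 ^ steps) / 2" by simp
    also have "\<dots> \<le> sg / 2" using steps_spec by (intro divide_right_mono) auto
    finally show ?thesis .
  qed
  then show fb: "- sg * inner h h \<le> form b h" for h
  proof -
    assume ba: "\<bar>b - a\<bar> \<le> sg / 2"
    have "\<bar>(b - a) * inner h (B1 h)\<bar> \<le> sg / 2 * inner h h"
      unfolding abs_mult using ba B_bound(2) sg_pos by (intro mult_mono) auto
    moreover have "form b h = form a h + (b - a) * inner h (B1 h)" by (simp add: form_def algebra_simps)
    moreover have "- (sg / 2) * inner h h \<le> form a h" using I(6) by blast
    ultimately show ?thesis by (simp add: abs_le_iff)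
  qed
  show "True \<in> set l"
  proof (rule ccontr)
    assume "True \<notin> set l"
    then have "b = e" using I(7) by simp
    moreover obtain v where v: "inner v v = 1" "form e v \<le> - \<xi> / 3"
      using e right_end_negative left_end_negative by blast
    ultimately show False using fb[of v] sg_le xi_pos by simp
  qed
  show "e = 2 * \<zeta> \<Longrightarrow> \<gamma>h < b \<and> b \<le> 2 * \<zeta>"
  proof -
    assume e2: "e = 2 * \<zeta>"
    then have "0 < (e - \<gamma>h) / 2 ^ steps" using gh_le zeta_ge1 by simp
    then have "a < b" using I(1) by linarith
    then show ?thesis using I e2 gh_le zeta_ge1 by (auto simp: min_def max_def split: if_splits)
  qed
  show "e = - \<zeta> \<Longrightarrow> - \<zeta> \<le> b \<and> b < \<gamma>h"
  proof -
    assume e2: "e = - \<zeta>"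
    then have "(e - \<gamma>h) / 2 ^ steps < 0" using gh0 zeta_ge1 by (intro divide_neg_pos) auto
    then have "b < a" using I(1) by linarith
    then show ?thesis using I e2 gh0 zeta_ge1 by (auto simp: min_def max_def split: if_splits)
  qed
qed

section \<open>Accelerated descent between the two multipliers\<close>

definition "reg_q \<gamma> x = inner x (B0 x) + 2 * inner \<beta>0 x + c0 + sg * inner x x
    + \<gamma> * (inner x (B1 x) + 2 * inner \<beta>1 x + c1)"

definition "bracket \<gamma>1 \<gamma>2 \<longleftrightarrow> - \<zeta> \<le> \<gamma>1 \<and> \<gamma>1 < \<gamma>2 \<and> \<gamma>2 \<le> 2 * \<zeta> \<and>
    (\<forall>h. - sg * inner h h \<le> form \<gamma>1 h) \<and> (\<forall>h. - sg * inner h h \<le> form \<gamma>2 h)"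

text \<open>For fixed h the form is affine in \<gamma>, so the lower bound carries over from the
  ends. Above, 1 + 2 \<zeta> \<le> 3 \<zeta> and sg \<le> \<zeta> add up to 4 \<zeta>.\<close>

lemma bracket_psd:
  assumes "bracket \<gamma>1 \<gamma>2" "\<gamma>1 \<le> \<gamma>" "\<gamma> \<le> \<gamma>2"
  shows "0 \<le> inner h (B0 h) + sg * inner h h + \<gamma> * inner h (B1 h)"
    "inner h (B0 h) + sg * inner h h + \<gamma> * inner h (B1 h) \<le> (4 * \<zeta>) * inner h h"
proof -
  have f: "- sg * inner h h \<le> form \<gamma>1 h" "- sg * inner h h \<le> form \<gamma>2 h" using assms by (auto simp: bracket_def)
  have "- sg * inner h h \<le> form \<gamma> h"
  proof (cases "0 \<le> inner h (B1 h)")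
    case True
    then have "\<gamma>1 * inner h (B1 h) \<le> \<gamma> * inner h (B1 h)" using assms by (intro mult_right_mono) auto
    then show ?thesis using f by (simp add: form_def)
  next
    case False
    then have "\<gamma>2 * inner h (B1 h) \<le> \<gamma> * inner h (B1 h)" using assms by (intro mult_right_mono_neg) auto
    then show ?thesis using f by (simp add: form_def)
  qed
  then show "0 \<le> inner h (B0 h) + sg * inner h h + \<gamma> * inner h (B1 h)" by (simp add: form_def)
  have "\<bar>\<gamma>\<bar> \<le> 2 * \<zeta>" using assms zeta_ge1 by (auto simp: bracket_def)
  then have "(1 + \<bar>\<gamma>\<bar>) * inner h h \<le> (1 + 2 * \<zeta>) * inner h h" by (intro mult_right_mono) auto
  moreover have "sg * inner h h \<le> \<zeta> * inner h h" using sg_le xi_le zeta_ge1 by (intro mult_right_mono) auto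
  moreover have "inner h h \<le> \<zeta> * inner h h" using mult_right_mono[OF zeta_ge1, of "inner h h"] by simp
  ultimately show "inner h (B0 h) + sg * inner h h + \<gamma> * inner h (B1 h) \<le> (4 * \<zeta>) * inner h h"
    using form_abs[of \<gamma> h] by (simp add: form_def distrib_right abs_le_iff)
qed

text \<open>The multiplier \<gamma> changes from step to step, but q1 vanishes at \<open>xs\<close>,
  so the reference value is the same for all of them and the estimates can be chained.\<close>

lemma descent_step:
  assumes br: "bracket \<gamma>1 \<gamma>2" and t: "1 \<le> t" and eta: "eta = t * (1 / (4 * \<zeta>))"
    and y: "y = x + (1 / t) *\<^sub>R (z - x)"
    and P: "P = B0 y + sg *\<^sub>R y + \<beta>0" and Q: "Q = B1 y + \<beta>1"
    and num: "num = inner y Q + inner y \<beta>1 + c1 + (inner Q z - inner Q y - inner Q P * eta) * 2"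
    and den: "den = inner Q Q * eta * 2"
    and \<gamma>: "\<gamma> = (if 0 < num - \<gamma>2 * den then \<gamma>2 else if 0 < num - \<gamma>1 * den then num / den else \<gamma>1)"
    and zp: "zp = z - eta *\<^sub>R (P + \<gamma> *\<^sub>R Q)" and xp: "xp = x + (1 / t) *\<^sub>R (zp - x)"
    and xs: "q1 xs = 0" and \<gamma>': "\<gamma>' \<in> {\<gamma>1, \<gamma>2}"
  shows "t\<^sup>2 * (reg_q \<gamma>' xp - reg_q 0 xs) + 4 * \<zeta> * inner (zp - xs) (zp - xs)
    \<le> (t\<^sup>2 - t) * (reg_q \<gamma>' x - reg_q 0 xs) + 4 * \<zeta> * inner (z - xs) (z - xs)"
proof -
  have g12: "\<gamma>1 < \<gamma>2" using br by (simp add: bracket_def)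
  have eta0: "0 < eta" unfolding eta using t zeta_ge1 by simp
  have den0: "0 \<le> den" unfolding den using eta0 by simp
  have D: "inner y (B1 y) + 2 * inner \<beta>1 y + c1 + 2 * inner Q (zp - y) = num - \<gamma> * den"
  proof -
    have "inner y Q = inner y (B1 y) + inner \<beta>1 y" by (simp add: Q inner_add_right inner_commute)
    moreover have "inner Q (zp - y) = inner Q z - inner Q y - eta * (inner Q P + \<gamma> * inner Q Q)"
      by (simp add: zp inner_diff_right inner_add_right)
    ultimately show ?thesis unfolding num den by (simp add: inner_commute[of y \<beta>1] algebra_simps)
  qed
  have \<gamma>12: "\<gamma>1 \<le> \<gamma> \<and> \<gamma> \<le> \<gamma>2 \<and> (\<gamma>1 - \<gamma>) * (num - \<gamma> * den) \<le> 0 \<and> (\<gamma>2 - \<gamma>) * (num - \<gamma> * den) \<le> 0"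
  proof (cases "0 < num - \<gamma>2 * den")
    case True
    then show ?thesis using g12 \<gamma> by (simp add: mult_nonpos_nonneg)
  next
    case F1: False
    show ?thesis
    proof (cases "0 < num - \<gamma>1 * den")
      case True
      \<comment> \<open>The slope differs at the two ends, so \<open>den\<close> is nonzero and the
        division is safe.\<close>
      then have "\<gamma>1 * den < \<gamma>2 * den" using F1 by linarith
      then have d: "0 < den" using den0 by (cases "den = 0") auto
      have "\<gamma> = num / den" using \<gamma> F1 True by simp
      moreover have "\<gamma>1 < num / den" "num / den \<le> \<gamma>2"
        using d True F1 by (simp_all add: pos_less_divide_eq pos_divide_le_eq)
      ultimately show ?thesis using d by simp
    next
      case False
      then show ?thesis using F1 g12 \<gamma> by (simp add: mult_nonneg_nonpos)
    qed
  qed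
  have s: "reg_q \<gamma> xs = reg_q 0 xs" using xs by (simp add: reg_q_def q1_def)
  have eta': "eta = t / (4 * \<zeta>)" by (simp add: eta)
  have opt: "(\<gamma>' - \<gamma>) * (inner y (B1 y) + 2 * inner \<beta>1 y + c1 + 2 * inner Q (zp - y)) \<le> 0"
    unfolding D using \<gamma>' \<gamma>12 by auto
  have "\<gamma>1 \<le> \<gamma>'" "\<gamma>' \<le> \<gamma>2" using \<gamma>' g12 by auto
  from accelerated_step[OF sa0 sa1 bracket_psd(1)[OF br] bracket_psd(2)[OF br] _ t y P Q _ _ zp[unfolded eta'] xp opt this,
      of c0 xs]
  show ?thesis using \<gamma>12 zeta_ge1 unfolding reg_q_def[symmetric] s by simp
qed

lemma wx_gradient:
  assumes \<sigma>: "prepared \<sigma>"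
    and Q: "\<And>\<sigma>'. same {26, 27, 31, 32, 34} {12, 13, 14} \<sigma> \<sigma>' \<Longrightarrow> dr \<sigma>' = dr \<sigma> \<Longrightarrow>
      R \<sigma>' 31 = (sqrt (R \<sigma> 30 * R \<sigma> 30 * 4 + 1) + 1) / 2 \<Longrightarrow> R \<sigma>' 32 = 1 / R \<sigma>' 31 \<Longrightarrow>
      R \<sigma>' 34 = R \<sigma>' 31 * (1 / (4 * \<zeta>)) \<Longrightarrow>
      V \<sigma>' 12 = V \<sigma> 10 + (1 / R \<sigma>' 31) *\<^sub>R (V \<sigma> 11 - V \<sigma> 10) \<Longrightarrow>
      V \<sigma>' 13 = B0 (V \<sigma>' 12) + sg *\<^sub>R V \<sigma>' 12 + \<beta>0 \<Longrightarrow> V \<sigma>' 14 = B1 (V \<sigma>' 12) + \<beta>1 \<Longrightarrow> Q \<sigma>'"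
  shows "wx \<omega> gradient_code 18 Q \<sigma>"
  unfolding gradient_code_def
  apply (rule wx_mono)
    apply (rule wx_Seq, rule wx_prims; (use \<sigma> in \<open>simp add: prepared_def prepared0_def\<close>)?)+
    apply (rule wx_prims)
       apply simp
      apply simp
     apply simp
    apply (rule Q)
           apply (use \<sigma> in \<open>simp_all add: same_def prepared_def prepared0_def\<close>)
  done

lemma wx_choose:
  assumes z: "R \<sigma> 7 = 0"
    and Q: "\<And>\<sigma>'. same {36} {} \<sigma> \<sigma>' \<Longrightarrow> dr \<sigma>' = dr \<sigma> \<Longrightarrow>
      R \<sigma>' 36 = (if 0 < R \<sigma> 26 then R \<sigma> 29 else if 0 < R \<sigma> 27 then R \<sigma> 33 / R \<sigma> 35 else R \<sigma> 28) \<Longrightarrow> Q \<sigma>'"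
  shows "wx \<omega> choose_code (1 + 1 + 1) Q \<sigma>"
  unfolding choose_code_def
proof (rule wx_sCond)
  assume p: "0 < R \<sigma> 26"
  show "wx \<omega> (sAdd 36 29 7 ;; sAdd 36 29 7) (1 + 1) Q \<sigma>"
    by (rule wx_Seq, rule wx_prims, rule wx_prims, rule Q) (use z p in \<open>simp_all add: same_def\<close>)
next
  assume p: "R \<sigma> 26 \<le> 0"
  show "wx \<omega> (sCond 27 (sDiv 36 33 35) (sAdd 36 28 7)) (1 + 1) Q \<sigma>"
  proof (rule wx_sCond)
    assume "0 < R \<sigma> 27"
    then show "wx \<omega> (sDiv 36 33 35) 1 Q \<sigma>" using p by (intro wx_prims Q) (simp_all add: same_def)
  next
    assume "R \<sigma> 27 \<le> 0"
    then show "wx \<omega> (sAdd 36 28 7) 1 Q \<sigma>" using p z by (intro wx_prims Q) (simp_all add: same_def)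
  qed
qed

lemma wx_slope:
  assumes \<sigma>: "prepared \<sigma>"
    and num: "num = inner (V \<sigma> 12) (V \<sigma> 14) + inner (V \<sigma> 12) \<beta>1 + c1
        + (inner (V \<sigma> 14) (V \<sigma> 11) - inner (V \<sigma> 14) (V \<sigma> 12) - inner (V \<sigma> 14) (V \<sigma> 13) * R \<sigma> 34) * 2"
    and den: "den = inner (V \<sigma> 14) (V \<sigma> 14) * R \<sigma> 34 * 2"
    and Q: "\<And>\<sigma>'. same {26, 27, 33, 35, 36} {} \<sigma> \<sigma>' \<Longrightarrow> dr \<sigma>' = dr \<sigma> \<Longrightarrow>
      R \<sigma>' 36 = (if 0 < num - R \<sigma> 29 * den then R \<sigma> 29
        else if 0 < num - R \<sigma> 28 * den then num / den else R \<sigma> 28) \<Longrightarrow> Q \<sigma>'"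
  shows "wx \<omega> (slope_code ;; choose_code) 22 Q \<sigma>"
proof -
  have ch: "wx \<omega> choose_code (1 + 1 + 1) Q \<sigma>1"
    if "same {26, 27, 33, 35} {} \<sigma> \<sigma>1" "dr \<sigma>1 = dr \<sigma>" "R \<sigma>1 33 = num" "R \<sigma>1 35 = den"
      "R \<sigma>1 26 = num - R \<sigma> 29 * den" "R \<sigma>1 27 = num - R \<sigma> 28 * den" for \<sigma>1
  proof (rule wx_choose)
    show "R \<sigma>1 7 = 0" using that \<sigma> by (simp add: same_def prepared_def prepared0_def)
  qed (rule Q, use that in \<open>simp_all add: same_def\<close>)
  show ?thesis
    apply (rule wx_mono)
      apply (rule wx_Seq)
      apply (unfold slope_code_def)
      apply (rule wx_Seq, rule wx_prims; (use \<sigma> in \<open>simp add: prepared_def prepared0_def\<close>)?)+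
      apply (rule wx_prims, rule ch)
           apply (use \<sigma> in \<open>simp_all add: same_def prepared_def prepared0_def num den\<close>)
    done
qed

lemma wx_prox:
  assumes \<sigma>: "prepared \<sigma>"
    and Q: "\<And>\<sigma>'. same {24, 26, 30} {6, 10, 11} \<sigma> \<sigma>' \<Longrightarrow> dr \<sigma>' = dr \<sigma> \<Longrightarrow>
      V \<sigma>' 11 = V \<sigma> 11 - R \<sigma> 34 *\<^sub>R (V \<sigma> 13 + R \<sigma> 36 *\<^sub>R V \<sigma> 14) \<Longrightarrow>
      V \<sigma>' 10 = V \<sigma> 10 + R \<sigma> 32 *\<^sub>R (V \<sigma>' 11 - V \<sigma> 10) \<Longrightarrow> R \<sigma>' 30 = R \<sigma> 31 \<Longrightarrow>
      R \<sigma>' 24 = budget - R \<sigma> 31 * R \<sigma> 31 * \<epsilon> \<Longrightarrow> Q \<sigma>'"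
  shows "wx \<omega> prox_code 9 Q \<sigma>"
  unfolding prox_code_def
  apply (rule wx_mono)
    apply (rule wx_Seq, rule wx_prims; (use \<sigma> in \<open>simp add: prepared_def prepared0_def\<close>)?)+
    apply (rule wx_prims, rule Q)
         apply (use \<sigma> in \<open>simp_all add: same_def prepared_def prepared0_def\<close>)
  done

text \<open>The potential of the accelerated method, for both multipliers. It holds initially with
  equality because the momentum and the starting vector are zero.\<close>

definition "descent_ok \<gamma>1 \<gamma>2 xs m x z \<longleftrightarrow> (\<forall>\<gamma>'\<in>{\<gamma>1, \<gamma>2}.
    (momentum m)\<^sup>2 * (reg_q \<gamma>' x - reg_q 0 xs) + 4 * \<zeta> * inner (z - xs) (z - xs) \<le> 4 * \<zeta> * inner xs xs)"

text \<open>\<open>bracket\<close> guards only the conclusion: on unlucky samples the multipliers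
  may be useless, and the loop must still end in time.\<close>

lemma wx_descent:
  assumes \<sigma>: "prepared \<sigma>" and xs: "q1 xs = 0"
    and Q: "\<And>\<sigma>'. same {24, 26, 27, 30, 31, 32, 33, 34, 35, 36} {6, 10, 11, 12, 13, 14} \<sigma> \<sigma>' \<Longrightarrow> dr \<sigma>' = dr \<sigma> \<Longrightarrow>
      (bracket (R \<sigma> 28) (R \<sigma> 29) \<Longrightarrow> descent_ok (R \<sigma> 28) (R \<sigma> 29) xs rounds (V \<sigma>' 10) (V \<sigma>' 11)) \<Longrightarrow> Q \<sigma>'"
  shows "wx \<omega> descent_code (rounds * 50 + 5) Q \<sigma>"
proof -
  let ?J = "{24, 26, 27, 30, 31, 32, 33, 34, 35, 36} :: nat set" and ?S = "{6, 10, 11, 12, 13, 14} :: nat set"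
  let ?g1 = "R \<sigma> 28" and ?g2 = "R \<sigma> 29"
  define I where "I = (\<lambda>i \<sigma>'. same ?J ?S \<sigma> \<sigma>' \<and> dr \<sigma>' = dr \<sigma> \<and> R \<sigma>' 30 = momentum i \<and>
     R \<sigma>' 24 = budget - momentum i * momentum i * \<epsilon> \<and>
     (bracket ?g1 ?g2 \<longrightarrow> descent_ok ?g1 ?g2 xs i (V \<sigma>' 10) (V \<sigma>' 11)))"
  have prep: "prepared \<sigma>'" if "same ?J ?S \<sigma> \<sigma>'" for \<sigma>'
    using same_prepared[OF that \<sigma>] by simp
  have loop: "wx \<omega> (sWhile 24 (gradient_code ;; (slope_code ;; choose_code) ;; prox_code)) (rounds * (49 + 1) + 1) Q \<sigma>0"
    if "I 0 \<sigma>0" for \<sigma>0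
  proof (rule wx_sWhile[where I = I, OF that])
    fix i \<sigma>1 assume i: "i < rounds" and I: "I i \<sigma>1"
    have s1: "same ?J ?S \<sigma> \<sigma>1" using I by (simp add: I_def)
    have "wx \<omega> (gradient_code ;; (slope_code ;; choose_code) ;; prox_code) (18 + (22 + 9)) (I (Suc i)) \<sigma>1"
    proof (rule wx_Seq, rule wx_gradient[OF prep[OF s1]])
      fix \<sigma>2 assume a2: "same {26, 27, 31, 32, 34} {12, 13, 14} \<sigma>1 \<sigma>2" "dr \<sigma>2 = dr \<sigma>1"
        "R \<sigma>2 31 = (sqrt (R \<sigma>1 30 * R \<sigma>1 30 * 4 + 1) + 1) / 2" "R \<sigma>2 32 = 1 / R \<sigma>2 31"
        "R \<sigma>2 34 = R \<sigma>2 31 * (1 / (4 * \<zeta>))"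
        "V \<sigma>2 12 = V \<sigma>1 10 + (1 / R \<sigma>2 31) *\<^sub>R (V \<sigma>1 11 - V \<sigma>1 10)"
        "V \<sigma>2 13 = B0 (V \<sigma>2 12) + sg *\<^sub>R V \<sigma>2 12 + \<beta>0" "V \<sigma>2 14 = B1 (V \<sigma>2 12) + \<beta>1"
      have s2: "same ?J ?S \<sigma> \<sigma>2" using s1 a2(1) by (simp add: same_def)
      define num where "num = inner (V \<sigma>2 12) (V \<sigma>2 14) + inner (V \<sigma>2 12) \<beta>1 + c1
        + (inner (V \<sigma>2 14) (V \<sigma>2 11) - inner (V \<sigma>2 14) (V \<sigma>2 12) - inner (V \<sigma>2 14) (V \<sigma>2 13) * R \<sigma>2 34) * 2"
      define den where "den = inner (V \<sigma>2 14) (V \<sigma>2 14) * R \<sigma>2 34 * 2"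
      show "wx \<omega> ((slope_code ;; choose_code) ;; prox_code) (22 + 9) (I (Suc i)) \<sigma>2"
      proof (rule wx_Seq, rule wx_slope[OF prep[OF s2] num_def den_def])
        fix \<sigma>3 assume a3: "same {26, 27, 33, 35, 36} {} \<sigma>2 \<sigma>3" "dr \<sigma>3 = dr \<sigma>2"
          "R \<sigma>3 36 = (if 0 < num - R \<sigma>2 29 * den then R \<sigma>2 29
            else if 0 < num - R \<sigma>2 28 * den then num / den else R \<sigma>2 28)"
        have s3: "same ?J ?S \<sigma> \<sigma>3" using s2 a3(1) by (simp add: same_def)
        have v3: "V \<sigma>3 = V \<sigma>2" "R \<sigma>3 31 = R \<sigma>2 31" "R \<sigma>3 32 = R \<sigma>2 32" "R \<sigma>3 34 = R \<sigma>2 34"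
          using a3(1) by (auto simp: same_def)
        have v2: "V \<sigma>2 10 = V \<sigma>1 10" "V \<sigma>2 11 = V \<sigma>1 11" using a2(1) by (simp_all add: same_def)
        have g2: "R \<sigma>2 28 = ?g1" "R \<sigma>2 29 = ?g2" using s2 by (simp_all add: same_def)
        have t: "R \<sigma>2 31 = momentum (Suc i)" using a2(3) I by (simp add: I_def)
        show "wx \<omega> prox_code 9 (I (Suc i)) \<sigma>3"
        proof (rule wx_prox[OF prep[OF s3]])
          fix \<sigma>4 assume a4: "same {24, 26, 30} {6, 10, 11} \<sigma>3 \<sigma>4" "dr \<sigma>4 = dr \<sigma>3"
            "V \<sigma>4 11 = V \<sigma>3 11 - R \<sigma>3 34 *\<^sub>R (V \<sigma>3 13 + R \<sigma>3 36 *\<^sub>R V \<sigma>3 14)"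
            "V \<sigma>4 10 = V \<sigma>3 10 + R \<sigma>3 32 *\<^sub>R (V \<sigma>4 11 - V \<sigma>3 10)" "R \<sigma>4 30 = R \<sigma>3 31"
            "R \<sigma>4 24 = budget - R \<sigma>3 31 * R \<sigma>3 31 * \<epsilon>"
          have "same ?J ?S \<sigma> \<sigma>4" using s3 a4(1) by (simp add: same_def)
          moreover have "descent_ok ?g1 ?g2 xs (Suc i) (V \<sigma>4 10) (V \<sigma>4 11)" if br: "bracket ?g1 ?g2"
            unfolding descent_ok_def
          proof
            fix \<gamma>' assume \<gamma>': "\<gamma>' \<in> {?g1, ?g2}"
            have "(momentum (Suc i))\<^sup>2 * (reg_q \<gamma>' (V \<sigma>4 10) - reg_q 0 xs) + 4 * \<zeta> * inner (V \<sigma>4 11 - xs) (V \<sigma>4 11 - xs)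
              \<le> ((momentum (Suc i))\<^sup>2 - momentum (Suc i)) * (reg_q \<gamma>' (V \<sigma>1 10) - reg_q 0 xs)
                + 4 * \<zeta> * inner (V \<sigma>1 11 - xs) (V \<sigma>1 11 - xs)"
              by (rule descent_step[OF br momentum_ge1 _ _ _ _ num_def[unfolded v2] den_def _ _ _ xs \<gamma>'])
                (use a2 a3 a4 in \<open>simp_all only: v3 v2 g2 t\<close>)
            also have "\<dots> \<le> 4 * \<zeta> * inner xs xs"
              unfolding momentum_square using I br \<gamma>' by (auto simp: I_def descent_ok_def)
            finally show "(momentum (Suc i))\<^sup>2 * (reg_q \<gamma>' (V \<sigma>4 10) - reg_q 0 xs)
              + 4 * \<zeta> * inner (V \<sigma>4 11 - xs) (V \<sigma>4 11 - xs) \<le> 4 * \<zeta> * inner xs xs" .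
          qed
          moreover have "dr \<sigma>4 = dr \<sigma>" using a4 a3 a2 I by (simp add: I_def)
          moreover have "R \<sigma>4 30 = momentum (Suc i)" "R \<sigma>4 24 = budget - momentum (Suc i) * momentum (Suc i) * \<epsilon>"
            using a4(5,6) unfolding v3 t by simp_all
          ultimately show "I (Suc i) \<sigma>4" unfolding I_def by blast
        qed
      qed
    qed
    then have "wx \<omega> (gradient_code ;; (slope_code ;; choose_code) ;; prox_code) 49 (I (Suc i)) \<sigma>1" by simp
    then show "0 < R \<sigma>1 24 \<and> wx \<omega> (gradient_code ;; (slope_code ;; choose_code) ;; prox_code) 49 (I (Suc i)) \<sigma>1"
      using rounds_less[OF i] I by (simp add: I_def)
  next
    fix \<sigma>' assume I: "I rounds \<sigma>'"
    have "Q \<sigma>'" by (rule Q) (use I in \<open>simp_all add: I_def\<close>)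
    then show "R \<sigma>' 24 \<le> 0 \<and> Q \<sigma>'" using I rounds_spec by (simp add: I_def)
  qed
  show ?thesis unfolding descent_code_def
    apply (rule wx_mono)
      apply (rule wx_Seq, rule wx_prims; (use \<sigma> in \<open>simp add: prepared_def prepared0_def\<close>)?)+
      apply (rule loop)
      apply (use \<sigma> in \<open>simp_all add: I_def same_def prepared_def prepared0_def descent_ok_def\<close>)
    done
qed

text \<open>One half of \<epsilon> covers the gap of the method, 144 \<zeta> \<kappa>^2 against a
  final weight of at least 288 \<zeta> \<kappa>^2 / \<epsilon>; the other half covers the
  regularization at \<open>xs\<close>.\<close>

lemma descent_value:
  assumes ok: "descent_ok \<gamma>1 \<gamma>2 xs rounds x z" and xs: "q1 xs = 0" "inner xs xs \<le> (6 * \<kappa>)\<^sup>2"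
    and \<gamma>: "\<gamma> \<in> {\<gamma>1, \<gamma>2}"
  shows "q0 x + \<gamma> * q1 x \<le> q0 xs + \<epsilon>"
proof -
  define M where "M = momentum rounds * momentum rounds"
  define e where "e = reg_q \<gamma> x - reg_q 0 xs"
  have zp: "0 < \<zeta>" using zeta_ge1 by simp
  have k1: "0 < \<kappa> * \<kappa>" using kappa_ge1 by simp
  have kk: "0 < \<zeta> * (\<kappa> * \<kappa>)" using zp k1 by simp
  have "M * e + 4 * \<zeta> * inner (z - xs) (z - xs) \<le> 4 * \<zeta> * inner xs xs"
    using ok \<gamma> unfolding descent_ok_def M_def e_def power2_eq_square by blast
  moreover have "0 \<le> 4 * \<zeta> * inner (z - xs) (z - xs)" using zp by simp
  moreover have "4 * \<zeta> * inner xs xs \<le> 4 * \<zeta> * (36 * (\<kappa> * \<kappa>))"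
    using xs(2) zp by (intro mult_left_mono) (auto simp: power2_eq_square)
  ultimately have 1: "M * e \<le> 144 * (\<zeta> * (\<kappa> * \<kappa>))" by simp
  have 2: "288 * (\<zeta> * (\<kappa> * \<kappa>)) \<le> M * \<epsilon>" using rounds_spec by (simp add: budget_def M_def mult.assoc)
  have M: "0 < M" using 2 kk eps0 by (smt (verit) mult_nonpos_nonneg)
  have "M * e \<le> M * (\<epsilon> / 2)" using 1 2 by simp
  then have e: "e \<le> \<epsilon> / 2" using M by simp
  have s: "sg * inner xs xs \<le> \<epsilon> / 2"
  proof -
    have "sg * inner xs xs \<le> sg * (36 * (\<kappa> * \<kappa>))"
      using xs(2) sg_pos by (intro mult_left_mono) (auto simp: power2_eq_square)
    also have "\<dots> = \<epsilon> / (2 * \<kappa>)" unfolding sg_def using kappa_ge1 by (simp add: field_simps)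
    also have "\<dots> \<le> \<epsilon> / (2 * 1)" using kappa_ge1 eps0 by (intro divide_left_mono) auto
    finally show ?thesis by simp
  qed
  have "q0 x + \<gamma> * q1 x \<le> reg_q \<gamma> x" using sg_pos by (simp add: reg_q_def q0_def q1_def)
  also have "\<dots> = reg_q 0 xs + e" by (simp add: e_def)
  also have "\<dots> = q0 xs + sg * inner xs xs + e" by (simp add: reg_q_def q0_def)
  finally show ?thesis using e s by simp
qed

text \<open>By \<open>a * q1 x \<le> 0\<close> both roots are real and their product q1(x) / a is
  nonpositive, so one of them satisfies r g \<le> 0. Along it neither the linear nor the quadratic
  term of the combined function is positive, and at a root of q1 this function equals q0.\<close>

lemma root_correct:
  assumes a: "a = inner v (B1 v)" "a \<noteq> 0" and b: "b = inner v (B1 x + \<beta>1)" and q: "a * q1 x \<le> 0"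
    and g: "g = inner v (B0 x + \<beta>0) + \<gamma> * b" and f: "form \<gamma> v \<le> 0"
    and sq: "sq = sqrt (b * b - a * q1 x)" and r1: "r1 = - (b + sq) / a" and r2: "r2 = (sq - b) / a"
    and r: "r = (if 0 < r1 * g then r2 else r1)"
  shows "q1 (x + r *\<^sub>R v) = 0" "q0 (x + r *\<^sub>R v) \<le> q0 x + \<gamma> * q1 x"
proof -
  have "0 \<le> b * b - a * q1 x" using q by (smt (verit) zero_le_square)
  then have sq2: "sq * sq = b * b - a * q1 x" by (simp add: sq)
  have e1: "q1 (x + t *\<^sub>R v) = q1 x + 2 * t * b + t * t * a" for t
    using selfadjoint_swap[OF sa1, of x v]
    by (simp add: q1_def a b selfadjoint_simps[OF sa1] inner_add_left inner_add_right
        inner_commute[of v] algebra_simps)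
  have e0: "q0 (x + t *\<^sub>R v) + \<gamma> * q1 (x + t *\<^sub>R v) = q0 x + \<gamma> * q1 x + 2 * (t * g) + t * t * form \<gamma> v" for t
  proof -
    have "q0 (x + t *\<^sub>R v) = q0 x + 2 * t * inner v (B0 x + \<beta>0) + t * t * inner v (B0 v)"
      using selfadjoint_swap[OF sa0, of x v]
      by (simp add: q0_def selfadjoint_simps[OF sa0] inner_add_left inner_add_right
          inner_commute[of v] algebra_simps)
    then show ?thesis unfolding e1 form_def g a(1) by (simp add: algebra_simps)
  qed
  have ar: "a * r1 + b = - sq" "a * r2 + b = sq" using a(2) by (simp_all add: r1 r2)
  have root: "q1 (x + t *\<^sub>R v) = 0" if "(a * t + b) * (a * t + b) = sq * sq" for t
  proof -
    have "a * (q1 x + 2 * t * b + t * t * a) = (a * t + b) * (a * t + b) - (b * b - a * q1 x)"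
      by (simp add: algebra_simps)
    also have "\<dots> = 0" using that sq2 by simp
    finally show ?thesis using a(2) by (simp add: e1)
  qed
  have "(a * r + b) * (a * r + b) = sq * sq" using ar by (auto simp: r)
  then show q: "q1 (x + r *\<^sub>R v) = 0" by (rule root)
  have "(a * a) * (r1 * r2) = (a * r1) * (a * r2)" by (simp add: algebra_simps)
  also have "\<dots> = (- sq - b) * (sq - b)" using ar by (metis add_diff_cancel_right')
  also have "\<dots> = a * q1 x" using sq2 by (simp add: algebra_simps)
  also have "\<dots> \<le> 0" by (rule assms(4))
  finally have "(a * a) * (r1 * r2) \<le> 0" .
  moreover have "0 < a * a" using a(2) by (cases "0 < a") (auto simp: zero_less_mult_iff)
  ultimately have r12: "r1 * r2 \<le> 0" by (smt (verit) mult_pos_pos)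
  have rg: "r * g \<le> 0"
  proof (cases "0 < r1 * g")
    case True
    have "(r1 * g) * (r2 * g) = (r1 * r2) * (g * g)" by (simp add: algebra_simps)
    also have "\<dots> \<le> 0" by (rule mult_nonpos_nonneg[OF r12 zero_le_square])
    finally have "r2 * g \<le> 0" using True by (smt (verit) mult_pos_pos)
    then show ?thesis using True r by simp
  qed (use r in auto)
  have "r * r * form \<gamma> v \<le> 0" using f by (intro mult_nonneg_nonpos) auto
  then show "q0 (x + r *\<^sub>R v) \<le> q0 x + \<gamma> * q1 x" using e0[of r] rg q by simp
qed

lemma wx_round:
  assumes \<sigma>: "prepared \<sigma>"
    and Q: "\<And>\<sigma>'. same {26, 33, 36} {4, 6, 13, 14} \<sigma> \<sigma>' \<Longrightarrow> V \<sigma>' 14 = B1 (V \<sigma> 10) + \<beta>1 \<Longrightarrow>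
      V \<sigma>' 13 = B0 (V \<sigma> 10) + \<beta>0 \<Longrightarrow> R \<sigma>' 33 = q1 (V \<sigma> 10) \<Longrightarrow>
      V \<sigma>' 6 = (if 0 < q1 (V \<sigma> 10) then V \<sigma> 9 else V \<sigma> 8) \<Longrightarrow>
      R \<sigma>' 36 = (if 0 < q1 (V \<sigma> 10) then R \<sigma> 29 else R \<sigma> 28) \<Longrightarrow> Q \<sigma>'"
  shows "wx \<omega> round_code 13 Q \<sigma>"
proof -
  have ch: "wx \<omega> (sCond 33 (vLin 6 8 9 7 9 ;; sAdd 36 29 7) (vLin 6 8 8 7 8 ;; sAdd 36 28 7)) (1 + 1 + 1) Q \<sigma>1"
    if s1: "same {26, 33} {4, 13, 14} \<sigma> \<sigma>1" "V \<sigma>1 14 = B1 (V \<sigma> 10) + \<beta>1"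
      "V \<sigma>1 13 = B0 (V \<sigma> 10) + \<beta>0" "R \<sigma>1 33 = q1 (V \<sigma> 10)" for \<sigma>1
  proof (rule wx_sCond)
    have c: "R \<sigma>1 7 = 0" "R \<sigma>1 8 = 1" using s1 \<sigma> by (simp_all add: same_def prepared_def prepared0_def)
    { assume p: "0 < R \<sigma>1 33"
      show "wx \<omega> (vLin 6 8 9 7 9 ;; sAdd 36 29 7) (1 + 1) Q \<sigma>1"
        apply (rule wx_Seq, rule wx_vLin)
           apply (simp_all add: c del: One_nat_def)
        apply (rule wx_prims, rule Q)
             apply (use s1 p c in \<open>simp_all add: same_def\<close>)
        done }
    { assume p: "R \<sigma>1 33 \<le> 0"
      show "wx \<omega> (vLin 6 8 8 7 8 ;; sAdd 36 28 7) (1 + 1) Q \<sigma>1"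
        apply (rule wx_Seq, rule wx_vLin)
           apply (simp_all add: c del: One_nat_def)
        apply (rule wx_prims, rule Q)
             apply (use s1 p c in \<open>simp_all add: same_def\<close>)
        done }
  qed
  show ?thesis unfolding round_code_def
    apply (rule wx_mono)
      apply (rule wx_Seq, rule wx_prims; (use \<sigma> in \<open>simp add: prepared_def prepared0_def\<close>)?)+
      apply (rule ch)
         apply (use \<sigma> in \<open>simp_all add: same_def prepared_def prepared0_def q1_def inner_add_right inner_commute\<close>)
    done
qed

lemma wx_root:
  assumes \<sigma>: "prepared \<sigma>"
    and a: "a = inner (V \<sigma> 6) (B1 (V \<sigma> 6))" and b: "b = inner (V \<sigma> 6) (V \<sigma> 14)"
    and g: "g = inner (V \<sigma> 6) (V \<sigma> 13) + R \<sigma> 36 * b"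
    and sq: "sq = sqrt (b * b - a * R \<sigma> 33)" and r1: "r1 = - (b + sq) / a" and r2: "r2 = (sq - b) / a"
    and Q: "\<And>\<sigma>'. V \<sigma>' 15 = V \<sigma> 10 + (if 0 < r1 * g then r2 else r1) *\<^sub>R V \<sigma> 6 \<Longrightarrow> Q \<sigma>'"
  shows "wx \<omega> root_code 20 Q \<sigma>"
proof -
  have c: "R \<sigma> 7 = 0" "R \<sigma> 8 = 1" using \<sigma> by (simp_all add: prepared_def prepared0_def)
  have fin: "wx \<omega> (sCond 24 (sAdd 27 26 7) (sAdd 27 27 7) ;; vLin 15 8 10 27 6) (1 + 1 + 1) Q \<sigma>1"
    if s1: "same {24, 26, 27, 35, 37, 38} {4} \<sigma> \<sigma>1" "R \<sigma>1 24 = r1 * g" "R \<sigma>1 26 = r2" "R \<sigma>1 27 = r1" for \<sigma>1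
  proof (rule wx_Seq, rule wx_sCond)
    have c1: "R \<sigma>1 7 = 0" "R \<sigma>1 8 = 1" "V \<sigma>1 10 = V \<sigma> 10" "V \<sigma>1 6 = V \<sigma> 6" using s1 c by (simp_all add: same_def)
    { assume p: "0 < R \<sigma>1 24"
      show "wx \<omega> (sAdd 27 26 7) 1 (\<lambda>\<sigma>. wx \<omega> (vLin 15 8 10 27 6) 1 Q \<sigma>) \<sigma>1"
        apply (rule wx_prims, rule wx_vLin)
           apply (simp_all del: One_nat_def)
        apply (rule Q)
        apply (use s1 p c1 in simp)
        done }
    { assume p: "R \<sigma>1 24 \<le> 0"
      show "wx \<omega> (sAdd 27 27 7) 1 (\<lambda>\<sigma>. wx \<omega> (vLin 15 8 10 27 6) 1 Q \<sigma>) \<sigma>1"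
        apply (rule wx_prims, rule wx_vLin)
           apply (simp_all del: One_nat_def)
        apply (rule Q)
        apply (use s1 p c1 in simp)
        done }
  qed
  show ?thesis unfolding root_code_def
    apply (rule wx_mono)
      apply (rule wx_Seq, rule wx_prims; (simp add: c a[symmetric] b[symmetric] g[symmetric] sq[symmetric])?)+
      apply (rule fin)
         apply (use c in \<open>simp_all add: same_def a b g sq r1 r2\<close>)
    done
qed

text \<open>The right bisection consumes the first \<open>steps * n\<close> samples, the left one
  those that follow.\<close>

definition "lucky \<omega> \<longleftrightarrow>
   (\<forall>j<steps. \<not> unlucky (2 * \<zeta>) (test_path (outcome (2 * \<zeta>)) n 0 \<omega> j) (\<lambda>i. \<omega> (0 + j * n + i))) \<and>
   (\<forall>j<steps. \<not> unlucky (- \<zeta>) (test_path (outcome (- \<zeta>)) n (steps * n) \<omega> j) (\<lambda>i. \<omega> (steps * n + j * n + i)))"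

definition "main_time = steps * (iters * 38 + 42) + rounds * 50 + 90"

lemma wx_main:
  assumes \<sigma>: "R \<sigma> 0 = \<xi>" "R \<sigma> 1 = \<zeta>" "R \<sigma> 2 = \<gamma>h" "R \<sigma> 3 = \<epsilon>" "R \<sigma> 4 = p" "R \<sigma> 5 = c0" "R \<sigma> 6 = c1"
      "R \<sigma> 7 = 0" "R \<sigma> 13 = 0" "V \<sigma> 0 = \<beta>0" "V \<sigma> 1 = \<beta>1" "dr \<sigma> = 0"
  shows "wx \<omega> main_code main_time (\<lambda>\<sigma>'. lucky \<omega> \<longrightarrow>
      q1 (V \<sigma>' 15) = 0 \<and> q0 (V \<sigma>' 15) \<le> Opt n A0 A1 b0 b1 c0 c1 + \<epsilon>) \<sigma>" (is "wx _ _ _ ?Q _")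
proof -
  obtain xs where xs: "q1 xs = 0" "q0 xs = Opt n A0 A1 b0 b1 c0 c1" "inner xs xs \<le> (6 * \<kappa>)\<^sup>2"
    using optimal_point by blast
  let ?J = "{20, 21, 22, 23, 24, 25, 26} :: nat set"
  let ?side = "steps * (iters * 19 + 19) + 3"
  \<comment> \<open>The program is treated from its end, since the triple of a prefix refers to
    everything that follows.\<close>
  have last: "wx \<omega> (descent_code ;; round_code ;; root_code) (rounds * 50 + 5 + (13 + 20)) ?Q \<sigma>1"
    if p1: "prepared \<sigma>1"
      and br: "lucky \<omega> \<Longrightarrow> bracket (R \<sigma>1 28) (R \<sigma>1 29) \<and> R \<sigma>1 28 < \<gamma>h \<and> \<gamma>h < R \<sigma>1 29 \<and>
        form (R \<sigma>1 28) (V \<sigma>1 8) < 0 \<and> form (R \<sigma>1 29) (V \<sigma>1 9) < 0" for \<sigma>1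
  proof (rule wx_in_dim, rule wx_Seq, rule wx_descent[OF p1 xs(1)])
    fix \<sigma>2 assume dim: "\<And>k. k < 20 \<Longrightarrow> in_dim n (V \<sigma>1 k)"
      and s2: "same {24, 26, 27, 30, 31, 32, 33, 34, 35, 36} {6, 10, 11, 12, 13, 14} \<sigma>1 \<sigma>2"
      and ok: "bracket (R \<sigma>1 28) (R \<sigma>1 29) \<Longrightarrow> descent_ok (R \<sigma>1 28) (R \<sigma>1 29) xs rounds (V \<sigma>2 10) (V \<sigma>2 11)"
    have p2: "prepared \<sigma>2" using same_prepared[OF s2 p1] by simp
    have e2: "R \<sigma>2 28 = R \<sigma>1 28" "R \<sigma>2 29 = R \<sigma>1 29" "V \<sigma>2 8 = V \<sigma>1 8" "V \<sigma>2 9 = V \<sigma>1 9"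
      using s2 by (simp_all add: same_def)
    show "wx \<omega> (round_code ;; root_code) (13 + 20) ?Q \<sigma>2"
    proof (rule wx_Seq, rule wx_round[OF p2])
      fix \<sigma>3 assume a3: "same {26, 33, 36} {4, 6, 13, 14} \<sigma>2 \<sigma>3" "V \<sigma>3 14 = B1 (V \<sigma>2 10) + \<beta>1"
        "V \<sigma>3 13 = B0 (V \<sigma>2 10) + \<beta>0" "R \<sigma>3 33 = q1 (V \<sigma>2 10)"
        "V \<sigma>3 6 = (if 0 < q1 (V \<sigma>2 10) then V \<sigma>2 9 else V \<sigma>2 8)"
        "R \<sigma>3 36 = (if 0 < q1 (V \<sigma>2 10) then R \<sigma>2 29 else R \<sigma>2 28)"
      have p3: "prepared \<sigma>3" using same_prepared[OF a3(1) p2] by simp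
      have x3: "V \<sigma>3 10 = V \<sigma>2 10" using a3(1) by (simp add: same_def)
      define x where "x = V \<sigma>2 10"
      define v where "v = V \<sigma>3 6"
      define \<gamma> where "\<gamma> = R \<sigma>3 36"
      define a where "a = inner v (B1 v)"
      define b where "b = inner v (V \<sigma>3 14)"
      define g where "g = inner v (V \<sigma>3 13) + \<gamma> * b"
      define sq where "sq = sqrt (b * b - a * R \<sigma>3 33)"
      define r1 where "r1 = - (b + sq) / a"
      define r2 where "r2 = (sq - b) / a"
      show "wx \<omega> root_code 20 ?Q \<sigma>3"
      proof (rule wx_root[OF p3 a_def[unfolded v_def] b_def[unfolded v_def] g_def[unfolded v_def \<gamma>_def]
            sq_def r1_def r2_def], intro impI)
        fix \<sigma>4 assume o: "V \<sigma>4 15 = V \<sigma>3 10 + (if 0 < r1 * g then r2 else r1) *\<^sub>R V \<sigma>3 6" and L: "lucky \<omega>"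
        note br' = br[OF L]
        have neg: "form \<gamma> v < 0" "\<gamma> \<in> {R \<sigma>1 28, R \<sigma>1 29}" "in_dim n v"
          using br' a3(5,6) dim[of 8] dim[of 9] by (auto simp: e2 v_def \<gamma>_def)
        have "0 \<le> \<xi> * inner v v" using xi_pos by simp
        \<comment> \<open>This is the difference of the form at \<gamma>, which is negative, and at
          \<gamma>h, which is not. It fixes the sign of the A1-curvature on either side.\<close>
        then have d: "(\<gamma> - \<gamma>h) * a < 0"
          using neg(1) form_hat[OF neg(3)] by (simp add: form_def a_def algebra_simps)
        have aq: "a \<noteq> 0 \<and> a * q1 x \<le> 0"
        proof (cases "0 < q1 x")
          case True
          then have "\<gamma>h < \<gamma>" using a3(6) br' by (simp add: \<gamma>_def x_def e2)
          then have "a < 0" using d by (simp add: mult_less_0_iff)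
          then show ?thesis using True by (simp add: mult_nonpos_nonneg)
        next
          case False
          then have "\<gamma> < \<gamma>h" using a3(6) br' by (simp add: \<gamma>_def x_def e2)
          then have "0 < a" using d by (simp add: mult_less_0_iff)
          then show ?thesis using False by (simp add: mult_nonneg_nonpos)
        qed
        have b': "b = inner v (B1 x + \<beta>1)" by (simp add: b_def a3(2) x_def)
        have g': "g = inner v (B0 x + \<beta>0) + \<gamma> * b" by (simp add: g_def a3(3) x_def)
        have sq': "sq = sqrt (b * b - a * q1 x)" by (simp add: sq_def a3(4) x_def)
        have o': "V \<sigma>4 15 = x + (if 0 < r1 * g then r2 else r1) *\<^sub>R v" by (simp add: o x3 x_def v_def)
        have val: "q0 x + \<gamma> * q1 x \<le> q0 xs + \<epsilon>"
          using descent_value[OF ok xs(1,3) neg(2)] br' by (simp add: x_def)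
        show "q1 (V \<sigma>4 15) = 0 \<and> q0 (V \<sigma>4 15) \<le> Opt n A0 A1 b0 b1 c0 c1 + \<epsilon>"
          using root_correct[OF a_def conjunct1[OF aq] b' conjunct2[OF aq] g' less_imp_le[OF neg(1)] sq' r1_def r2_def refl]
            val xs(2) unfolding o' by simp
      qed
    qed
  qed
  have second: "wx \<omega> (sSub 21 7 1 ;; side_code 8 ;; sAdd 28 21 7 ;; descent_code ;; round_code ;; root_code)
      (1 + (?side + (1 + (rounds * 50 + 5 + (13 + 20))))) ?Q \<sigma>1"
    if p1: "prepared \<sigma>1" and d1: "dr \<sigma>1 = steps * n"
      and right: "lucky \<omega> \<Longrightarrow> \<gamma>h < R \<sigma>1 29 \<and> R \<sigma>1 29 \<le> 2 * \<zeta> \<and>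
        form (R \<sigma>1 29) (V \<sigma>1 9) < 0 \<and> (\<forall>h. - sg * inner h h \<le> form (R \<sigma>1 29) h)" for \<sigma>1
  proof -
    have side: "wx \<omega> (side_code 8 ;; sAdd 28 21 7 ;; descent_code ;; round_code ;; root_code)
      (?side + (1 + (rounds * 50 + 5 + (13 + 20)))) ?Q \<sigma>2"
      if s2: "same {21} {} \<sigma>1 \<sigma>2" "R \<sigma>2 21 = - \<zeta>" "dr \<sigma>2 = steps * n" for \<sigma>2
    proof (rule wx_Seq, rule wx_side[OF same_prepared[OF s2(1) p1] _ s2(2)])
      fix \<sigma>3
      let ?l = "test_path (outcome (- \<zeta>)) n (dr \<sigma>2) \<omega> steps"
      assume s3: "same ?J {2, 3, 4, 5, 6, 8} \<sigma>2 \<sigma>3"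
        and res: "let l = ?l in R \<sigma>3 21 = snd (interval (- \<zeta>) l) \<and> (\<not> True \<in> set l \<or> form (R \<sigma>3 21) (V \<sigma>3 8) < 0)"
      have s13: "same ?J {2, 3, 4, 5, 6, 8} \<sigma>1 \<sigma>3" using s2(1) s3 by (simp add: same_def)
      have p3: "prepared \<sigma>3" using same_prepared[OF s13 p1] by simp
      show "wx \<omega> (sAdd 28 21 7 ;; descent_code ;; round_code ;; root_code) (1 + (rounds * 50 + 5 + (13 + 20))) ?Q \<sigma>3"
      proof (rule wx_Seq, rule wx_scalars(2), rule last)
        show "prepared (\<sigma>3\<lparr>R := (R \<sigma>3)(28 := R \<sigma>3 21 + R \<sigma>3 7)\<rparr>)"
          using p3 by (simp add: prepared_def prepared0_def)
        assume L: "lucky \<omega>"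
        have z: "R \<sigma>3 7 = 0" using p3 by (simp add: prepared_def prepared0_def)
        have c: "R \<sigma>3 29 = R \<sigma>1 29" "V \<sigma>3 9 = V \<sigma>1 9" using s13 by (simp_all add: same_def)
        have good: "\<not> unlucky (- \<zeta>) (test_path (outcome (- \<zeta>)) n (dr \<sigma>2) \<omega> j) (\<lambda>i. \<omega> (dr \<sigma>2 + j * n + i))"
          if "j < steps" for j using L that s2(3) by (simp add: lucky_def)
        note br = bisection_result[OF good disjI2[OF refl]]
        have b: "R \<sigma>3 21 = snd (interval (- \<zeta>) ?l)" "form (R \<sigma>3 21) (V \<sigma>3 8) < 0"
          using res br(1) by (auto simp: Let_def)
        have "- \<zeta> \<le> R \<sigma>3 21 \<and> R \<sigma>3 21 < \<gamma>h" "\<forall>h. - sg * inner h h \<le> form (R \<sigma>3 21) h"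
          using br(2,4) b(1) by auto
        then show "bracket (R (\<sigma>3\<lparr>R := (R \<sigma>3)(28 := R \<sigma>3 21 + R \<sigma>3 7)\<rparr>) 28)
              (R (\<sigma>3\<lparr>R := (R \<sigma>3)(28 := R \<sigma>3 21 + R \<sigma>3 7)\<rparr>) 29) \<and>
            R (\<sigma>3\<lparr>R := (R \<sigma>3)(28 := R \<sigma>3 21 + R \<sigma>3 7)\<rparr>) 28 < \<gamma>h \<and>
            \<gamma>h < R (\<sigma>3\<lparr>R := (R \<sigma>3)(28 := R \<sigma>3 21 + R \<sigma>3 7)\<rparr>) 29 \<and>
            form (R (\<sigma>3\<lparr>R := (R \<sigma>3)(28 := R \<sigma>3 21 + R \<sigma>3 7)\<rparr>) 28) (V (\<sigma>3\<lparr>R := (R \<sigma>3)(28 := R \<sigma>3 21 + R \<sigma>3 7)\<rparr>) 8) < 0 \<and>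
            form (R (\<sigma>3\<lparr>R := (R \<sigma>3)(28 := R \<sigma>3 21 + R \<sigma>3 7)\<rparr>) 29) (V (\<sigma>3\<lparr>R := (R \<sigma>3)(28 := R \<sigma>3 21 + R \<sigma>3 7)\<rparr>) 9) < 0"
          using right[OF L] b(2) by (simp add: z c bracket_def)
      qed
    qed simp_all
    show ?thesis
      apply (rule wx_Seq, rule wx_scalars(3), rule side)
        apply (use p1 d1 in \<open>simp_all add: same_def prepared_def prepared0_def\<close>)
      done
  qed
  have first: "wx \<omega> (sMul 21 1 9 ;; side_code 9 ;; sAdd 29 21 7 ;;
      sSub 21 7 1 ;; side_code 8 ;; sAdd 28 21 7 ;; descent_code ;; round_code ;; root_code)
      (1 + (?side + (1 + (1 + (?side + (1 + (rounds * 50 + 5 + (13 + 20)))))))) ?Q \<sigma>1"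
    if p1: "prepared \<sigma>1" and d1: "dr \<sigma>1 = 0" for \<sigma>1
  proof -
    have side: "wx \<omega> (side_code 9 ;; sAdd 29 21 7 ;;
      sSub 21 7 1 ;; side_code 8 ;; sAdd 28 21 7 ;; descent_code ;; round_code ;; root_code)
      (?side + (1 + (1 + (?side + (1 + (rounds * 50 + 5 + (13 + 20))))))) ?Q \<sigma>2"
      if s2: "same {21} {} \<sigma>1 \<sigma>2" "R \<sigma>2 21 = 2 * \<zeta>" "dr \<sigma>2 = 0" for \<sigma>2
    proof (rule wx_Seq, rule wx_side[OF same_prepared[OF s2(1) p1] _ s2(2)])
      fix \<sigma>3
      let ?l = "test_path (outcome (2 * \<zeta>)) n (dr \<sigma>2) \<omega> steps"
      assume s3: "same ?J {2, 3, 4, 5, 6, 9} \<sigma>2 \<sigma>3" and d3: "dr \<sigma>3 = dr \<sigma>2 + steps * n"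
        and res: "let l = ?l in R \<sigma>3 21 = snd (interval (2 * \<zeta>) l) \<and> (\<not> True \<in> set l \<or> form (R \<sigma>3 21) (V \<sigma>3 9) < 0)"
      have s13: "same ?J {2, 3, 4, 5, 6, 9} \<sigma>1 \<sigma>3" using s2(1) s3 by (simp add: same_def)
      have p3: "prepared \<sigma>3" using same_prepared[OF s13 p1] by simp
      show "wx \<omega> (sAdd 29 21 7 ;; sSub 21 7 1 ;; side_code 8 ;; sAdd 28 21 7 ;; descent_code ;; round_code ;; root_code)
         (1 + (1 + (?side + (1 + (rounds * 50 + 5 + (13 + 20)))))) ?Q \<sigma>3"
      proof (rule wx_Seq, rule wx_scalars(2), rule second)
        show "prepared (\<sigma>3\<lparr>R := (R \<sigma>3)(29 := R \<sigma>3 21 + R \<sigma>3 7)\<rparr>)"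
          using p3 by (simp add: prepared_def prepared0_def)
        show "dr (\<sigma>3\<lparr>R := (R \<sigma>3)(29 := R \<sigma>3 21 + R \<sigma>3 7)\<rparr>) = steps * n" using d3 s2(3) by simp
        assume L: "lucky \<omega>"
        have z: "R \<sigma>3 7 = 0" using p3 by (simp add: prepared_def prepared0_def)
        have good: "\<not> unlucky (2 * \<zeta>) (test_path (outcome (2 * \<zeta>)) n (dr \<sigma>2) \<omega> j) (\<lambda>i. \<omega> (dr \<sigma>2 + j * n + i))"
          if "j < steps" for j using L that s2(3) by (simp add: lucky_def)
        note br = bisection_result[OF good disjI1[OF refl]]
        have b: "R \<sigma>3 21 = snd (interval (2 * \<zeta>) ?l)" "form (R \<sigma>3 21) (V \<sigma>3 9) < 0"
          using res br(1) by (auto simp: Let_def)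
        have "\<gamma>h < R \<sigma>3 21 \<and> R \<sigma>3 21 \<le> 2 * \<zeta>" "\<forall>h. - sg * inner h h \<le> form (R \<sigma>3 21) h"
          using br(2,3) b(1) by auto
        then show "\<gamma>h < R (\<sigma>3\<lparr>R := (R \<sigma>3)(29 := R \<sigma>3 21 + R \<sigma>3 7)\<rparr>) 29 \<and>
          R (\<sigma>3\<lparr>R := (R \<sigma>3)(29 := R \<sigma>3 21 + R \<sigma>3 7)\<rparr>) 29 \<le> 2 * \<zeta> \<and>
          form (R (\<sigma>3\<lparr>R := (R \<sigma>3)(29 := R \<sigma>3 21 + R \<sigma>3 7)\<rparr>) 29) (V (\<sigma>3\<lparr>R := (R \<sigma>3)(29 := R \<sigma>3 21 + R \<sigma>3 7)\<rparr>) 9) < 0 \<and>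
          (\<forall>h. - sg * inner h h \<le> form (R (\<sigma>3\<lparr>R := (R \<sigma>3)(29 := R \<sigma>3 21 + R \<sigma>3 7)\<rparr>) 29) h)"
          using b(2) by (simp add: z)
      qed
    qed simp_all
    show ?thesis
      apply (rule wx_Seq, rule wx_scalars(4), rule side)
        apply (use p1 d1 in \<open>simp_all add: same_def prepared_def prepared0_def\<close>)
      done
  qed
  show ?thesis unfolding main_code_def
  proof (rule wx_mono)
    show "wx \<omega> (setup_code ;; count_code ;; threshold_code ;; sMul 21 1 9 ;; side_code 9 ;; sAdd 29 21 7 ;;
      sSub 21 7 1 ;; side_code 8 ;; sAdd 28 21 7 ;; descent_code ;; round_code ;; root_code)
      (28 + (steps * 4 + 1 + (8 + (1 + (?side + (1 + (1 + (?side + (1 + (rounds * 50 + 5 + (13 + 20))))))))))) ?Q \<sigma>"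
    proof (rule wx_Seq, rule wx_setup[OF \<sigma>(1-11)], rule wx_Seq, rule wx_count, assumption+,
        rule wx_Seq, rule wx_threshold, assumption+, rule first)
      fix \<sigma>1 \<sigma>2 \<sigma>3 assume "dr \<sigma>1 = dr \<sigma>" "dr \<sigma>2 = dr \<sigma>1" "dr \<sigma>3 = dr \<sigma>2"
      then show "dr \<sigma>3 = 0" using \<sigma>(12) by simp
    qed
  qed (simp_all add: main_time_def algebra_simps)
qed

end

section \<open>Running time\<close>

lemma log1_ge1: "1 \<le> log1 x" and log1_ge_ln: "ln x \<le> log1 x"
  by (simp_all add: log1_def)

lemma loglog1_ge1: "1 \<le> loglog1 x" by (simp add: loglog1_def log1_ge1)

lemma le_product:
  assumes "1 \<le> a" "1 \<le> (b :: real)"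
  shows "a \<le> a * b" "b \<le> a * b" "1 \<le> a * b"
proof -
  show "a \<le> a * b" using mult_left_mono[OF assms(2), of a] assms by simp
  show b: "b \<le> a * b" using mult_right_mono[OF assms(1), of b] assms by simp
  show "1 \<le> a * b" by (rule order_trans[OF assms(2) b])
qed

lemma ln_le_2_sqrt:
  assumes "1 \<le> (x :: real)"
  shows "ln x \<le> 2 * sqrt x"
proof -
  have "ln (sqrt x) \<le> sqrt x - 1" using assms by (intro ln_le_minus_one) auto
  then show ?thesis using assms by (simp add: ln_sqrt)
qed

lemma ln_le_of_power:
  assumes "(x :: real) \<le> 2 ^ k" "0 < x"
  shows "ln x \<le> real k"
proof -
  have "ln x \<le> ln ((2 :: real) ^ k)" using assms by simp
  also have "\<dots> = real k * ln 2" by (simp add: ln_realpow)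
  also have "\<dots> \<le> real k * 1" using ln_2_less_1 by (intro mult_left_mono) auto
  finally show ?thesis by simp
qed

context gtrs
begin

lemma kappa_pos: "0 < \<kappa>" using kappa_ge1 by simp

text \<open>Up to a constant sqrt (\<zeta> / sg), which governs the length of one Chebyshev test. It
  is smaller by sqrt \<kappa> than the power factor of the claimed time.\<close>

definition "growth = sqrt (\<zeta> * \<kappa> ^ 3 / \<epsilon>)"

lemma growth_ge1: "1 \<le> growth"
proof -
  have "\<epsilon> \<le> \<kappa> ^ 3 * \<xi>" using eps1 by (simp add: \<kappa>_def)
  also have "\<dots> \<le> \<kappa> ^ 3 * \<zeta>" using xi_le zeta_ge1 kappa_pos by (intro mult_left_mono) auto
  finally have "1 \<le> \<zeta> * \<kappa> ^ 3 / \<epsilon>" using eps0 by (simp add: mult.commute)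
  then show ?thesis by (simp add: growth_def)
qed

lemma kappa_growth: "sqrt \<kappa> * growth = \<kappa>\<^sup>2 * sqrt \<zeta> / sqrt \<epsilon>"
proof -
  have "sqrt \<kappa> * growth = sqrt (\<kappa> ^ 4 * \<zeta> / \<epsilon>)"
    unfolding growth_def real_sqrt_mult[symmetric] by (simp add: power4_eq_xxxx power3_eq_cube mult_ac)
  also have "\<dots> = sqrt (\<kappa> ^ 4) * sqrt \<zeta> / sqrt \<epsilon>" by (simp add: real_sqrt_mult real_sqrt_divide)
  also have "sqrt (\<kappa> ^ 4) = \<kappa>\<^sup>2" by (rule real_sqrt_unique) auto
  finally show ?thesis .
qed

lemma steps_pos: "0 < steps"
proof (rule ccontr)
  assume "\<not> 0 < steps"
  then have "8 * \<zeta> \<le> sg" using steps_spec by simp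
  moreover have "sg \<le> \<zeta>"
  proof -
    have "\<epsilon> \<le> \<zeta> * \<kappa> ^ 3" using growth_ge1 eps0 by (simp add: growth_def)
    then have "sg \<le> \<zeta> * \<kappa> ^ 3 / (\<kappa> * \<kappa> * \<kappa> * 72)" unfolding sg_def using kappa_pos by (intro divide_right_mono) auto
    also have "\<dots> = \<zeta> / 72" using kappa_pos by (simp add: power3_eq_cube)
    finally show ?thesis using zeta_ge1 by simp
  qed
  ultimately show False using zeta_ge1 by simp
qed

lemma zeta_sg: "\<zeta> / sg = 72 * (\<zeta> * \<kappa> ^ 3 / \<epsilon>)"
  unfolding sg_def by (simp add: power3_eq_cube)

lemma steps_le: "real steps \<le> 18 * log1 (\<kappa> / \<epsilon>) + 6 * ln \<kappa>"
proof -
  define Y where "Y = \<zeta> * \<kappa> ^ 3 / \<epsilon>"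
  have Y: "0 < Y" unfolding Y_def using zeta_ge1 kappa_pos eps0 by simp
  have "sg < 8 * \<zeta> / 2 ^ (steps - 1)" using steps_less[of "steps - 1"] steps_pos by simp
  then have "2 ^ (steps - 1) < 8 * (\<zeta> / sg)" using sg_pos by (simp add: field_simps)
  then have "2 ^ (steps - 1) < 576 * Y" by (simp add: zeta_sg Y_def)
  then have "ln (2 ^ (steps - 1)) < ln (576 * Y)" using Y by (subst ln_less_cancel_iff) auto
  then have 1: "real (steps - 1) * ln 2 < ln 576 + ln Y" using Y by (simp add: ln_realpow ln_mult)
  have l576: "ln (576 :: real) \<le> 10" using ln_le_of_power[of 576 10] by simp
  \<comment> \<open>Splitting off \<kappa> / \<epsilon> isolates the claimed logarithm; only a
    multiple of ln \<kappa> remains.\<close>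
  have "Y \<le> \<kappa> ^ 3 * (\<kappa> / \<epsilon>)" unfolding Y_def
    using zeta_le_kappa kappa_pos eps0 by (simp add: divide_right_mono mult.commute)
  then have "ln Y \<le> ln (\<kappa> ^ 3 * (\<kappa> / \<epsilon>))" using Y kappa_pos eps0 by (subst ln_le_cancel_iff) auto
  also have "\<dots> = 3 * ln \<kappa> + ln (\<kappa> / \<epsilon>)" using kappa_pos eps0 by (subst ln_mult) (auto simp: ln_realpow)
  finally have 2: "ln Y \<le> 3 * ln \<kappa> + log1 (\<kappa> / \<epsilon>)" using log1_ge_ln[of "\<kappa> / \<epsilon>"] by simp
  have "real (steps - 1) * (2 / 3) \<le> real (steps - 1) * ln 2" using ln2_ge_two_thirds by (intro mult_left_mono) auto
  then have "real (steps - 1) \<le> 3 / 2 * (10 + 3 * ln \<kappa> + log1 (\<kappa> / \<epsilon>))" using 1 2 l576 by simp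
  moreover have "real (steps - 1) = real steps - 1" using steps_pos by (simp add: of_nat_diff)
  ultimately have "2 * (real steps - 1) \<le> 30 + 9 * ln \<kappa> + 3 * log1 (\<kappa> / \<epsilon>)" by simp
  moreover have "0 \<le> ln \<kappa>" using kappa_ge1 by simp
  ultimately show ?thesis using log1_ge1[of "\<kappa> / \<epsilon>"] by (smt (verit))
qed

lemma steps_le_sqrt: "real steps \<le> 30 * (sqrt \<kappa> * log1 (\<kappa> / \<epsilon>))"
proof -
  let ?L = "log1 (\<kappa> / \<epsilon>)"
  have s: "1 \<le> sqrt \<kappa>" using kappa_ge1 by simp
  show ?thesis using steps_le ln_le_2_sqrt[OF kappa_ge1] le_product[OF s log1_ge1[of "\<kappa> / \<epsilon>"]] by linarith
qed

text \<open>The number of tests enters the Chebyshev length through \<open>pf\<close>, hence only as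
  a logarithm of logarithms, which the hidden factors absorb.\<close>

lemma ln_steps_le: "ln (real steps) \<le> 7 * (loglog1 \<kappa> * loglog1 (\<kappa> / \<epsilon>))"
proof -
  let ?L = "log1 (\<kappa> / \<epsilon>)" and ?K = "log1 \<kappa>"
  have K: "1 \<le> ?K" and L: "1 \<le> ?L" by (simp_all add: log1_ge1)
  have "real steps \<le> 24 * (?K * ?L)" using steps_le log1_ge_ln[of \<kappa>] le_product[OF K L] by linarith
  then have "ln (real steps) \<le> ln (24 * (?K * ?L))" using steps_pos K L by (subst ln_le_cancel_iff) auto
  also have "\<dots> = ln 24 + (ln ?K + ln ?L)" using K L by (simp add: ln_mult)
  also have "\<dots> \<le> 5 + (loglog1 \<kappa> + loglog1 (\<kappa> / \<epsilon>))"
    using ln_le_of_power[of 24 5] unfolding loglog1_def by (intro add_mono log1_ge_ln) auto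
  finally have 1: "ln (real steps) \<le> 5 + (loglog1 \<kappa> + loglog1 (\<kappa> / \<epsilon>))" .
  then show ?thesis using le_product[OF loglog1_ge1[of \<kappa>] loglog1_ge1[of "\<kappa> / \<epsilon>"]] by linarith
qed

lemma pf_pos: "0 < pf" unfolding pf_def using p0 steps_pos by simp

lemma ln_HH_le: "ln HH \<le> 32 * (log1 (real n / p) * (loglog1 \<kappa> * loglog1 (\<kappa> / \<epsilon>)))"
proof -
  let ?M = "loglog1 \<kappa> * loglog1 (\<kappa> / \<epsilon>)" and ?L = "log1 (real n / p)"
  have st: "0 < real steps" using steps_pos by simp
  have nn: "1 \<le> real n" using n_pos by simp
  have "ln HH = ln (real n * 32) - ln (pf * pf * pf)" unfolding HH_def using nn pf_pos by (subst ln_div) auto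
  also have "\<dots> = ln (real n) + ln 32 - 3 * ln pf" using nn pf_pos by (simp add: ln_mult)
  also have "ln pf = ln p - (ln (real steps) + ln 2)" unfolding pf_def using p0 st by (simp add: ln_div ln_mult)
  finally have 1: "ln HH = ln 32 + 3 * ln 2 + 3 * ln (real steps) + (ln (real n) - 3 * ln p)" by simp
  \<comment> \<open>Since p may exceed 1, the sign of ln p decides which multiple of ln (n / p) is
    compared.\<close>
  have 2: "ln (real n) - 3 * ln p \<le> 3 * ?L"
  proof -
    have d: "ln (real n / p) = ln (real n) - ln p" using nn p0 by (simp add: ln_div)
    have n0: "0 \<le> ln (real n)" using nn by simp
    have l: "ln (real n / p) \<le> ?L" "1 \<le> ?L" by (simp_all add: log1_ge_ln log1_ge1)
    show ?thesis using d n0 l by (cases "ln p \<le> 0") linarith+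
  qed
  have 3: "ln (32 :: real) \<le> 5" "ln (2 :: real) \<le> 1" using ln_le_of_power[of 32 5] ln_le_of_power[of 2 1] by auto
  have M: "1 \<le> ?M" by (intro le_product loglog1_ge1)
  have L: "1 \<le> ?L" by (rule log1_ge1)
  have "ln HH \<le> 8 + 21 * ?M + 3 * ?L" using 1 2 3 ln_steps_le by linarith
  then show ?thesis using M L le_product[OF L M] by linarith
qed

text \<open>The rate satisfies 2 ln rho \<ge> y with 1 / y = sqrt (108 Y) \<le> 11 sqrt Y, where
  sqrt Y is \<open>growth\<close>. The resulting 32 * 11 = 352 is increased by one for the last
  iteration.\<close>

lemma iters_le: "real iters \<le> 353 * (growth * (log1 (real n / p) * (loglog1 \<kappa> * loglog1 (\<kappa> / \<epsilon>))))"
proof -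
  let ?M = "loglog1 \<kappa> * loglog1 (\<kappa> / \<epsilon>)" and ?L = "log1 (real n / p)"
  define Y where "Y = \<zeta> * \<kappa> ^ 3 / \<epsilon>"
  define y where "y = sqrt (sg / (3 * \<zeta>) * 2)"
  have Y1: "1 \<le> Y" using growth_ge1 unfolding growth_def Y_def by simp
  have sgY: "sg / (3 * \<zeta>) * 2 = 1 / (108 * Y)"
    unfolding sg_def Y_def using zeta_ge1 kappa_pos eps0 by (simp add: field_simps power3_eq_cube)
  have y0: "0 < y" unfolding y_def sgY using Y1 by simp
  have yi: "1 / y \<le> 11 * growth"
  proof -
    have "1 / y = sqrt (108 * Y)" unfolding y_def sgY by (simp add: real_sqrt_divide)
    also have "\<dots> \<le> sqrt (121 * Y)" using Y1 by simp
    also have "\<dots> = 11 * growth" unfolding growth_def Y_def[symmetric] real_sqrt_mult by (simp add: real_sqrt_unique[of 11 121])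
    finally show ?thesis .
  qed
  have yh: "y \<le> 1 / 2" unfolding y_def sgY using Y1 by (intro real_le_lsqrt) (auto simp: power2_eq_square field_simps)
  have lr: "y \<le> 2 * ln rho"
  proof -
    have "y - y\<^sup>2 \<le> ln (1 + y)" using y0 yh by (intro ln_one_plus_pos_lower_bound) auto
    moreover have "y * y \<le> y * (1 / 2)" using y0 yh by (intro mult_left_mono) auto
    moreover have "rho = 1 + y" by (simp add: rho_def y_def)
    ultimately show ?thesis by (simp add: power2_eq_square)
  qed
  define X where "X = ?L * ?M"
  have M: "1 \<le> ?M" by (intro le_product loglog1_ge1)
  have X1: "1 \<le> X" unfolding X_def by (rule le_product(3)[OF log1_ge1 M])
  have GX: "1 \<le> growth * X" by (rule le_product(3)[OF growth_ge1 X1])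
  show ?thesis
  proof (cases "iters = 0")
    case True
    then show ?thesis using GX by (simp add: X_def)
  next
    case False
    then have "(rho * rho) ^ (iters - 1) < HH" using iters_less[of "iters - 1"] by simp
    moreover have r: "0 < rho * rho" using rho_gt1 by simp
    ultimately have "ln ((rho * rho) ^ (iters - 1)) < ln HH" by (subst ln_less_cancel_iff) (auto intro: less_trans[OF zero_less_power])
    then have "real (iters - 1) * (2 * ln rho) < ln HH" using r rho_gt1 by (simp add: ln_realpow ln_mult)
    moreover have "real (iters - 1) * y \<le> real (iters - 1) * (2 * ln rho)" using lr by (intro mult_left_mono) auto
    ultimately have "real (iters - 1) * y \<le> 32 * X" using ln_HH_le unfolding X_def by linarith
    then have "real (iters - 1) \<le> 32 * X * (1 / y)" using y0 by (simp add: field_simps)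
    also have "\<dots> \<le> 32 * X * (11 * growth)" using yi X1 by (intro mult_left_mono) auto
    finally have "real iters - 1 \<le> 352 * (growth * X)" using False by (simp add: of_nat_diff mult_ac)
    then show ?thesis using GX unfolding X_def by linarith
  qed
qed

text \<open>The momentum is at least m / 2, so before the last round m^2 < 1152 \<zeta> \<kappa>^2 /
  \<epsilon>; the constant is rounded up to 1156 = 34^2.\<close>

lemma rounds_le: "real rounds \<le> 35 * (sqrt \<kappa> * growth)"
proof -
  have kg: "1 \<le> sqrt \<kappa> * growth" using growth_ge1 kappa_ge1 by (intro le_product) auto
  show ?thesis
  proof (cases "rounds = 0")
    case False
    define m where "m = rounds - 1"
    have "momentum m * momentum m * \<epsilon> < budget" using rounds_less[of m] False by (simp add: m_def)
    moreover have "real m / 2 * (real m / 2) * \<epsilon> \<le> momentum m * momentum m * \<epsilon>"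
      using momentum_ge[of m] eps0 by (intro mult_mono mult_right_mono) (auto simp: order_trans[OF _ momentum_ge])
    ultimately have "real m * real m * \<epsilon> < 4 * budget" by simp
    then have "real m * real m \<le> 1152 * (\<zeta> * \<kappa> * \<kappa> / \<epsilon>)" using eps0 by (simp add: budget_def field_simps)
    also have "\<dots> \<le> 1156 * (\<zeta> * \<kappa> ^ 4 / \<epsilon>)"
    proof -
      have "\<kappa> * \<kappa> * 1 \<le> \<kappa> * \<kappa> * (\<kappa> * \<kappa>)" using kappa_ge1 mult_mono[of 1 \<kappa> 1 \<kappa>] by (intro mult_left_mono) auto
      then have "\<zeta> * (\<kappa> * \<kappa>) / \<epsilon> \<le> \<zeta> * \<kappa> ^ 4 / \<epsilon>"
        using zeta_ge1 eps0 by (intro divide_right_mono mult_left_mono) (auto simp: power4_eq_xxxx mult.assoc)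
      moreover have "0 \<le> \<zeta> * \<kappa> ^ 4 / \<epsilon>" using zeta_ge1 eps0 kappa_pos by simp
      ultimately show ?thesis by (simp add: mult.assoc)
    qed
    also have "\<dots> = (34 * (sqrt \<kappa> * growth))\<^sup>2"
      unfolding growth_def power_mult_distrib using kappa_pos zeta_ge1 eps0
      by (simp add: power3_eq_cube power4_eq_xxxx)
    finally have "(real m)\<^sup>2 \<le> (34 * (sqrt \<kappa> * growth))\<^sup>2" by (simp add: power2_eq_square)
    then have "real m \<le> 34 * (sqrt \<kappa> * growth)" by (rule power2_le_imp_le) (use kg in linarith)
    moreover have "real rounds = real m + 1" using False by (simp add: m_def of_nat_diff)
    ultimately show ?thesis using kg by linarith
  qed (use kg in auto)
qed

lemma total_time_le:
  "real (steps * (iters * 38 + 42) + rounds * 50 + 100) \<le>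
    410000 * (\<kappa>\<^sup>2 * sqrt \<zeta> / sqrt \<epsilon> * log1 (real n / p) * log1 (\<kappa> / \<epsilon>) * (loglog1 \<kappa> * loglog1 (\<kappa> / \<epsilon>)))"
proof -
  define M where "M = loglog1 \<kappa> * loglog1 (\<kappa> / \<epsilon>)"
  define L where "L = log1 (real n / p)"
  define L2 where "L2 = log1 (\<kappa> / \<epsilon>)"
  define k where "k = sqrt \<kappa>"
  define W where "W = growth * (L * M)"
  have M: "1 \<le> M" unfolding M_def by (intro le_product loglog1_ge1)
  have L: "1 \<le> L" "1 \<le> L2" by (simp_all add: L_def L2_def log1_ge1)
  have k: "1 \<le> k" using kappa_ge1 by (simp add: k_def)
  have LM: "1 \<le> L * M" by (rule le_product(3)[OF L(1) M])
  have W: "1 \<le> W" unfolding W_def by (rule le_product(3)[OF growth_ge1 LM])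
  have gW: "growth \<le> W" unfolding W_def by (rule le_product(1)[OF growth_ge1 LM])
  have kL: "1 \<le> k * L2" by (rule le_product(3)[OF k L(2)])
  have kW: "k * growth \<le> k * L2 * W"
    using le_product(1)[OF k L(2)] gW growth_ge1 k kL by (intro mult_mono) auto
  have kW1: "1 \<le> k * L2 * W" by (rule le_product(3)[OF kL W])
  have it: "real iters * 38 + 42 \<le> 13456 * W" using iters_le W unfolding W_def L_def M_def by linarith
  have "real steps * (real iters * 38 + 42) \<le> (30 * (k * L2)) * (13456 * W)"
    using steps_le_sqrt it kL unfolding k_def L2_def by (intro mult_mono) auto
  moreover have "(30 * (k * L2)) * (13456 * W) = 403680 * (k * L2 * W)" by simp
  moreover have "real rounds * 50 \<le> 1750 * (k * L2 * W)" using rounds_le kW unfolding k_def by linarith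
  ultimately have "real (steps * (iters * 38 + 42) + rounds * 50 + 100) \<le> 410000 * (k * L2 * W)"
    using kW1 unfolding of_nat_add of_nat_mult of_nat_numeral by linarith
  also have "k * L2 * W = (k * growth) * L * L2 * M" by (simp add: W_def mult_ac)
  finally show ?thesis unfolding k_def kappa_growth L_def L2_def M_def .
qed

end

section \<open>Input, output and success probability\<close>

text \<open>Index registers cannot be multiplied, so the slot addresses arise by repeated addition
  of n.\<close>

definition address_code :: "instr list" where
  "address_code = map (\<lambda>k. NAdd (23 + k) (22 + k) 6) [0..<17]"

definition init_code :: com where
  "init_code =
     Block [NConst 5 1, NConst 13 0, NLoad 6 13, NLoad 7 5, NConst 13 2, NLoad 8 13, NConst 9 3,
       NAdd 10 9 7, NAdd 10 10 7, NConst 13 7, NAdd 11 13 6, NAdd 11 11 6, NAdd 12 11 7,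
       NConst 20 7, NAdd 21 20 6, NAdd 22 12 8] ;;
     Block address_code ;;
     Block [NConst 13 0, RLoad 10 13, NConst 13 1, RLoad 11 13, NConst 13 2, RLoad 12 13,
       NConst 13 3, RLoad 13 13, NConst 13 4, RLoad 14 13, NConst 13 5, RLoad 15 13,
       NConst 13 6, RLoad 16 13]"

definition output_code :: com where
  "output_code =
     Block [NConst 4 0, NAdd 0 6 4, NAdd 1 35 4, NConst 3 0] ;;
     While (TN 0) (Block [RLoad 0 1, RStore 3 0, NAdd 1 1 5, NAdd 3 3 5, NSub 0 0 5])"

lemma fold_address:
  assumes "s' = fold (exec \<omega>) (map (\<lambda>k. NAdd (23 + k) (22 + k) 6) [0..<m]) s"
  shows "(\<forall>k\<le>m. nreg s' (22 + k) = nreg s 22 + k * nreg s 6) \<and> (\<forall>r\<le>22. nreg s' r = nreg s r) \<and>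
    rreg s' = rreg s \<and> nmem s' = nmem s \<and> rmem s' = rmem s \<and> draws s' = draws s"
  using assms
proof (induction m arbitrary: s')
  case (Suc m)
  define t where "t = fold (exec \<omega>) (map (\<lambda>k. NAdd (23 + k) (22 + k) 6) [0..<m]) s"
  note IH = Suc.IH[OF t_def]
  have s': "s' = exec \<omega> (NAdd (23 + m) (22 + m) 6) t" using Suc.prems by (simp add: t_def)
  have "nreg s' (22 + k) = nreg s 22 + k * nreg s 6" if "k \<le> Suc m" for k
    using IH that by (cases "k = Suc m") (auto simp: s' set_n_def)
  then show ?case using IH by (auto simp: s' set_n_def)
qed simp

lemma load_list_append:
  "load_list (xs @ ys) i = (if i < length xs then xs ! i else load_list ys (i - length xs))"
  by (auto simp: load_list_def nth_append)

lemma load_list_append5: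
  "load_list (P @ B @ C @ D @ E) i = (if i < length P then P ! i
     else if i - length P < length B then B ! (i - length P)
     else if i - length P - length B < length C then C ! (i - length P - length B)
     else if i - length P - length B - length C < length D then D ! (i - length P - length B - length C)
     else load_list E (i - length P - length B - length C - length D))"
  by (simp only: load_list_append)

lemma length_pairs: "length (concat (map (\<lambda>(i, j). [i, j]) L)) = 2 * length L"
  by (induction L) auto

lemma nth_pairs:
  "e < length L \<Longrightarrow> concat (map (\<lambda>(i, j). [i, j]) L) ! (2 * e) = fst (L ! e) \<and>
    concat (map (\<lambda>(i, j). [i, j]) L) ! Suc (2 * e) = snd (L ! e)"
proof (induction L arbitrary: e)
  case (Cons a L)
  then show ?case by (cases e) (auto split: prod.split)
qed simp

context gtrs_ram
begin

lemma output_correct: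
  assumes s: "sim s \<sigma>"
  shows "\<exists>s'. executes_within \<omega> output_code s U s' \<and> (\<forall>i<n. rmem s' i = coord (V \<sigma> 15) i)"
proof -
  have c: "nreg s 5 = 1" "nreg s 6 = n" "nreg s 35 = adr 15"
  proof -
    have "nreg s (20 + 15) = adr 15" using s unfolding sim_def by (metis numeral_less_iff semiring_norm(76) semiring_norm(78) semiring_norm(80) semiring_norm(81))
    then show "nreg s 35 = adr 15" by simp
  qed (use s in \<open>simp_all add: sim_def\<close>)
  have vec: "\<forall>i<n. rmem s (adr 15 + i) = coord (V \<sigma> 15) i" using s by (simp add: sim_def)
  \<comment> \<open>The result is copied to addresses below n, so the source slot is not overwritten
    while it is read.\<close>
  have big: "n \<le> adr 15" by (simp add: adr_def)
  let ?init = "[NConst 4 0, NAdd 0 6 4, NAdd 1 35 4, NConst 3 0]"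
  let ?body = "[RLoad 0 1, RStore 3 0, NAdd 1 1 5, NAdd 3 3 5, NSub 0 0 5]"
  define I where "I = (\<lambda>i (t::state). i \<le> n \<and> nreg t 0 = n - i \<and> nreg t 1 = adr 15 + i \<and> nreg t 3 = i
    \<and> nreg t 5 = 1 \<and> (\<forall>p\<ge>n. rmem t p = rmem s p) \<and> (\<forall>j<i. rmem t j = coord (V \<sigma> 15) j))"
  define s0 where "s0 = fold (exec \<omega>) ?init s"
  have e0: "executes_within \<omega> (Block ?init) s 4 s0"
    by (rule executes_within_Block[OF _ _ s0_def]) simp_all
  have "I 0 s0" using c by (simp add: I_def s0_def set_n_def)
  then have "\<exists>s'. executes_within \<omega> (While (TN 0) (Block ?body)) s0 (n * (5 + 2) + 1) s' \<and> I n s'"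
  proof (rule executes_within_While)
    fix i t assume i: "i < n" and I: "I i t"
    define t' where "t' = fold (exec \<omega>) ?body t"
    have n5: "nreg t 5 = 1" "nreg t 0 = n - i" "nreg t 1 = adr 15 + i" "nreg t 3 = i"
      using I by (simp_all add: I_def)
    have rd: "rmem t (adr 15 + i) = coord (V \<sigma> 15) i" using I vec i big by (simp add: I_def)
    have nr: "nreg t' 0 = n - Suc i" "nreg t' 1 = adr 15 + Suc i" "nreg t' 3 = Suc i" "nreg t' 5 = 1"
      using n5 by (simp_all add: t'_def set_n_def set_r_def)
    have rm: "rmem t' = (rmem t)(i := coord (V \<sigma> 15) i)"
      using n5 rd by (simp add: t'_def set_n_def set_r_def)
    have "I (Suc i) t'" using I i nr by (auto simp: I_def rm less_Suc_eq)
    moreover have "executes_within \<omega> (Block ?body) t 5 t'" by (rule executes_within_Block[OF _ _ t'_def]) simp_all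
    moreover have "test_holds (TN 0) t" using I i by (simp add: I_def)
    ultimately show "test_holds (TN 0) t \<and> (\<exists>s'. executes_within \<omega> (Block ?body) t 5 s' \<and> I (Suc i) s')"
      by blast
  qed (simp add: I_def)
  then obtain s' where s': "executes_within \<omega> (While (TN 0) (Block ?body)) s0 (n * (5 + 2) + 1) s'" "I n s'"
    by blast
  have "executes_within \<omega> output_code s U s'"
    unfolding output_code_def by (rule executes_within_Seq[OF e0 s'(1)]) (use n in \<open>simp add: U_def\<close>)
  then show ?thesis using s'(2) by (auto simp: I_def)
qed

end

context gtrs
begin

abbreviation "input \<equiv> gtrs_input n A0 A1 b0 b1 c0 c1 \<xi> \<zeta> \<gamma>h \<epsilon> p"

lemma input_nmem: "nmem input 0 = n" "nmem input 1 = nnz A0" "nmem input 2 = nnz A1"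
  by (simp_all add: gtrs_input_def load_list_def)

lemma ram: "gtrs_ram n A0 A1 b0 b1 c1 \<xi> \<zeta> \<gamma>h \<epsilon> p (nmem input)"
proof (unfold_locales)
  let ?L = "nz_entries A0 @ nz_entries A1"
  have m: "nmem input (3 + i) = load_list (concat (map (\<lambda>(i, j). [i, j]) ?L)) i" for i
    unfolding gtrs_input_def by (subst state.simps, subst load_list_append) simp
  have e: "nmem input (3 + 2 * e) = fst (?L ! e) \<and> nmem input (4 + 2 * e) = snd (?L ! e)" if "e < length ?L" for e
  proof -
    have "nmem input (3 + Suc (2 * e)) = snd (?L ! e)"
      unfolding m load_list_def length_pairs using nth_pairs[OF that] that by simp
    moreover have "nmem input (3 + 2 * e) = fst (?L ! e)"
      unfolding m load_list_def length_pairs using nth_pairs[OF that] that by simp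
    ultimately show ?thesis by (simp add: eval_nat_numeral)
  qed
  show "nmem input (3 + 2 * e) = fst (nz_entries A0 ! e) \<and> nmem input (4 + 2 * e) = snd (nz_entries A0 ! e)"
    if "e < length (nz_entries A0)" for e using e[of e] that by (simp add: nth_append)
  show "nmem input (3 + 2 * length (nz_entries A0) + 2 * e) = fst (nz_entries A1 ! e) \<and>
      nmem input (4 + 2 * length (nz_entries A0) + 2 * e) = snd (nz_entries A1 ! e)"
    if "e < length (nz_entries A1)" for e
    using e[of "length (nz_entries A0) + e"] that by (simp add: nth_append algebra_simps)
qed (use carriers n_pos in auto)

interpretation rm: gtrs_ram n A0 A1 b0 b1 c0 c1 \<xi> \<zeta> \<gamma>h \<epsilon> p "nmem input"
  by (rule ram)

definition initial :: astate where
  "initial = \<lparr>R = (\<lambda>j. if j < 7 then [\<xi>, \<zeta>, \<gamma>h, \<epsilon>, p, c0, c1] ! j else 0),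
     V = (\<lambda>k. if k = 0 then \<beta>0 else if k = 1 then \<beta>1 else 0), dr = 0\<rparr>"

lemma input_rmem:
  "i < 7 \<Longrightarrow> rmem input i = [\<xi>, \<zeta>, \<gamma>h, \<epsilon>, p, c0, c1] ! i"
  "i < n \<Longrightarrow> rmem input (7 + i) = b0 $ i"
  "i < n \<Longrightarrow> rmem input (7 + n + i) = b1 $ i"
  "e < length (nz_entries A0) \<Longrightarrow> rmem input (7 + 2 * n + e) = A0 $$ (nz_entries A0 ! e)"
  "e < length (nz_entries A1) \<Longrightarrow> rmem input (7 + 2 * n + length (nz_entries A0) + e) = A1 $$ (nz_entries A1 ! e)"
  "7 + 2 * n + length (nz_entries A0) + length (nz_entries A1) \<le> i \<Longrightarrow> rmem input i = 0"
proof -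
  have len: "length (list_of_vec b0) = n" "length (list_of_vec b1) = n" using carriers by auto
  define P where "P = [\<xi>, \<zeta>, \<gamma>h, \<epsilon>, p, c0, c1]"
  have lP: "length P = 7" by (simp add: P_def)
  have "rmem input i = load_list (P @ list_of_vec b0 @ list_of_vec b1
      @ map (\<lambda>ij. A0 $$ ij) (nz_entries A0) @ map (\<lambda>ij. A1 $$ ij) (nz_entries A1)) i" for i
    by (simp add: gtrs_input_def P_def)
  note r = this[unfolded load_list_append5 lP len length_map]
  show "i < 7 \<Longrightarrow> rmem input i = [\<xi>, \<zeta>, \<gamma>h, \<epsilon>, p, c0, c1] ! i" by (simp add: r P_def)
  show "i < n \<Longrightarrow> rmem input (7 + i) = b0 $ i" "i < n \<Longrightarrow> rmem input (7 + n + i) = b1 $ i"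
    by (simp_all add: r list_of_vec_index)
  show "e < length (nz_entries A0) \<Longrightarrow> rmem input (7 + 2 * n + e) = A0 $$ (nz_entries A0 ! e)"
    "e < length (nz_entries A1) \<Longrightarrow> rmem input (7 + 2 * n + length (nz_entries A0) + e) = A1 $$ (nz_entries A1 ! e)"
    by (simp_all add: r load_list_def)
  show "rmem input i = 0" if "7 + 2 * n + length (nz_entries A0) + length (nz_entries A1) \<le> i"
  proof -
    have "\<not> i < 7" "\<not> i - 7 < n" "\<not> i - 7 - n < n" "\<not> i - 7 - n - n < length (nz_entries A0)"
      "\<not> i - 7 - n - n - length (nz_entries A0) < length (nz_entries A1)" using that by arith+
    then show ?thesis unfolding r load_list_def length_map by (simp only: if_False)
  qed
qed

lemma init_correct: "\<exists>s. executes_within \<omega> init_code input 47 s \<and> rm.sim s initial"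
proof -
  let ?i1 = "[NConst 5 1, NConst 13 0, NLoad 6 13, NLoad 7 5, NConst 13 2, NLoad 8 13, NConst 9 3,
       NAdd 10 9 7, NAdd 10 10 7, NConst 13 7, NAdd 11 13 6, NAdd 11 11 6, NAdd 12 11 7,
       NConst 20 7, NAdd 21 20 6, NAdd 22 12 8]"
  let ?i3 = "[NConst 13 0, RLoad 10 13, NConst 13 1, RLoad 11 13, NConst 13 2, RLoad 12 13,
       NConst 13 3, RLoad 13 13, NConst 13 4, RLoad 14 13, NConst 13 5, RLoad 15 13,
       NConst 13 6, RLoad 16 13]"
  define s1 where "s1 = fold (exec \<omega>) ?i1 input"
  define s2 where "s2 = fold (exec \<omega>) address_code s1"
  define s3 where "s3 = fold (exec \<omega>) ?i3 s2"
  have ex: "executes_within \<omega> init_code input 47 s3" unfolding init_code_def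
  proof (rule executes_within_Seq[OF _ executes_within_Seq[OF _ _ order_refl]])
    show "executes_within \<omega> (Block ?i1) input 16 s1" by (rule executes_within_Block[OF _ _ s1_def]) simp_all
    show "executes_within \<omega> (Block address_code) s1 17 s2"
      by (rule executes_within_Block[OF _ _ s2_def]) (auto simp: address_code_def list_all_iff)
    show "executes_within \<omega> (Block ?i3) s2 14 s3" by (rule executes_within_Block[OF _ _ s3_def]) simp_all
  qed simp
  have nn: "nnz A0 = length (nz_entries A0)" "nnz A1 = length (nz_entries A1)" by (simp_all add: nnz_eq_length)
  have n1: "nmem input (Suc 0) = nnz A0" using input_nmem(2) by simp
  have z: "rreg input = (\<lambda>_. 0)" "draws input = 0" by (simp_all add: gtrs_input_def)
  have r1: "nreg s1 5 = 1" "nreg s1 6 = n" "nreg s1 7 = length (nz_entries A0)" "nreg s1 8 = length (nz_entries A1)"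
    "nreg s1 9 = 3" "nreg s1 10 = 3 + 2 * length (nz_entries A0)" "nreg s1 11 = 7 + 2 * n"
    "nreg s1 12 = 7 + 2 * n + length (nz_entries A0)" "nreg s1 20 = 7" "nreg s1 21 = 7 + n"
    "nreg s1 22 = 7 + 2 * n + length (nz_entries A0) + length (nz_entries A1)"
    unfolding s1_def using input_nmem n1 by (simp_all add: set_n_def nn)
  have f1: "rreg s1 = rreg input" "nmem s1 = nmem input" "rmem s1 = rmem input" "draws s1 = draws input"
    unfolding s1_def by (simp_all add: set_n_def)
  note f2 = fold_address[OF s2_def[unfolded address_code_def]]
  have f3: "\<And>r. r \<noteq> 13 \<Longrightarrow> nreg s3 r = nreg s2 r" "nmem s3 = nmem s2" "rmem s3 = rmem s2" "draws s3 = draws s2"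
    "rreg s3 = (rreg s2)(10 := rmem s2 0, 11 := rmem s2 1, 12 := rmem s2 2, 13 := rmem s2 3, 14 := rmem s2 4,
       15 := rmem s2 5, 16 := rmem s2 6)"
    unfolding s3_def by (simp_all add: set_n_def set_r_def)
  have adr: "nreg s3 (20 + k) = rm.adr k" if "k < 20" for k
  proof (cases "k < 2")
    case True
    then have "k = 0 \<or> k = 1" by auto
    then show ?thesis using f2 r1(9,10) by (auto simp: f3(1) rm.adr_def)
  next
    case False
    then obtain j where j: "k = 2 + j" by (metis le_add_diff_inverse not_less)
    have "nreg s3 (22 + j) = nreg s1 22 + j * nreg s1 6" using f2 that j by (simp add: f3(1))
    then show ?thesis using j r1 by (simp add: rm.adr_def)
  qed
  have rmem: "rmem s3 = rmem input" using f1 f2 f3 by simp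
  have vec: "in_dim n (V initial k) \<and> (\<forall>i<n. rmem s3 (rm.adr k + i) = coord (V initial k) i)" for k
  proof -
    consider "k = 0" | "k = 1" | "2 \<le> k" by linarith
    then show ?thesis
    proof cases
      case 1
      then show ?thesis using input_rmem(2) by (simp add: initial_def rmem rm.adr_def) (simp add: \<beta>0_def to_f_def)
    next
      case 2
      then show ?thesis using input_rmem(3) by (simp add: initial_def rmem rm.adr_def) (simp add: \<beta>1_def to_f_def)
    next
      case 3
      then have "rmem input (rm.adr k + i) = 0" for i by (intro input_rmem(6)) (simp add: rm.adr_def)
      then show ?thesis using 3 by (simp add: initial_def rmem)
    qed
  qed
  have rr: "rreg s3 (10 + j) = R initial j" for j
  proof (cases "j < 7")
    case True
    then have "j \<in> {0, 1, 2, 3, 4, 5, 6}" by auto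
    then show ?thesis using f1 f2 by (auto simp: f3(5) initial_def input_rmem)
  next
    case False
    then show ?thesis using f1 f2 z by (auto simp: f3(5) initial_def)
  qed
  have "rm.sim s3 initial" unfolding rm.sim_def
    using adr vec rr f1 f2 f3 r1 z input_rmem(4,5) by (simp add: rmem) (simp add: initial_def)
  with ex show ?thesis by blast
qed

lemma full_correct:
  "\<exists>s. executes_within \<omega> (init_code ;; main_code ;; output_code) input
      ((steps * (iters * 38 + 42) + rounds * 50 + 100) * rm.U) s \<and>
    (rm.lucky \<omega> \<longrightarrow> q1 (vecn n (rmem s)) = 0 \<and> q0 (vecn n (rmem s)) \<le> Opt n A0 A1 b0 b1 c0 c1 + \<epsilon>)"
proof -
  obtain s1 where s1: "executes_within \<omega> init_code input 47 s1" "rm.sim s1 initial" using init_correct by blast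
  have "rm.wx \<omega> main_code rm.main_time (\<lambda>\<sigma>'. rm.lucky \<omega> \<longrightarrow>
      q1 (V \<sigma>' 15) = 0 \<and> q0 (V \<sigma>' 15) \<le> Opt n A0 A1 b0 b1 c0 c1 + \<epsilon>) initial"
    by (rule rm.wx_main) (simp_all add: initial_def)
  then obtain s2 \<sigma>2 where s2: "executes_within \<omega> main_code s1 (rm.main_time * rm.U) s2" "rm.sim s2 \<sigma>2"
    "rm.lucky \<omega> \<longrightarrow> q1 (V \<sigma>2 15) = 0 \<and> q0 (V \<sigma>2 15) \<le> Opt n A0 A1 b0 b1 c0 c1 + \<epsilon>"
    using s1(2) unfolding rm.wx_def by blast
  obtain s3 where s3: "executes_within \<omega> output_code s2 rm.U s3" "\<forall>i<n. rmem s3 i = coord (V \<sigma>2 15) i"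
    using rm.output_correct[OF s2(2)] by blast
  have "in_dim n (V \<sigma>2 15)" using s2(2) by (simp add: rm.sim_def)
  then have "vecn n (rmem s3) = V \<sigma>2 15" using s3(2) by (intro fvec_eqI) (auto simp: in_dim_def)
  moreover have "executes_within \<omega> (init_code ;; main_code ;; output_code) input
      ((steps * (iters * 38 + 42) + rounds * 50 + 100) * rm.U) s3"
  proof (rule executes_within_Seq[OF s1(1) executes_within_Seq[OF s2(1) s3(1) order_refl]])
    have "47 \<le> 3 * rm.U" using rm.U_ge(1) by simp
    then show "47 + (rm.main_time * rm.U + rm.U) \<le> (steps * (iters * 38 + 42) + rounds * 50 + 100) * rm.U"
      by (simp add: rm.main_time_def algebra_simps)
  qed
  ultimately show ?thesis using s2(3) by (intro exI[of _ s3]) simp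
qed

text \<open>Coordinatewise measurability suffices: with the dimension fixed, inner products and
  forms are finite sums of coordinates.\<close>

definition vmeas :: "((nat \<Rightarrow> real) \<Rightarrow> fvec) \<Rightarrow> bool" where
  "vmeas X \<longleftrightarrow> (\<forall>\<omega>. in_dim n (X \<omega>)) \<and> (\<forall>i. (\<lambda>\<omega>. coord (X \<omega>) i) \<in> borel_measurable samples)"

lemma vmeas_simps:
  assumes "vmeas X" "vmeas Y"
  shows "vmeas (\<lambda>\<omega>. X \<omega> + Y \<omega>)" "vmeas (\<lambda>\<omega>. X \<omega> - Y \<omega>)" "vmeas (\<lambda>\<omega>. r *\<^sub>R X \<omega>)"
    "vmeas (\<lambda>\<omega>. B0 (X \<omega>))" "vmeas (\<lambda>\<omega>. B1 (X \<omega>))"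
    "(\<lambda>\<omega>. inner (X \<omega>) (Y \<omega>)) \<in> borel_measurable samples"
proof -
  have m: "(\<lambda>\<omega>. coord (X \<omega>) i) \<in> borel_measurable samples"
    "(\<lambda>\<omega>. coord (Y \<omega>) i) \<in> borel_measurable samples" for i using assms unfolding vmeas_def by blast+
  have d: "in_dim n (X \<omega>)" "in_dim n (Y \<omega>)" for \<omega> using assms unfolding vmeas_def by blast+
  show "vmeas (\<lambda>\<omega>. X \<omega> + Y \<omega>)" unfolding vmeas_def coord_simps
    by (intro conjI allI in_dim_simps(2) d borel_measurable_add m)
  show "vmeas (\<lambda>\<omega>. X \<omega> - Y \<omega>)" unfolding vmeas_def coord_simps
    by (intro conjI allI in_dim_simps(3) d borel_measurable_diff m)
  show "vmeas (\<lambda>\<omega>. r *\<^sub>R X \<omega>)" unfolding vmeas_def coord_simps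
    by (intro conjI allI in_dim_simps(5) d borel_measurable_times borel_measurable_const m)
  have "(\<lambda>\<omega>. coord (mat_op A (X \<omega>)) i) \<in> borel_measurable samples" for A i
    unfolding mat_op_def coord_vecn
    by (cases "i < dim_row A") (simp_all only: if_True if_False,
        intro borel_measurable_sum borel_measurable_times borel_measurable_const m, rule borel_measurable_const)
  then show "vmeas (\<lambda>\<omega>. B0 (X \<omega>))" "vmeas (\<lambda>\<omega>. B1 (X \<omega>))"
    unfolding vmeas_def using in_dim_B by blast+
  show "(\<lambda>\<omega>. inner (X \<omega>) (Y \<omega>)) \<in> borel_measurable samples"
    unfolding inner_in_dim[OF d(1)] by (intro borel_measurable_sum borel_measurable_times m)
qed

lemma vmeas_unary:
  assumes "vmeas X"
  shows "vmeas (\<lambda>\<omega>. r *\<^sub>R X \<omega>)" "vmeas (\<lambda>\<omega>. B0 (X \<omega>))" "vmeas (\<lambda>\<omega>. B1 (X \<omega>))"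
  by (rule vmeas_simps(3-5)[OF assms assms])+

lemma vmeas_vecn:
  assumes "\<And>i. (\<lambda>\<omega>. f \<omega> i) \<in> borel_measurable samples"
  shows "vmeas (\<lambda>\<omega>. vecn n (f \<omega>))"
  unfolding vmeas_def coord_vecn
proof (intro conjI allI)
  fix i show "(\<lambda>\<omega>. if i < n then f \<omega> i else 0) \<in> borel_measurable samples"
    by (cases "i < n") (simp_all only: if_True if_False assms, rule borel_measurable_const)
qed (rule in_dim_vecn)

lemma vmeas_cheb:
  "vmeas (\<lambda>\<omega>. fst (cheb (rm.opM \<gamma>) (vecn n \<omega>) k)) \<and> vmeas (\<lambda>\<omega>. snd (cheb (rm.opM \<gamma>) (vecn n \<omega>) k))"
proof (induction k)
  case 0
  have "vmeas (\<lambda>\<omega>. vecn n \<omega>)" by (rule vmeas_vecn[OF measurable_sample])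
  then show ?case by simp
next
  case (Suc k)
  let ?w = "\<lambda>\<omega>. fst (cheb (rm.opM \<gamma>) (vecn n \<omega>) k)" and ?v = "\<lambda>\<omega>. snd (cheb (rm.opM \<gamma>) (vecn n \<omega>) k)"
  have M: "vmeas (\<lambda>\<omega>. rm.opM \<gamma> (X \<omega>))" if "vmeas X" for X
    unfolding rm.pen_def by (intro vmeas_simps(1,2) vmeas_unary that)
  have "cheb (rm.opM \<gamma>) (vecn n \<omega>) (Suc k) =
      (rm.opM \<gamma> (?w \<omega>) + ?v \<omega> + rm.opM \<gamma> (?v \<omega>), rm.opM \<gamma> (?v \<omega>) - ?w \<omega> + rm.opM \<gamma> (?w \<omega>))" for \<omega>
    by (simp add: case_prod_unfold Let_def)
  moreover have "vmeas (\<lambda>\<omega>. rm.opM \<gamma> (?w \<omega>) + ?v \<omega> + rm.opM \<gamma> (?v \<omega>))"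
    "vmeas (\<lambda>\<omega>. rm.opM \<gamma> (?v \<omega>) - ?w \<omega> + rm.opM \<gamma> (?w \<omega>))"
    by (intro vmeas_simps(1,2) M conjunct1[OF Suc] conjunct2[OF Suc])+
  ultimately show ?case by (simp only: fst_conv snd_conv)
qed

lemma outcome_measurable: "{\<omega>. rm.outcome e l \<omega>} \<in> sets samples"
proof -
  let ?m = "rm.mid_of e l"
  have v: "vmeas (\<lambda>\<omega>. rm.test_vec ?m (vecn n \<omega>))" unfolding rm.test_vec_def using vmeas_cheb by blast
  have f: "(\<lambda>\<omega>. form ?m (rm.test_vec ?m (vecn n \<omega>))) \<in> borel_measurable samples"
    unfolding form_def
    by (intro borel_measurable_add borel_measurable_times borel_measurable_const vmeas_simps(6) v
        vmeas_unary)
  have "{\<omega> \<in> space samples. form ?m (rm.test_vec ?m (vecn n \<omega>)) < 0} \<in> sets samples"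
    by (intro borel_measurable_less f borel_measurable_const)
  then show ?thesis by (simp add: rm.outcome_def)
qed

lemma unlucky_bound:
  "{\<omega>. rm.unlucky e l \<omega>} \<in> sets samples" "measure samples {\<omega>. rm.unlucky e l \<omega>} \<le> pf"
proof -
  let ?u = "rm.low_vec (rm.mid_of e l)"
  have "{\<omega> \<in> space samples. \<not> 4 * (\<Sum>i<n. (\<omega> i)\<^sup>2) < 32 * real n / pf ^ 3 * (\<Sum>i<n. coord ?u i * \<omega> i)\<^sup>2} \<in> sets samples"
    by measurable
  then show "{\<omega>. rm.unlucky e l \<omega>} \<in> sets samples" by (simp add: rm.unlucky_def)
  have "in_dim n ?u" "inner ?u ?u = 1" using rm.low_vec by blast+
  then have "(\<Sum>i<n. (coord ?u i)\<^sup>2) = 1" by (simp add: inner_in_dim[of n] power2_eq_square)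
  from gaussian_overlap[OF this n_pos pf_pos]
  show "measure samples {\<omega>. rm.unlucky e l \<omega>} \<le> pf" by (simp add: rm.unlucky_def)
qed

text \<open>A union bound over the 2 \<open>steps\<close> tests, each failing with probability at
  most \<open>pf\<close> whatever the earlier outcomes were.\<close>

lemma lucky_probability:
  "{\<omega>. rm.lucky \<omega>} \<in> sets samples" "1 - p \<le> measure samples {\<omega>. rm.lucky \<omega>}"
proof -
  define F where "F = (\<lambda>e d j. {\<omega>. rm.unlucky e (test_path (rm.outcome e) n d \<omega> j) (\<lambda>i. \<omega> (d + j * n + i))})"
  have loc: "rm.outcome e l \<omega> = rm.outcome e l \<omega>'" if "\<And>i. i < n \<Longrightarrow> \<omega> i = \<omega>' i" for e l \<omega> \<omega>'
  proof -
    have "vecn n \<omega> = vecn n \<omega>'" using that by (intro fvec_eqI) auto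
    then show ?thesis by (simp add: rm.outcome_def)
  qed
  have F: "F e d j \<in> sets samples" "measure samples (F e d j) \<le> pf" for e d j
    unfolding F_def by (rule adaptive_failure[OF loc outcome_measurable unlucky_bound]; assumption)+
  let ?G = "\<lambda>e d. \<Union>j<steps. F e d j"
  have G: "?G e d \<in> sets samples" "measure samples (?G e d) \<le> real steps * pf" for e d
  proof -
    show "?G e d \<in> sets samples" using F by auto
    have "measure samples (?G e d) \<le> (\<Sum>j<steps. measure samples (F e d j))"
      using F by (intro measure_UNION_le) auto
    also have "\<dots> \<le> (\<Sum>j<steps. pf)" by (intro sum_mono F)
    finally show "measure samples (?G e d) \<le> real steps * pf" by simp
  qed
  let ?B = "?G (2 * \<zeta>) 0 \<union> ?G (- \<zeta>) (steps * n)"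
  have eq: "{\<omega>. rm.lucky \<omega>} = space samples - ?B" by (auto simp: rm.lucky_def F_def)
  show "{\<omega>. rm.lucky \<omega>} \<in> sets samples" unfolding eq by (intro sets.Diff sets.top sets.Un G(1))
  have "measure samples ?B \<le> measure samples (?G (2 * \<zeta>) 0) + measure samples (?G (- \<zeta>) (steps * n))"
    using G by (intro measure_Un_le) auto
  also have "\<dots> \<le> real steps * pf + real steps * pf" by (intro add_mono G)
  also have "\<dots> = p" unfolding pf_def using steps_pos by simp
  finally have "measure samples ?B \<le> p" .
  moreover have "measure samples (space samples - ?B) = 1 - measure samples ?B"
    by (rule sp.prob_compl) (intro sets.Un G(1))
  ultimately show "1 - p \<le> measure samples {\<omega>. rm.lucky \<omega>}" unfolding eq by simp
qed

lemma success:
  defines "P \<equiv> compile 0 (init_code ;; main_code ;; output_code)"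
  defines "s \<equiv> gtrs_input n A0 A1 b0 b1 c0 c1 \<xi> \<zeta> \<gamma>h \<epsilon> p"
  shows "halts_within P \<omega> s
      (16400000 * (real (nnz A0 + nnz A1) * \<kappa>\<^sup>2 * sqrt \<zeta> / sqrt \<epsilon> * log1 (real n / p) * log1 (\<kappa> / \<epsilon>))
        * (loglog1 (real n / p) * loglog1 \<kappa> * loglog1 (\<kappa> / \<epsilon>)) ^ 1)"
    and "1 - p \<le> measure samples {\<omega> \<in> space samples.
       quad A0 b0 c0 (output_vec n (final_state P \<omega> s)) \<le> Opt n A0 A1 b0 b1 c0 c1 + \<epsilon> \<and>
       quad A1 b1 c1 (output_vec n (final_state P \<omega> s)) = 0}"
proof -
  \<comment> \<open>T does not depend on the samples, so the program has halted by time T for every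
    \<omega>, and measurability of runs of fixed length applies.\<close>
  define T where "T = (steps * (iters * 38 + 42) + rounds * 50 + 100) * rm.U"
  have pc: "pc s = 0" by (simp add: s_def gtrs_input_def)
  have ex: "\<exists>s' :: state. halted P (run P \<omega> s T) \<and> rmem (run P \<omega> s T) = rmem s' \<and> final_state P \<omega> s = run P \<omega> s T \<and>
     (rm.lucky \<omega> \<longrightarrow> q1 (vecn n (rmem s')) = 0 \<and> q0 (vecn n (rmem s')) \<le> Opt n A0 A1 b0 b1 c0 c1 + \<epsilon>)" for \<omega>
  proof -
    obtain s' where s': "executes_within \<omega> (init_code ;; main_code ;; output_code) s T s'"
      "rm.lucky \<omega> \<longrightarrow> q1 (vecn n (rmem s')) = 0 \<and> q0 (vecn n (rmem s')) \<le> Opt n A0 A1 b0 b1 c0 c1 + \<epsilon>"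
      using full_correct unfolding T_def s_def by blast
    note c = compiled_run[OF s'(1) pc, folded P_def]
    show ?thesis by (rule exI[of _ s']) (use c s'(2) in simp)
  qed
  have q: "quad A0 b0 c0 (output_vec n t) = q0 (vecn n (rmem t))" "quad A1 b1 c1 (output_vec n t) = q1 (vecn n (rmem t))" for t
    unfolding output_vec_def by (simp_all add: quad_q)
  \<comment> \<open>From n \<le> N the unit of cost is at most 40 N; together with 410000 this gives
    the constant 16400000.\<close>
  have U: "real rm.U \<le> 40 * real (nnz A0 + nnz A1)"
    using dim_le_nnz by (simp add: rm.U_def nnz_eq_length)
  show "halts_within P \<omega> s
      (16400000 * (real (nnz A0 + nnz A1) * \<kappa>\<^sup>2 * sqrt \<zeta> / sqrt \<epsilon> * log1 (real n / p) * log1 (\<kappa> / \<epsilon>))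
        * (loglog1 (real n / p) * loglog1 \<kappa> * loglog1 (\<kappa> / \<epsilon>)) ^ 1)"
  proof -
    define M where "M = loglog1 \<kappa> * loglog1 (\<kappa> / \<epsilon>)"
    define E where "E = \<kappa>\<^sup>2 * sqrt \<zeta> / sqrt \<epsilon> * log1 (real n / p) * log1 (\<kappa> / \<epsilon>)"
    have M: "1 \<le> M" unfolding M_def by (intro le_product loglog1_ge1)
    have E0: "0 \<le> E" unfolding E_def using zeta_ge1 eps0 log1_ge1[of "real n / p"] log1_ge1[of "\<kappa> / \<epsilon>"] by simp
    have ll: "1 * M \<le> loglog1 (real n / p) * M" using M loglog1_ge1[of "real n / p"] by (intro mult_right_mono) auto
    have "real T \<le> (410000 * (E * M)) * (40 * real (nnz A0 + nnz A1))"
      unfolding T_def of_nat_mult[of _ rm.U]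
    proof (rule mult_mono[OF _ U])
      show "real (steps * (iters * 38 + 42) + rounds * 50 + 100) \<le> 410000 * (E * M)"
        using total_time_le unfolding E_def M_def .
      show "0 \<le> 410000 * (E * M)" using E0 M by simp
    qed simp
    also have "\<dots> \<le> (410000 * (E * (loglog1 (real n / p) * M))) * (40 * real (nnz A0 + nnz A1))"
      using ll E0 by (intro mult_right_mono mult_left_mono) auto
    also have "\<dots> = 16400000 * (real (nnz A0 + nnz A1) * \<kappa>\<^sup>2 * sqrt \<zeta> / sqrt \<epsilon> * log1 (real n / p) * log1 (\<kappa> / \<epsilon>))
        * (loglog1 (real n / p) * loglog1 \<kappa> * loglog1 (\<kappa> / \<epsilon>)) ^ 1"
      by (simp add: E_def M_def)
    finally show ?thesis unfolding halts_within_def using ex by blast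
  qed
  let ?S = "{\<omega> \<in> space samples.
       quad A0 b0 c0 (output_vec n (final_state P \<omega> s)) \<le> Opt n A0 A1 b0 b1 c0 c1 + \<epsilon> \<and>
       quad A1 b1 c1 (output_vec n (final_state P \<omega> s)) = 0}"
  have fin: "final_state P \<omega> s = run P \<omega> s T" for \<omega> using ex by blast
  have v: "vmeas (\<lambda>\<omega>. vecn n (rmem (run P \<omega> s T)))"
    by (rule vmeas_vecn) (use measurable_state_run[of P s T] in \<open>unfold measurable_state_def, blast\<close>)
  have b: "vmeas (\<lambda>_. \<beta>0)" "vmeas (\<lambda>_. \<beta>1)"
    unfolding vmeas_def by (intro conjI allI in_dim_beta borel_measurable_const)+
  have f: "(\<lambda>\<omega>. q0 (vecn n (rmem (run P \<omega> s T)))) \<in> borel_measurable samples"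
    "(\<lambda>\<omega>. q1 (vecn n (rmem (run P \<omega> s T)))) \<in> borel_measurable samples"
    unfolding q0_def q1_def
    by (intro borel_measurable_add borel_measurable_times borel_measurable_const vmeas_simps(6) v b
        vmeas_unary)+
  have S: "?S \<in> sets samples" unfolding fin q
    by (intro sets.sets_Collect_conj borel_measurable_le borel_measurable_eq f borel_measurable_const)
  have "{\<omega>. rm.lucky \<omega>} \<subseteq> ?S"
  proof
    fix \<omega> assume "\<omega> \<in> {\<omega>. rm.lucky \<omega>}"
    then show "\<omega> \<in> ?S" using ex[of \<omega>] by (auto simp: q fin)
  qed
  then have "measure samples {\<omega>. rm.lucky \<omega>} \<le> measure samples ?S" using S by (intro sp.finite_measure_mono) auto
  then show "1 - p \<le> measure samples ?S" using lucky_probability(2) by linarith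
qed

end

theorem theorem7:
  shows "\<exists>(P :: program) (C :: real) (k :: nat).
    \<forall>(n :: nat) (A0 :: real mat) (A1 :: real mat) (b0 :: real vec) (b1 :: real vec)
      (c0 :: real) (c1 :: real) (\<xi> :: real) (\<zeta> :: real) (\<gamma>h :: real) (\<epsilon> :: real) (p :: real)
      (\<kappa> :: real) (N :: nat) (s :: state).
      assumption_A n A0 A1 b0 b1 c1 \<longrightarrow>
      regular A0 A1 \<xi> \<zeta> \<longrightarrow>
      0 \<le> \<gamma>h \<longrightarrow> \<xi> \<le> lambda_min (pencil A0 A1 \<gamma>h) \<longrightarrow>
      \<kappa> = \<zeta> / \<xi> \<longrightarrow>
      0 < \<epsilon> \<longrightarrow> \<epsilon> \<le> \<kappa> ^ 3 * \<xi> \<longrightarrow>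
      0 < p \<longrightarrow>
      N = nnz A0 + nnz A1 \<longrightarrow>
      s = gtrs_input n A0 A1 b0 b1 c0 c1 \<xi> \<zeta> \<gamma>h \<epsilon> p \<longrightarrow>
        (\<forall>\<omega>. halts_within P \<omega> s
           (C * (real N * \<kappa>\<^sup>2 * sqrt \<zeta> / sqrt \<epsilon> * log1 (real n / p) * log1 (\<kappa> / \<epsilon>))
              * (loglog1 (real n / p) * loglog1 \<kappa> * loglog1 (\<kappa> / \<epsilon>)) ^ k)) \<and>
        measure samples
          {\<omega> \<in> space samples.
             quad A0 b0 c0 (output_vec n (final_state P \<omega> s))
               \<le> Opt n A0 A1 b0 b1 c0 c1 + \<epsilon> \<and>
             quad A1 b1 c1 (output_vec n (final_state P \<omega> s)) = 0}
          \<ge> 1 - p"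
proof (intro exI allI impI)
  fix n :: nat and A0 A1 :: "real mat" and b0 b1 :: "real vec"
    and c0 c1 \<xi> \<zeta> \<gamma>h \<epsilon> p \<kappa> :: real and N :: nat and s :: state
  assume A: "assumption_A n A0 A1 b0 b1 c1" "regular A0 A1 \<xi> \<zeta>" "0 \<le> \<gamma>h"
      "\<xi> \<le> lambda_min (pencil A0 A1 \<gamma>h)" and \<kappa>: "\<kappa> = \<zeta> / \<xi>" and e: "0 < \<epsilon>" "\<epsilon> \<le> \<kappa> ^ 3 * \<xi>" "0 < p"
    and N: "N = nnz A0 + nnz A1" and s: "s = gtrs_input n A0 A1 b0 b1 c0 c1 \<xi> \<zeta> \<gamma>h \<epsilon> p"
  interpret g: gtrs n A0 A1 b0 b1 c0 c1 \<xi> \<zeta> \<gamma>h \<epsilon> p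
    by unfold_locales (use A e in \<open>simp_all only: \<kappa>\<close>)
  have k: "g.\<kappa> = \<kappa>" by (simp add: g.\<kappa>_def \<kappa>)
  show "(\<forall>\<omega>. halts_within (compile 0 (init_code ;; main_code ;; output_code)) \<omega> s
           (16400000 * (real N * \<kappa>\<^sup>2 * sqrt \<zeta> / sqrt \<epsilon> * log1 (real n / p) * log1 (\<kappa> / \<epsilon>))
              * (loglog1 (real n / p) * loglog1 \<kappa> * loglog1 (\<kappa> / \<epsilon>)) ^ 1)) \<and>
        measure samples
          {\<omega> \<in> space samples.
             quad A0 b0 c0 (output_vec n (final_state (compile 0 (init_code ;; main_code ;; output_code)) \<omega> s))
               \<le> Opt n A0 A1 b0 b1 c0 c1 + \<epsilon> \<and>
             quad A1 b1 c1 (output_vec n (final_state (compile 0 (init_code ;; main_code ;; output_code)) \<omega> s)) = 0}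
          \<ge> 1 - p"
    unfolding s N using g.success unfolding k by blast
qed

end
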